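(* Let $q\ge 1$, let $U\subset\mathbb{R}^q$ be an open box (a product of $q$ open intervals), $V\subset\mathbb{R}$ an open interval, and let $y:U\to V$ be implicitly defined by $g:U\times V\to\mathbb{R}$, i.e. $g(\mathbf{x},y(\mathbf{x}))=0$ and $\frac{\partial g}{\partial y}(\mathbf{x},y(\mathbf{x}))\neq 0$ for all $\mathbf{x}\in U$, where $g$ and $y$ are sufficiently smooth. Let $\mathbf{n}=(n_1,\ldots,n_q)\in\mathbb{N}^q$ and let $\{x^1_0,\ldots,x^1_{n_1}\}\times\cdots\times\{x^q_0,\ldots,x^q_{n_q}\}\subset U$ be any rectangular grid, with $x^j_0\le\cdots\le x^j_{n_j}$ for $j=1,\ldots,q$ (coordinates may coincide). If $|\mathbf{n}|=n_1+\cdots+n_q\ge 2$, then $$[\mathbf{x}:\mathbf{0},\mathbf{n}]y=\sum_{\mathbf{0}=\mathbf{p}_0<\mathbf{p}_1<\cdots<\mathbf{p}_{|\mathbf{n}|}=\mathbf{n}}\ \sum_{\pi\in\mathcal{P}(\mathbf{p}_0,\mathbf{p}_1,\ldots,\mathbf{p}_{|\mathbf{n}|})}\ \prod_{(\mathbf{v}_0,\mathbf{v}_1,\ldots,\mathbf{v}_r)\in F(\pi)}\{\mathbf{v}_0\mathbf{v}_1\cdots\mathbf{v}_r\}g,$$ where the outer sum is over all sequences of points $\mathbf{p}_0,\ldots,\mathbf{p}_{|\mathbf{n}|}$ in $\mathbb{N}^q$ that are strictly increasing for the componentwise partial order and run from $\mathbf{0}$ to $\mathbf{n}$, $\mathcal{P}(\mathbf{p}_0,\ldots,\mathbf{p}_{|\mathbf{n}|})$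 denotes the set of partitions of the corresponding convex polygon, $F(\pi)$ is the set of faces of $\pi$, and the symbols $\{\mathbf{v}_0\cdots\mathbf{v}_r\}g$ are the expressions in divided differences of $g$ defined in the context.
   Context: Conventions: $\mathbb{N}=\{0,1,2,\ldots\}$. For $\mathbf{a}=(a_1,\ldots,a_q),\mathbf{b}=(b_1,\ldots,b_q)\in\mathbb{N}^q$, $\mathbf{a}\le\mathbf{b}$ means $a_j\le b_j$ for all $j$, and $\mathbf{a}<\mathbf{b}$ means $\mathbf{a}\le\mathbf{b}$ and $\mathbf{a}\ne\mathbf{b}$. $\mathbf{e}_1,\ldots,\mathbf{e}_q$ is the standard basis of $\mathbb{R}^q$. Empty products equal $1$. Divided differences. For a function $y$ on $U$ and a grid in $U$ with $x^j_0<\cdots<x^j_{n_j}$, $j=1,\ldots,q$, the divided difference $[x^1_0,\ldots,x^1_{n_1};\cdots;x^q_0,\ldots,x^q_{n_q}]y$ is defined recursively: if all $n_j=0$ it is $y(x^1_0,\ldots,x^q_0)$; if $n_j>0$, then it is $$\frac{[\ldots;x^j_1,\ldots,x^j_{n_j};\ldots]y-[\ldots;x^j_0,\ldots,x^j_{n_j-1};\ldots]y}{x^j_{n_j}-x^j_0},$$ where the other groups of points are unchanged; the result does not depend on which $j$ is used. It is symmetric in the points within each group, so it is defined for distinct points in any order. When points within a group coincide, the divided difference is defined by taking limits, for sufficiently smooth functions; for instance, if all points coalesce, $[x^1_0,\ldots,x^1_0;\cdots;x^q_0,\ldots,x^q_0]y$ (with $x^j_0$ repeated $n_j+1$ times)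 equals $\frac{1}{n_1!\cdots n_q!}\frac{\partial^{|\mathbf{n}|}y}{\partial\mathbf{x}^{\mathbf{n}}}(x^1_0,\ldots,x^q_0)$. Divided differences of $g$, a function of the $q+1$ variables $x^1,\ldots,x^q,y$, are defined in the same way, with the group of $y$-points separated from the others by a bar. Index notation. For $\mathbf{i}=(i^1,\ldots,i^q)$ with $\mathbf{0}\le\mathbf{i}\le\mathbf{n}$ put $\mathbf{x}_{\mathbf{i}}=(x^1_{i^1},\ldots,x^q_{i^q})$ and $y_{\mathbf{i}}=y(\mathbf{x}_{\mathbf{i}})$. For $\mathbf{a}\le\mathbf{b}$, $$[\mathbf{x}:\mathbf{a},\mathbf{b}]y:=[x^1_{a_1},x^1_{a_1+1},\ldots,x^1_{b_1};\cdots;x^q_{a_q},x^q_{a_q+1},\ldots,x^q_{b_q}]y.$$ For divided differences of $g$ only indices are written: $$[i_{1,0}\cdots i_{1,s_1};\cdots;i_{q,0}\cdots i_{q,s_q}\,|\,\mathbf{j}_0\cdots\mathbf{j}_t]g:=[x^1_{i_{1,0}},\ldots,x^1_{i_{1,s_1}};\cdots;x^q_{i_{q,0}},\ldots,x^q_{i_{q,s_q}}\,|\,y_{\mathbf{j}_0},\ldots,y_{\mathbf{j}_t}]g.$$ Compatible tuples. Let $\mathbf{i}_0<\mathbf{i}_1<\cdots<\mathbf{i}_k$ be a sequence in $\mathbb{N}^q$. A tuple $(s_1,\ldots,s_q,t)$ of nonnegative integers with $s_1+\cdots+s_q+t=k$ is compatible with $(\mathbf{i}_0,\ldots,\mathbf{i}_k)$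 if the sequence starts with $s_1$ steps equal to $\mathbf{e}_1$, followed by $s_2$ steps equal to $\mathbf{e}_2$, ..., followed by $s_q$ steps equal to $\mathbf{e}_q$, followed by $t$ arbitrary steps; i.e. $\mathbf{i}_j-\mathbf{i}_{j-1}=\mathbf{e}_r$ whenever $s_1+\cdots+s_{r-1}<j\le s_1+\cdots+s_r$, $r=1,\ldots,q$. Write $|\mathbf{s}|=s_1+\cdots+s_q$. The symbol $\{\mathbf{i}_0\cdots\mathbf{i}_k\}g$. For $\mathbf{i}_0<\cdots<\mathbf{i}_k$ with $\mathbf{i}_j=(i_j^1,\ldots,i_j^q)$, $$\{\mathbf{i}_0\cdots\mathbf{i}_k\}g:=\sum_{(s_1,\ldots,s_q,t)\ \text{compatible}}\left(-\frac{[i_0^1\cdots(i_0^1+s_1);\cdots;i_0^q\cdots(i_0^q+s_q)\,|\,\mathbf{i}_{|\mathbf{s}|}\,\mathbf{i}_{|\mathbf{s}|+1}\cdots\mathbf{i}_{|\mathbf{s}|+t}]g}{[i_0^1;\cdots;i_0^q\,|\,\mathbf{i}_0\,\mathbf{i}_k]g}\right)\times\prod_{r=1}^q\ \prod_{\substack{j=|\mathbf{s}|+1\\ \mathbf{i}_j-\mathbf{i}_{j-1}=\mathbf{e}_r}}^{|\mathbf{s}|+t}\left(-\frac{[i_{j-1}^1;\cdots;i_{j-1}^{r-1};i_{j-1}^r\,i_j^r;i_j^{r+1};\cdots;i_j^q\,|\,\mathbf{i}_j]g}{[i_{j-1}^1;\cdots;i_{j-1}^q\,|\,\mathbf{i}_{j-1}\,\mathbf{i}_j]g}\right),$$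 where $i_0^r\cdots(i_0^r+s_r)$ denotes the list of consecutive indices $i_0^r,i_0^r+1,\ldots,i_0^r+s_r$. Polygon partitions. With a sequence of labels $\mathbf{p}_0,\ldots,\mathbf{p}_n$ ($n\ge 2$) associate a convex polygon with $n+1$ vertices labelled $\mathbf{p}_0,\ldots,\mathbf{p}_n$ in order. A partition of the polygon is the result of connecting certain (possibly no) pairs of nonadjacent vertices with straight line segments, no two of which cross in the interior (they may share endpoints). $\mathcal{P}(\mathbf{p}_0,\ldots,\mathbf{p}_n)$ is the set of all such partitions. For $\pi\in\mathcal{P}(\mathbf{p}_0,\ldots,\mathbf{p}_n)$, $F(\pi)$ is the set of bounded faces of the resulting plane graph, each face being represented by the subsequence $(\mathbf{v}_0,\ldots,\mathbf{v}_r)$ (of length at least three) of $(\mathbf{p}_0,\ldots,\mathbf{p}_n)$ consisting of its vertices.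
   Formalization: The formal theorem also assumes that all denominators [i^1;...;i^q | i k]g with 0 ≤ i < k ≤ n are nonzero; this does not follow from ∂g/∂y ≠ 0 on the graph of y, and without it the right-hand side is undefined. *)

theory Defs
  imports "HOL-Analysis.Analysis"
begin

section \<open>Smoothness\<close>

text \<open>\<open>Ck_on k f S\<close>, for open \<open>S\<close>: the function \<open>f\<close> is \<open>k\<close> times continuously differentiable on \<open>S\<close>.\<close>

fun Ck_on :: "nat \<Rightarrow> ('a::real_normed_vector \<Rightarrow> real) \<Rightarrow> 'a set \<Rightarrow> bool" where
  "Ck_on 0 f S \<longleftrightarrow> continuous_on S f"
| "Ck_on (Suc k) f S \<longleftrightarrow>
     (\<forall>x\<in>S. f differentiable (at x)) \<and> (\<forall>v. Ck_on k (\<lambda>x. frechet_derivative f (at x) v) S)"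


section \<open>Divided differences\<close>

text \<open>The variables of \<open>f\<close> are indexed by the finite type \<open>'d\<close>, and \<open>X j\<close> is the (nonempty) group
  of points for the variable \<open>j\<close>. The recursion below is meant for groups of pairwise distinct
  points. It unfolds an arbitrary group with more than one point; by \<open>dd_distinct_rec\<close>,
  the choice of that group is irrelevant.\<close>

function dd_distinct :: "(('d::finite \<Rightarrow> real) \<Rightarrow> real) \<Rightarrow> ('d \<Rightarrow> real list) \<Rightarrow> real" where
  "dd_distinct f X =
     (if \<forall>j. length (X j) \<le> 1 then f (\<lambda>j. hd (X j))
      else let j = (SOME j. length (X j) > 1) in
        (dd_distinct f (X(j := tl (X j))) - dd_distinct f (X(j := butlast (X j))))
          / (last (X j) - hd (X j)))"
  by auto

lemma sum_length_update_less:
  fixes X :: "'d::finite \<Rightarrow> 'a list"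
  assumes "length ys < length (X j)"
  shows "(\<Sum>i\<in>UNIV. length ((X(j := ys)) i)) < (\<Sum>i\<in>UNIV. length (X i))"
  by (rule sum_strict_mono_ex1) (use assms in auto)

lemma length_SOME_group:
  assumes "\<not> (\<forall>j. length (X j) \<le> 1)"
  shows "length (X (SOME j. length (X j) > 1)) > 1"
  using assms someI_ex[of "\<lambda>j. length (X j) > 1"] by (auto simp: not_le)

termination dd_distinct
proof (relation "Wellfounded.measure (\<lambda>(f, X). \<Sum>j\<in>UNIV. length (X j))", goal_cases)
  case (2 f X j)
  then show ?case
    using length_SOME_group[of X] sum_length_update_less[of "tl (X j)" X j] by auto
next
  case (3 f X j)
  then show ?case
    using length_SOME_group[of X] sum_length_update_less[of "butlast (X j)" X j] by auto
qed auto

declare dd_distinct.simps [simp del]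

lemma dd_distinct_rec:
  assumes "length (X j) > 1"
  shows "dd_distinct f X =
           (dd_distinct f (X(j := tl (X j))) - dd_distinct f (X(j := butlast (X j))))
             / (last (X j) - hd (X j))"
  using assms
proof (induction "\<Sum>i\<in>UNIV. length (X i)" arbitrary: X j rule: less_induct)
  case less
  define k where "k = (SOME k. length (X k) > 1)"
  have nt: "\<not> (\<forall>j. length (X j) \<le> 1)"
    using less.prems by (auto simp: not_le)
  have k: "length (X k) > 1"
    using length_SOME_group[OF nt] by (simp add: k_def)
  have rec: "dd_distinct f X =
      (dd_distinct f (X(k := tl (X k))) - dd_distinct f (X(k := butlast (X k))))
        / (last (X k) - hd (X k))"
    by (subst dd_distinct.simps) (simp only: if_not_P[OF nt] Let_def k_def)
  show ?case
  proof (cases "j = k")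
    case True
    then show ?thesis using rec by simp
  next
    case False
    have IH: "dd_distinct f (X(u := ys)) =
        (dd_distinct f (X(u := ys, v := tl (X v))) - dd_distinct f (X(u := ys, v := butlast (X v))))
          / (last (X v) - hd (X v))"
      if "u \<noteq> v" "length (X v) > 1" "length ys < length (X u)" for u v ys
      using less.hyps[of "X(u := ys)" v] that sum_length_update_less[of ys X u] by auto
    have l: "length (tl (X u)) < length (X u)" "length (butlast (X u)) < length (X u)"
      if "length (X u) > 1" for u
      using that by auto
    have comm: "X(j := ys, k := zs) = X(k := zs, j := ys)" for ys zs
      using False by (rule fun_upd_twist)
    show ?thesis
      unfolding rec
      using False less.prems k l
      by (simp add: IH[of k j] IH[of j k] comm diff_divide_distrib)
        (simp add: mult.commute algebra_simps)
  qed
qed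

text \<open>Tuples of groups of pairwise distinct points approaching \<open>X\<close>.\<close>

definition distinct_near :: "('d \<Rightarrow> real list) \<Rightarrow> ('d \<Rightarrow> real list) filter" where
  "distinct_near X = (INF e\<in>{0<..}. principal
     {Z. \<forall>j. distinct (Z j) \<and> list_all2 (\<lambda>z x. dist z x < e) (Z j) (X j)})"

definition divdiff :: "(('d::finite \<Rightarrow> real) \<Rightarrow> real) \<Rightarrow> ('d \<Rightarrow> real list) \<Rightarrow> real" where
  "divdiff f X =
     (if \<forall>j. distinct (X j) then dd_distinct f X else Lim (distinct_near X) (dd_distinct f))"


section \<open>Divided differences on a grid\<close>

text \<open>The type \<open>'q\<close> indexes the coordinates; its order is the order of the coordinates
  \<open>1, \<dots>, q\<close>. The grid is given by \<open>x\<close>, where \<open>x j i\<close> is the \<open>i\<close>-th point in coordinate \<open>j\<close>.\<close>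

definition grid_point :: "('q::finite \<Rightarrow> nat \<Rightarrow> real) \<Rightarrow> nat ^ 'q \<Rightarrow> real ^ 'q" where
  "grid_point x i = (\<chi> j. x j (i $ j))"

definition divdiff_y ::
  "(real ^ 'q::finite \<Rightarrow> real) \<Rightarrow> ('q \<Rightarrow> nat \<Rightarrow> real) \<Rightarrow> nat ^ 'q \<Rightarrow> nat ^ 'q \<Rightarrow> real" where
  "divdiff_y y x a b = divdiff (\<lambda>u. y (\<chi> j. u j)) (\<lambda>j. map (x j) [a $ j ..< Suc (b $ j)])"

text \<open>For \<open>g\<close>, the variable \<open>x\<^sup>j\<close> has index \<open>Some j\<close> and the variable \<open>y\<close> has index \<open>None\<close>.\<close>

definition divdiff_g ::
  "((real ^ 'q) \<times> real \<Rightarrow> real) \<Rightarrow> (real ^ 'q \<Rightarrow> real) \<Rightarrow> ('q::finite \<Rightarrow> nat \<Rightarrow> real)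
     \<Rightarrow> ('q \<Rightarrow> nat list) \<Rightarrow> (nat ^ 'q) list \<Rightarrow> real" where
  "divdiff_g g y x I J =
     divdiff (\<lambda>u. g ((\<chi> j. u (Some j)), u None))
       (case_option (map (\<lambda>j. y (grid_point x j)) J) (\<lambda>r. map (x r) (I r)))"


section \<open>The symbol in the summation formula\<close>

definition compatible :: "(nat ^ 'q::{finite,linorder}) list \<Rightarrow> ('q \<Rightarrow> nat) \<Rightarrow> nat \<Rightarrow> bool" where
  "compatible v s t \<longleftrightarrow>
     (\<Sum>r\<in>UNIV. s r) + t = length v - 1 \<and>
     (\<forall>r j. (\<Sum>u\<in>{..<r}. s u) < j \<and> j \<le> (\<Sum>u\<in>{..r}. s u) \<longrightarrow> v ! j = v ! (j - 1) + axis r 1)"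

definition curly ::
  "((real ^ 'q::{finite,linorder}) \<times> real \<Rightarrow> real) \<Rightarrow> (real ^ 'q::{finite,linorder} \<Rightarrow> real) \<Rightarrow> ('q::{finite,linorder} \<Rightarrow> nat \<Rightarrow> real)
     \<Rightarrow> (nat ^ 'q::{finite,linorder}) list \<Rightarrow> real" where
  "curly g y x v =
     (\<Sum>(s, t) | compatible v s t.
        let S = (\<Sum>r\<in>UNIV. s r) in
        (- (divdiff_g g y x (\<lambda>r. [v ! 0 $ r ..< Suc (v ! 0 $ r + s r)]) (map ((!) v) [S ..< Suc (S + t)])
            / divdiff_g g y x (\<lambda>r. [v ! 0 $ r]) [v ! 0, v ! (length v - 1)]))
        * (\<Prod>r\<in>UNIV. \<Prod>j | S + 1 \<le> j \<and> j \<le> S + t \<and> v ! j = v ! (j - 1) + axis r 1.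
             - (divdiff_g g y x
                  (\<lambda>u. if u < r then [v ! (j - 1) $ u]
                       else if u = r then [v ! (j - 1) $ r, v ! j $ r]
                       else [v ! j $ u])
                  [v ! j]
                / divdiff_g g y x (\<lambda>u. [v ! (j - 1) $ u]) [v ! (j - 1), v ! j])))"


section \<open>Polygon partitions\<close>

text \<open>Points on a parabola are in strictly convex position, so \<open>vertex 0, \<dots>, vertex n\<close> are, in this
  order, the vertices of a convex polygon. Its sides and diagonals are given as pairs of indices.\<close>

definition vertex :: "nat \<Rightarrow> complex" where
  "vertex k = Complex (real k) ((real k)\<^sup>2)"

definition sides :: "nat \<Rightarrow> (nat \<times> nat) set" where
  "sides n = insert (0, n) {(a, Suc a) | a. a < n}"

definition diagonals :: "nat \<Rightarrow> (nat \<times> nat) set" where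
  "diagonals n = {(a, b). a < b \<and> b \<le> n} - sides n"

definition polygon_partitions :: "nat \<Rightarrow> (nat \<times> nat) set set" where
  "polygon_partitions n =
     {D. D \<subseteq> diagonals n \<and>
         (\<forall>(a, b)\<in>D. \<forall>(c, d)\<in>D. (a, b) \<noteq> (c, d) \<longrightarrow>
            open_segment (vertex a) (vertex b) \<inter> open_segment (vertex c) (vertex d) = {})}"

definition plane_graph :: "nat \<Rightarrow> (nat \<times> nat) set \<Rightarrow> complex set" where
  "plane_graph n D = (\<Union>(a, b)\<in>sides n \<union> D. closed_segment (vertex a) (vertex b))"

text \<open>The bounded faces of the partition \<open>D\<close> of the polygon with labels \<open>p\<close>, each represented by
  the subsequence of the labels of the vertices on its boundary.\<close>

definition faces :: "'a list \<Rightarrow> (nat \<times> nat) set \<Rightarrow> 'a list set" where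
  "faces p D =
     {nths p {k. vertex k \<in> frontier C} | C.
        C \<in> components (- plane_graph (length p - 1) D) \<and> bounded C}"


section \<open>Chains of multi-indices\<close>

definition abs_index :: "nat ^ 'q::finite \<Rightarrow> nat" where
  "abs_index n = (\<Sum>j\<in>UNIV. n $ j)"

definition chains_to :: "nat ^ 'q::finite \<Rightarrow> (nat ^ 'q) list set" where
  "chains_to n =
     {p. length p = abs_index n + 1 \<and> hd p = 0 \<and> last p = n \<and> sorted_wrt (<) p}"

end

theory Submission
  imports Defs
begin

text \<open>
  For a fixed grid, write \<open>Y a b\<close> for the divided difference of \<open>y\<close> over the subgrid from \<open>a\<close> to \<open>b\<close>.
  The formula comes from a recursion for \<open>Y a b\<close> that has the same shape as the obvious recursion for
  partitions of polygons.

  The first recursion is a chain rule. By the Leibniz rule \<open>grid_dd_Leibniz\<close>, divided differences over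
  subgrids multiply like the entries of triangular matrices. So the divided differences of \<open>f \<circ> y\<close> are
  given by the functional calculus of such matrices: \<open>f \<circ> y\<close> has over the grid from \<open>a\<close> to \<open>b\<close> the divided
  difference \<open>\<Sum> [y\<^bsub>v\<^sub>0\<^esub>, \<dots>, y\<^bsub>v\<^sub>k\<^esub>] f * Y v\<^sub>0 v\<^sub>1 * \<dots> * Y v\<^sub>k\<^sub>-\<^sub>1 v\<^sub>k\<close>, where the sum is over all chains
  \<open>a = v\<^sub>0 < \<dots> < v\<^sub>k = b\<close>. Splitting off the direct dependence on the grid point by another use of the
  Leibniz rule gives \<open>grid_dd_chain_rule\<close> for \<open>g (x, y x)\<close>. This composite vanishes. In the resulting identity
  \<open>implicit_chain_identity\<close>, the unknown \<open>Y a b\<close> occurs in one term only, with the coefficient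
  \<open>[a | a b] g\<close>. Solving for it expresses \<open>Y a b\<close> as the sum of \<open>curly\<close> over all chains with at least
  three points, times the divided differences of \<open>y\<close> over the steps that are not unit steps
  (\<open>Y_recursion\<close>). Over unit steps \<open>Y\<close> is known explicitly, and these values are the factors of
  the product in the definition of \<open>curly\<close>. The compatible tuples enumerate the ways in which a chain of
  the chain rule can be prolonged downwards to \<open>a\<close> by a path along the axes, first in the first
  direction, then in the second, and so on (\<open>sum_compatible\<close>).

  The second recursion: a partition of a polygon consists of the face at its base edge and of partitions
  of the polygons beyond the other edges of this face. If the polygon is labelled by a maximal
  chain from \<open>a\<close> to \<open>b\<close>, the labels of the base face form a chain with at least three points, and its
  steps that are not unit steps are the base edges of the smaller polygons. So the right-hand side of the
  theorem satisfies the same recursion (\<open>partition_sum_rec\<close>), and equality follows by induction.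

  Two points need work. First, grid points may coincide, and values of \<open>y\<close> may coincide even if grid points
  do not, whereas the algebra above is about pairwise distinct points. So the grid is spread
  and the values are perturbed. The perturbed values solve the equation only up to a small error, but the
  divided differences converge (\<open>dd_distinct_convergent\<close>), and in the limit the identity becomes exact.
  Convergence is proved by induction on the order, which is lowered by a difference quotient if a group
  contains two points with different limits and by the mean value theorem \<open>dd1_mean_value\<close> otherwise.

  Secondly, faces are defined as components of the complement of a plane graph. With the vertices on the
  parabola \<open>u = t\<^sup>2\<close>, the chord from \<open>a\<close> to \<open>b\<close> lies \<open>(t - a) * (b - t)\<close> above the parabola. So the position of
  chords relative to each other is decided by comparing products, and each face is the region below one
  chord and above finitely many others (\<open>bounded_components_eq\<close>).
\<close>

section \<open>Chords between points of a parabola\<close>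

text \<open>The line through \<open>vertex a\<close> and \<open>vertex b\<close>, as a function of the abscissa.\<close>

definition chord :: "nat \<Rightarrow> nat \<Rightarrow> real \<Rightarrow> real" where
  "chord a b t = (real a + real b) * t - real a * real b"

text \<open>Height above the parabola turns every comparison of chords into a comparison of products of two
  distances.\<close>

lemma chord_parabola: "chord a b t = t\<^sup>2 + (t - real a) * (real b - t)"
  by (simp add: chord_def algebra_simps power2_eq_square)

lemma closed_segment_vertex:
  assumes "a < b"
  shows "closed_segment (vertex a) (vertex b)
           = {z. real a \<le> Re z \<and> Re z \<le> real b \<and> Im z = chord a b (Re z)}" (is "?L = ?R")
proof (intro subset_antisym subsetI)
  fix z assume "z \<in> ?L"
  then obtain u where u: "0 \<le> u" "u \<le> 1" "z = (1 - u) *\<^sub>R vertex a + u *\<^sub>R vertex b"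
    by (auto simp: in_segment)
  have re: "Re z = real a + u * (real b - real a)"
    unfolding u(3) by (simp add: vertex_def algebra_simps)
  have im: "Im z = (1 - u) * (real a)\<^sup>2 + u * (real b)\<^sup>2"
    unfolding u(3) by (simp add: vertex_def)
  have "u * (real b - real a) \<le> 1 * (real b - real a)" "0 \<le> u * (real b - real a)"
    using u(1,2) assms by (auto intro!: mult_right_mono)
  moreover have "Im z = chord a b (Re z)"
    unfolding re im by (simp add: chord_def algebra_simps power2_eq_square)
  ultimately show "z \<in> ?R"
    using re by simp
next
  fix z assume z: "z \<in> ?R"
  define u where "u = (Re z - real a) / (real b - real a)"
  have ub: "u * (real b - real a) = Re z - real a"
    using assms by (simp add: u_def)
  have "0 \<le> u" "u \<le> 1"
    using z assms by (auto simp: u_def divide_simps)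
  moreover have "z = (1 - u) *\<^sub>R vertex a + u *\<^sub>R vertex b"
  proof (rule complex_eqI)
    show "Re z = Re ((1 - u) *\<^sub>R vertex a + u *\<^sub>R vertex b)"
      using ub by (simp add: vertex_def algebra_simps)
    have "chord a b (Re z) = (real a)\<^sup>2 + (Re z - real a) * (real a + real b)"
      by (simp add: chord_def algebra_simps power2_eq_square)
    also have "\<dots> = (1 - u) * (real a)\<^sup>2 + u * (real b)\<^sup>2"
      unfolding ub[symmetric] by (simp add: algebra_simps power2_eq_square)
    finally show "Im z = Im ((1 - u) *\<^sub>R vertex a + u *\<^sub>R vertex b)"
      using z by (simp add: vertex_def)
  qed
  ultimately show "z \<in> ?L"
    by (auto simp: in_segment)
qed

lemma open_segment_vertex:
  assumes "a < b"
  shows "open_segment (vertex a) (vertex b)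
           = {z. real a < Re z \<and> Re z < real b \<and> Im z = chord a b (Re z)}"
proof -
  have "z = vertex a \<longleftrightarrow> Re z = real a" "z = vertex b \<longleftrightarrow> Re z = real b"
    if "Im z = chord a b (Re z)" for z
    using that by (auto simp: complex_eq_iff vertex_def chord_def algebra_simps power2_eq_square)
  then show ?thesis
    unfolding open_segment_def closed_segment_vertex[OF assms]
    by (auto simp: vertex_def less_le)
qed

text \<open>Strict interleaving of the endpoints; chords with a common endpoint do not cross.\<close>

definition crossing :: "nat \<times> nat \<Rightarrow> nat \<times> nat \<Rightarrow> bool" where
  "crossing e f \<longleftrightarrow> fst e < fst f \<and> fst f < snd e \<and> snd e < snd f
                \<or> fst f < fst e \<and> fst e < snd f \<and> snd f < snd e"

lemma crossing_sym: "crossing e f \<Longrightarrow> crossing f e"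
  by (auto simp: crossing_def)

lemma nested_chord_less:
  assumes "c \<le> a" "b \<le> d" "(a, b) \<noteq> (c, d)" "real a < t" "t < real b"
  shows "chord a b t < chord c d t"
proof -
  have "(t - real a) * (real b - t) < (t - real c) * (real d - t)"
  proof (cases "c < a")
    case True
    then show ?thesis
      using assms by (intro mult_less_le_imp_less) auto
  next
    case False
    then show ?thesis
      using assms by (intro mult_le_less_imp_less) auto
  qed
  then show ?thesis by (simp add: chord_parabola)
qed

lemma nested_chord_le:
  assumes "c \<le> a" "b \<le> d" "real a \<le> t" "t \<le> real b"
  shows "chord a b t \<le> chord c d t"
proof -
  have "(t - real a) * (real b - t) \<le> (t - real c) * (real d - t)"
    using assms by (intro mult_mono) auto
  then show ?thesis by (simp add: chord_parabola)
qed

lemma chord_ge_parabola: "real a \<le> t \<Longrightarrow> t \<le> real b \<Longrightarrow> t\<^sup>2 \<le> chord a b t"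
  by (simp add: chord_parabola)

lemma chord_le_parabola: "a < b \<Longrightarrow> t \<le> real a \<or> real b \<le> t \<Longrightarrow> chord a b t \<le> t\<^sup>2"
  by (auto simp: chord_parabola mult_le_0_iff)

text \<open>This makes the geometric condition on partitions combinatorial. If the endpoints interleave, the
  two lines meet at an abscissa that lies between the two middle endpoints. If they do not, then
  overlapping chords are nested, and the outer one is strictly higher.\<close>

lemma disjoint_open_segments_iff:
  assumes "a < b" "c < d" "(a, b) \<noteq> (c, d)"
  shows "open_segment (vertex a) (vertex b) \<inter> open_segment (vertex c) (vertex d) = {}
           \<longleftrightarrow> \<not> crossing (a, b) (c, d)"
proof -
  have meet: "open_segment (vertex a) (vertex b) \<inter> open_segment (vertex c) (vertex d) \<noteq> {}"
    if "a < c" "c < b" "b < d" for a b c d :: nat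
  proof -
    \<comment> \<open>The abscissa at which the two lines meet.\<close>
    define t where "t = (real c * real d - real a * real b) / (real c + real d - real a - real b)"
    have pos: "0 < real c + real d - real a - real b"
      using that by linarith
    have "t - real c = (real c - real a) * (real b - real c) / (real c + real d - real a - real b)"
         "real b - t = (real d - real b) * (real b - real c) / (real c + real d - real a - real b)"
      using pos by (simp_all add: t_def field_simps)
    then have "t - real c > 0" "real b - t > 0"
      using pos that by simp_all
    moreover have "t * (real c + real d - real a - real b) = real c * real d - real a * real b"
      using pos by (simp add: t_def)
    then have "chord a b t = chord c d t"
      by (simp add: chord_def algebra_simps)
    ultimately have "Complex t (chord a b t)
        \<in> open_segment (vertex a) (vertex b) \<inter> open_segment (vertex c) (vertex d)"
      using that by (simp add: open_segment_vertex)
    then show ?thesis by blast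
  qed
  have "\<not> crossing (a, b) (c, d)" if "open_segment (vertex a) (vertex b) \<inter> open_segment (vertex c) (vertex d) = {}"
    using that meet[of a c b d] meet[of c a d b] by (auto simp: crossing_def Int_commute)
  moreover have False
    if nc: "\<not> crossing (a, b) (c, d)"
      and z: "z \<in> open_segment (vertex a) (vertex b)" "z \<in> open_segment (vertex c) (vertex d)" for z
  proof -
    have z': "real a < Re z" "Re z < real b" "real c < Re z" "Re z < real d"
      "chord a b (Re z) = chord c d (Re z)"
      using z assms by (auto simp: open_segment_vertex)
    then have "a < d" "c < b"
      by linarith+
    then have "a \<le> c \<and> d \<le> b \<or> c \<le> a \<and> b \<le> d"
      using nc assms by (auto simp: crossing_def)
    then show False
      using nested_chord_less[of a c d b "Re z"] nested_chord_less[of c a b d "Re z"] z' assms(3)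
      by auto
  qed
  ultimately show ?thesis by blast
qed

text \<open>Partitions of the polygon with vertices \<open>i, \<dots>, j\<close>. The indices are not shifted to start at \<open>0\<close>, so that
  the sub-polygons cut off by a chord are described by subsets of the same set of chords.\<close>

definition dissections :: "nat \<Rightarrow> nat \<Rightarrow> (nat \<times> nat) set set" where
  "dissections i j =
     {D. D \<subseteq> {(a, b). i \<le> a \<and> a + 2 \<le> b \<and> b \<le> j} - {(i, j)}
       \<and> (\<forall>e\<in>D. \<forall>f\<in>D. \<not> crossing e f)}"

lemma polygon_partitions_eq_dissections: "polygon_partitions N = dissections 0 N"
proof -
  have diag: "diagonals N = {(a, b). 0 \<le> a \<and> a + 2 \<le> b \<and> b \<le> N} - {(0, N)}"
    by (auto simp: diagonals_def sides_def)
  have "(case e of (a, b) \<Rightarrow> case f of (c, d) \<Rightarrow> (a, b) \<noteq> (c, d) \<longrightarrow>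
            open_segment (vertex a) (vertex b) \<inter> open_segment (vertex c) (vertex d) = {})
        \<longleftrightarrow> \<not> crossing e f" if "e \<in> diagonals N" "f \<in> diagonals N" for e f
  proof -
    obtain a b c d where ef: "e = (a, b)" "f = (c, d)"
      by (cases e, cases f)
    then have "a < b" "c < d"
      using that by (auto simp: diag)
    then show ?thesis
      using disjoint_open_segments_iff[of a b c d]
      by (cases "e = f") (auto simp: ef crossing_def)
  qed
  then have "(\<forall>e\<in>D. case e of (a, b) \<Rightarrow> \<forall>f\<in>D. case f of (c, d) \<Rightarrow> (a, b) \<noteq> (c, d) \<longrightarrow>
            open_segment (vertex a) (vertex b) \<inter> open_segment (vertex c) (vertex d) = {})
        \<longleftrightarrow> (\<forall>e\<in>D. \<forall>f\<in>D. \<not> crossing e f)" if "D \<subseteq> diagonals N" for D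
  proof -
    have "(\<forall>e\<in>D. case e of (a, b) \<Rightarrow> \<forall>f\<in>D. case f of (c, d) \<Rightarrow> R a b c d)
        \<longleftrightarrow> (\<forall>e\<in>D. \<forall>f\<in>D. case e of (a, b) \<Rightarrow> case f of (c, d) \<Rightarrow> R a b c d)"
      for R :: "nat \<Rightarrow> nat \<Rightarrow> nat \<Rightarrow> nat \<Rightarrow> bool"
      by auto
    moreover have "(\<forall>e\<in>D. \<forall>f\<in>D. case e of (a, b) \<Rightarrow> case f of (c, d) \<Rightarrow> (a, b) \<noteq> (c, d) \<longrightarrow>
            open_segment (vertex a) (vertex b) \<inter> open_segment (vertex c) (vertex d) = {})
        \<longleftrightarrow> (\<forall>e\<in>D. \<forall>f\<in>D. \<not> crossing e f)"
      using \<open>\<And>f e. _ \<Longrightarrow> _ \<Longrightarrow> _ = (\<not> crossing e f)\<close> that by (intro ball_cong refl) blast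
    ultimately show ?thesis
      by (simp only:)
  qed
  then show ?thesis
    unfolding polygon_partitions_def dissections_def diag[symmetric]
    by (intro Collect_cong conj_cong refl) simp
qed

section \<open>The faces of a dissected polygon\<close>

text \<open>Every bounded face lies directly below exactly one chord, its longest edge; this is a diagonal of
  the partition or the base edge. The face below \<open>e\<close> has those vertices between the endpoints of \<open>e\<close>
  that are not cut off from \<open>e\<close> by another chord.\<close>

definition face_vertices :: "(nat \<times> nat) set \<Rightarrow> nat \<times> nat \<Rightarrow> nat set" where
  "face_vertices D e =
     {k. fst e \<le> k \<and> k \<le> snd e \<and>
        \<not> (\<exists>f\<in>D. f \<noteq> e \<and> fst e \<le> fst f \<and> fst f < k \<and> k < snd f \<and> snd f \<le> snd e)}"

text \<open>The lower boundary of the face.\<close>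

definition face_edges :: "(nat \<times> nat) set \<Rightarrow> nat \<times> nat \<Rightarrow> (nat \<times> nat) set" where
  "face_edges D e =
     {(k, l). k \<in> face_vertices D e \<and> l \<in> face_vertices D e \<and> k < l
        \<and> (\<forall>m\<in>face_vertices D e. m \<le> k \<or> l \<le> m)}"

definition face_region :: "(nat \<times> nat) set \<Rightarrow> nat \<times> nat \<Rightarrow> complex set" where
  "face_region D e =
     {z. Im z < chord (fst e) (snd e) (Re z) \<and> (\<forall>(k, l)\<in>face_edges D e. chord k l (Re z) < Im z)}"

lemma dissectionsD:
  assumes "D \<in> dissections i j" "i + 2 \<le> j" "(a, b) \<in> insert (i, j) D"
  shows "i \<le> a" "a + 2 \<le> b" "b \<le> j"
  using assms by (auto simp: dissections_def)

lemma dissections_not_crossing: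
  assumes "D \<in> dissections i j" "e \<in> insert (i, j) D" "f \<in> insert (i, j) D"
  shows "\<not> crossing e f"
proof -
  have "\<not> crossing e f" if "e = (i, j)" "f \<in> insert (i, j) D" for e f
    using that assms(1) by (auto simp: crossing_def dissections_def)
  then show ?thesis
    using assms crossing_sym[of e f] by (auto simp: dissections_def)
qed

lemma face_vertices_endpoints:
  assumes "D \<in> dissections i j" "i + 2 \<le> j" "(a, b) \<in> insert (i, j) D"
  shows "a \<in> face_vertices D (a, b)" "b \<in> face_vertices D (a, b)"
  using dissectionsD(2)[OF assms] by (auto simp: face_vertices_def)

lemma face_vertices_bounds: "k \<in> face_vertices D e \<Longrightarrow> fst e \<le> k \<and> k \<le> snd e"
  by (simp add: face_vertices_def)

lemma finite_face_vertices: "finite (face_vertices D e)"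
  by (rule finite_subset[of _ "{fst e..snd e}"]) (auto simp: face_vertices_def)

text \<open>A lower edge is a side or a diagonal. If \<open>l\<close> is not the successor of \<open>k\<close>, then the vertices between
  them are cut off by chords inside \<open>[k, l]\<close>; the longest such chord that starts at \<open>k\<close> must end at \<open>l\<close>,
  since a chord cutting off its right endpoint would cross it or be longer.\<close>

lemma face_edge_cases:
  assumes D: "D \<in> dissections i j"
    and kl: "(k, l) \<in> face_edges D (a, b)"
  shows "l = Suc k \<or> (k, l) \<in> D \<and> (k, l) \<noteq> (a, b)"
proof (cases "l = Suc k")
  case False
  define S where "S = {d. (k, d) \<in> D \<and> (k, d) \<noteq> (a, b) \<and> k < d \<and> d \<le> l}"
  have kl': "k \<in> face_vertices D (a, b)" "l \<in> face_vertices D (a, b)" "k < l"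
    "\<And>m. k < m \<Longrightarrow> m < l \<Longrightarrow> m \<notin> face_vertices D (a, b)"
    using kl by (fastforce simp: face_edges_def)+
  have bds: "a \<le> k" "l \<le> b"
    using kl' by (auto dest: face_vertices_bounds)
  have covered: "\<exists>c d. (c, d) \<in> D \<and> (c, d) \<noteq> (a, b) \<and> k \<le> c \<and> c < m \<and> m < d \<and> d \<le> l"
    if m: "k < m" "m < l" for m
  proof -
    obtain c d where cd: "(c, d) \<in> D" "(c, d) \<noteq> (a, b)" "a \<le> c" "c < m" "m < d" "d \<le> b"
      using kl'(4)[OF m] m bds by (fastforce simp: face_vertices_def)
    have "\<not> (c < k \<and> k < d)" "\<not> (c < l \<and> l < d)"
      using kl'(1,2) cd by (auto simp: face_vertices_def)
    then show ?thesis
      using cd m by (intro exI[of _ c] exI[of _ d]) auto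
  qed
  have fin: "finite S"
    by (rule finite_subset[of _ "{..l}"]) (auto simp: S_def)
  have "Suc k < l"
    using False kl'(3) by simp
  then obtain d0 where "d0 \<in> S"
    using covered[of "Suc k"] by (force simp: S_def less_Suc_eq_le)
  then have max: "Max S \<in> S" "\<And>d. d \<in> S \<Longrightarrow> d \<le> Max S"
    using fin by (auto intro: Max_in)
  have "Max S = l"
  proof (rule ccontr)
    assume "Max S \<noteq> l"
    then have lt: "k < Max S" "Max S < l"
      using max(1) by (auto simp: S_def)
    obtain c d where cd: "(c, d) \<in> D" "(c, d) \<noteq> (a, b)" "k \<le> c" "c < Max S" "Max S < d" "d \<le> l"
      using covered[OF lt] by blast
    have "(k, Max S) \<in> D"
      using max(1) by (simp add: S_def)
    then have "\<not> crossing (k, Max S) (c, d)"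
      using D cd(1) by (auto simp: dissections_def)
    then have "c = k"
      using cd by (auto simp: crossing_def)
    then have "d \<in> S"
      using cd by (auto simp: S_def)
    then show False
      using max(2) cd(5) by fastforce
  qed
  then show ?thesis
    using max(1) by (simp add: S_def)
qed simp

lemma face_edge_exists:
  assumes D: "D \<in> dissections i j" and ij: "i + 2 \<le> j" and ab: "(a, b) \<in> insert (i, j) D"
    and t: "real a \<le> t" "t \<le> real b"
  shows "\<exists>(k, l)\<in>face_edges D (a, b). real k \<le> t \<and> t \<le> real l"
proof -
  let ?K = "face_vertices D (a, b)"
  have ends: "a \<in> ?K" "b \<in> ?K" and lt: "a < b"
    using face_vertices_endpoints[OF D ij ab] dissectionsD[OF D ij ab] by auto
  \<comment> \<open>The first vertex of the face at or after the abscissa and its predecessor.\<close>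
  define l where "l = (LEAST l. l \<in> ?K \<and> a < l \<and> t \<le> real l)"
  have l: "l \<in> ?K" "a < l" "t \<le> real l"
    and least: "\<And>m. m \<in> ?K \<Longrightarrow> a < m \<Longrightarrow> t \<le> real m \<Longrightarrow> l \<le> m"
    using LeastI[of "\<lambda>l. l \<in> ?K \<and> a < l \<and> t \<le> real l" b] ends lt t
    by (auto simp: l_def intro: Least_le)
  define k where "k = Max {k \<in> ?K. k < l}"
  have fin: "finite {k \<in> ?K. k < l}" and ne: "{k \<in> ?K. k < l} \<noteq> {}"
    using finite_face_vertices[of D "(a, b)"] ends l by auto
  have k: "k \<in> ?K" "k < l" and max: "\<And>m. m \<in> ?K \<Longrightarrow> m < l \<Longrightarrow> m \<le> k"
    using Max_in[OF fin ne] Max_ge[OF fin] by (auto simp: k_def)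
  have "(k, l) \<in> face_edges D (a, b)"
    using k l max by (fastforce simp: face_edges_def not_le)
  moreover have "real k \<le> t"
  proof (cases "k = a")
    case False
    then have "a < k"
      using face_vertices_bounds[OF k(1)] by simp
    then show ?thesis
      using least[OF k(1)] k(2) by fastforce
  qed (use t in simp)
  ultimately show ?thesis
    using l(3) by blast
qed

text \<open>A face is not degenerate: a chord cannot be its own lower edge.\<close>

lemma face_inner_vertex:
  assumes D: "D \<in> dissections i j" and ij: "i + 2 \<le> j" and ab: "(a, b) \<in> insert (i, j) D"
  shows "\<exists>m\<in>face_vertices D (a, b). a < m \<and> m < b"
proof (rule ccontr)
  assume no: "\<not> ?thesis"
  have "m \<le> a \<or> b \<le> m" if "m \<in> face_vertices D (a, b)" for m
    using no that by (auto simp: not_less)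
  then have "(a, b) \<in> face_edges D (a, b)"
    using face_vertices_endpoints[OF D ij ab] dissectionsD[OF D ij ab]
    by (auto simp: face_edges_def)
  from face_edge_cases[OF D this] show False
    using dissectionsD[OF D ij ab] by auto
qed


lemma lower_halfplane: "{z. Im z < chord a b (Re z)} = {z. Complex (- (real a + real b)) 1 \<bullet> z < - (real a * real b)}"
  and upper_halfplane: "{z. chord a b (Re z) < Im z} = {z. Complex (real a + real b) (- 1) \<bullet> z < real a * real b}"
  and lower_halfplane_closed: "{z. Im z \<le> chord a b (Re z)} = {z. Complex (- (real a + real b)) 1 \<bullet> z \<le> - (real a * real b)}"
  and upper_halfplane_closed: "{z. chord a b (Re z) \<le> Im z} = {z. Complex (real a + real b) (- 1) \<bullet> z \<le> real a * real b}"
  by (auto simp: chord_def inner_complex_def algebra_simps)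

lemma halfplane_normals: "Complex c 1 \<noteq> 0" "Complex c (- 1) \<noteq> 0"
  by (simp_all add: complex_eq_iff)

text \<open>The open half-planes whose intersection is the face. In this form convexity, openness and the
  closure of a face are instances of general facts.\<close>

definition halfplanes :: "(nat \<times> nat) set \<Rightarrow> nat \<times> nat \<Rightarrow> complex set set" where
  "halfplanes D e = insert {z. Im z < chord (fst e) (snd e) (Re z)}
      ((\<lambda>(k, l). {z. chord k l (Re z) < Im z}) ` face_edges D e)"

lemma face_region_halfplanes: "face_region D e = \<Inter> (halfplanes D e)"
  by (auto simp: face_region_def halfplanes_def)

lemma halfplanes_convex_open: "H \<in> halfplanes D e \<Longrightarrow> convex H \<and> open H"
  by (auto simp: halfplanes_def lower_halfplane upper_halfplane convex_halfspace_lt open_halfspace_lt)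

lemma finite_face_edges: "finite (face_edges D e)"
  by (rule finite_subset[of _ "face_vertices D e \<times> face_vertices D e"])
    (auto simp: face_edges_def finite_face_vertices)

lemma face_region_convex: "convex (face_region D e)"
  unfolding face_region_halfplanes using halfplanes_convex_open by (blast intro: convex_Inter)

lemma face_region_open: "open (face_region D e)"
  unfolding face_region_halfplanes using halfplanes_convex_open
  by (intro open_Inter) (auto simp: halfplanes_def finite_face_edges)

lemma closure_face_region:
  assumes "face_region D e \<noteq> {}"
  shows "closure (face_region D e) =
    {z. Im z \<le> chord (fst e) (snd e) (Re z) \<and> (\<forall>(k, l)\<in>face_edges D e. chord k l (Re z) \<le> Im z)}"
proof -
  have "closure (face_region D e) = \<Inter> (closure ` halfplanes D e)"
    using assms closure_Inter_convex_open[of "halfplanes D e"] halfplanes_convex_open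
    unfolding face_region_halfplanes by metis
  also have "closure ` halfplanes D e = insert {z. Im z \<le> chord (fst e) (snd e) (Re z)}
      ((\<lambda>(k, l). {z. chord k l (Re z) \<le> Im z}) ` face_edges D e)"
    unfolding halfplanes_def image_insert image_image lower_halfplane lower_halfplane_closed
      closure_halfspace_lt[OF halfplane_normals(1)]
    by (intro arg_cong2[of _ _ _ _ insert] refl image_cong)
      (auto simp: upper_halfplane upper_halfplane_closed closure_halfspace_lt[OF halfplane_normals(2)]
        simp del: closure_halfspace_lt)
  finally show ?thesis by auto
qed

context
  fixes N :: nat and D :: "(nat \<times> nat) set"
  assumes D: "D \<in> dissections 0 N" and N: "2 \<le> N"
begin

lemma N_gap: "0 + 2 \<le> N" using N by simp

text \<open>The witness lies above an inner vertex of the face, halfway up to the top chord.\<close>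

lemma face_region_nonempty:
  assumes e: "e \<in> insert (0, N) D"
  shows "face_region D e \<noteq> {}"
proof -
  obtain a b where ab: "e = (a, b)" by (cases e)
  then have e': "(a, b) \<in> insert (0, N) D" using e by simp
  obtain m where m: "m \<in> face_vertices D (a, b)" "a < m" "m < b"
    using face_inner_vertex[OF D N_gap e'] by auto
  define h where "h = (real m - real a) * (real b - real m)"
  have h: "h > 0" using m by (simp add: h_def)
  have "Complex (real m) ((real m)\<^sup>2 + h / 2) \<in> face_region D e"
  proof -
    have "(real m)\<^sup>2 + h / 2 < chord a b (real m)"
      using h by (simp add: chord_parabola h_def[symmetric])
    moreover have "chord k l (real m) < (real m)\<^sup>2 + h / 2" if "(k, l) \<in> face_edges D (a, b)" for k l
    proof -
      have "k < l" "m \<le> k \<or> l \<le> m"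
        using that m(1) by (auto simp: face_edges_def)
      then show ?thesis
        using chord_le_parabola[of k l "real m"] h by auto
    qed
    ultimately show ?thesis by (auto simp: face_region_def ab)
  qed
  then show ?thesis by blast
qed

text \<open>The comparisons of the top chord with the leftmost and the rightmost lower edge confine the face
  to the strip over \<open>[a, b]\<close>, and some lower edge keeps it above the parabola.\<close>

lemma face_closed_region_bounds:
  assumes e: "(a, b) \<in> insert (0, N) D"
    and le: "Im z \<le> chord a b (Re z)" and ge: "\<forall>(k, l)\<in>face_edges D (a, b). chord k l (Re z) \<le> Im z"
  shows "real a \<le> Re z" "Re z \<le> real b" "(Re z)\<^sup>2 \<le> Im z"
proof -
  have ends: "a \<in> face_vertices D (a, b)" "b \<in> face_vertices D (a, b)" "a < b"
    using face_vertices_endpoints[OF D N_gap e] dissectionsD[OF D N_gap e] by auto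
  obtain m where m: "m \<in> face_vertices D (a, b)" "a < m" "m < b"
    using face_inner_vertex[OF D N_gap e] by auto
  obtain k l where kl: "(k, l) \<in> face_edges D (a, b)" "real k \<le> real a" "real a \<le> real l"
    using face_edge_exists[OF D N_gap e, of "real a"] ends by auto
  have bd: "fst (a, b) \<le> k"
    using kl(1) by (intro conjunct1[OF face_vertices_bounds[of k D]]) (auto simp: face_edges_def)
  then have k: "k = a" "l \<le> m" "k < l" using kl m by (auto simp: face_edges_def)
  have "chord a l (Re z) \<le> chord a b (Re z)"
    using le ge kl(1) k by force
  then have "0 \<le> (real b - real l) * (Re z - real a)"
    by (simp add: chord_def algebra_simps)
  then show a: "real a \<le> Re z"
    using k m by (auto simp: zero_le_mult_iff)
  obtain k l where kl: "(k, l) \<in> face_edges D (a, b)" "real k \<le> real b" "real b \<le> real l"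
    using face_edge_exists[OF D N_gap e, of "real b"] ends by auto
  have bd: "l \<le> snd (a, b)"
    using kl(1) by (intro conjunct2[OF face_vertices_bounds[of l D]]) (auto simp: face_edges_def)
  then have k: "l = b" "m \<le> k" "k < l" using kl m by (auto simp: face_edges_def)
  have "chord k b (Re z) \<le> chord a b (Re z)"
    using le ge kl(1) k by force
  then have "0 \<le> (real k - real a) * (real b - Re z)"
    by (simp add: chord_def algebra_simps)
  then show b: "Re z \<le> real b"
    using k m by (auto simp: zero_le_mult_iff)
  show "(Re z)\<^sup>2 \<le> Im z"
    using face_edge_exists[OF D N_gap e a b] ge chord_ge_parabola[of _ "Re z"] by fastforce
qed

lemma face_region_bounded:
  assumes e: "e \<in> insert (0, N) D"
  shows "bounded (face_region D e)"
proof -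
  obtain a b where ab: "e = (a, b)" by (cases e)
  have "face_region D e \<subseteq> cbox 0 (Complex (real b) ((real a + real b) * real b))"
  proof
    fix z assume z: "z \<in> face_region D e"
    have bds: "real a \<le> Re z" "Re z \<le> real b" "(Re z)\<^sup>2 \<le> Im z"
      using face_closed_region_bounds[of a b z] e z by (fastforce simp: ab face_region_def)+
    have "Im z \<le> (real a + real b) * Re z"
      using z by (auto simp: face_region_def ab chord_def intro: less_imp_le order_trans)
    also have "\<dots> \<le> (real a + real b) * real b"
      using bds by (intro mult_left_mono) auto
    finally show "z \<in> cbox 0 (Complex (real b) ((real a + real b) * real b))"
      using bds order_trans[OF zero_le_power2 bds(3)] by (auto simp: in_cbox_complex_iff)
  qed
  then show ?thesis using bounded_cbox bounded_subset by blast
qed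

lemma plane_graph_eq:
  "plane_graph N D =
     {z. \<exists>(c, d)\<in>sides N \<union> D. real c \<le> Re z \<and> Re z \<le> real d \<and> Im z = chord c d (Re z)}"
proof -
  have "a < b" if "(a, b) \<in> sides N \<union> D" for a b
    using that D N by (auto simp: sides_def dissections_def)
  then have "(case e of (a, b) \<Rightarrow> closed_segment (vertex a) (vertex b))
      = {z. case e of (c, d) \<Rightarrow> real c \<le> Re z \<and> Re z \<le> real d \<and> Im z = chord c d (Re z)}"
    if "e \<in> sides N \<union> D" for e
    using that closed_segment_vertex by (cases e) auto
  then show ?thesis
    unfolding plane_graph_def by blast
qed

lemma plane_graphI:
  assumes "(c, d) \<in> insert (0, N) D \<or> d = Suc c \<and> c < N" "real c \<le> Re z" "Re z \<le> real d" "Im z = chord c d (Re z)"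
  shows "z \<in> plane_graph N D"
  using assms unfolding plane_graph_eq by (force simp: sides_def)

lemma face_edge_in_graph:
  assumes e: "e \<in> insert (0, N) D" and kl: "(k, l) \<in> face_edges D e"
  shows "(k, l) \<in> insert (0, N) D \<or> l = Suc k \<and> k < N"
proof -
  obtain a b where ab: "e = (a, b)" by (cases e)
  then have e': "(a, b) \<in> insert (0, N) D" using e by simp
  have "l \<le> snd (a, b)"
    using kl by (intro conjunct2[OF face_vertices_bounds[of l D]]) (auto simp: face_edges_def ab)
  then show ?thesis
    using face_edge_cases[OF D, of k l a b] kl ab dissectionsD[OF D N_gap e'] by auto
qed

text \<open>A point of the graph inside the face would lie on a chord that is strictly below the top chord and
  strictly above a lower edge \<open>(k, l)\<close> over the same abscissa. Not crossing the top chord, it is nested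
  in it; cutting off neither \<open>k\<close> nor \<open>l\<close>, it is nested in \<open>(k, l)\<close>, hence below it.\<close>

lemma face_region_avoids_graph:
  assumes e: "e \<in> insert (0, N) D"
  shows "face_region D e \<inter> plane_graph N D = {}"
proof (rule ccontr)
  obtain a b where ab: "e = (a, b)" by (cases e)
  then have e': "(a, b) \<in> insert (0, N) D" using e by simp
  assume "\<not> ?thesis"
  then obtain z c d where z: "z \<in> face_region D e" and cd: "(c, d) \<in> sides N \<union> D"
    "real c \<le> Re z" "Re z \<le> real d" "Im z = chord c d (Re z)"
    unfolding plane_graph_eq by blast
  have lt: "Im z < chord a b (Re z)"
    and gt: "\<And>k l. (k, l) \<in> face_edges D (a, b) \<Longrightarrow> chord k l (Re z) < Im z"
    using z by (auto simp: face_region_def ab)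
  have bds: "real a \<le> Re z" "Re z \<le> real b"
    using face_closed_region_bounds[OF e', of z] lt gt by fastforce+
  obtain k l where kl: "(k, l) \<in> face_edges D (a, b)" "real k \<le> Re z" "Re z \<le> real l"
    using face_edge_exists[OF D N_gap e' bds] by auto
  have below: "chord k l (Re z) < chord c d (Re z)" and above: "chord c d (Re z) < chord a b (Re z)"
    using gt[OF kl(1)] cd(4) lt by simp_all
  have strict: "real c < Re z" "Re z < real d"
    using below chord_ge_parabola[OF kl(2,3)] cd(2,3)
    by (auto simp: less_le chord_parabola)
  have "\<not> (c \<le> a \<and> b \<le> d)"
    using nested_chord_le[of c a b d "Re z"] bds above by auto
  moreover have "a < d" "c < b"
    using strict bds by linarith+
  moreover have "\<not> crossing (a, b) (c, d)"
    using cd(1) dissections_not_crossing[OF D e', of "(c, d)"]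
    by (auto simp: sides_def crossing_def)
  ultimately have inside: "a \<le> c" "d \<le> b" "(c, d) \<noteq> (a, b)"
    by (auto simp: crossing_def)
  have kl': "k \<in> face_vertices D (a, b)" "l \<in> face_vertices D (a, b)" "k < l"
    using kl(1) by (auto simp: face_edges_def)
  have "(c, d) \<in> D \<or> d = Suc c"
    using inside cd(1) dissectionsD[OF D N_gap e'] by (auto simp: sides_def)
  then have "\<not> (c < m \<and> m < d)" if "m \<in> face_vertices D (a, b)" for m
    using that inside by (auto simp: face_vertices_def)
  then have "\<not> (c < k \<and> k < d)" "\<not> (c < l \<and> l < d)"
    using kl' by auto
  then have "k \<le> c" "d \<le> l"
    using strict kl by linarith+
  then show False
    using nested_chord_le[of k c d l "Re z"] strict below by auto
qed

text \<open>A frontier point satisfies one of the defining inequalities with equality. If it is the one of a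
  lower edge, then it lies on the lower edge over its own abscissa, because that one is the highest of
  all lower edges there.\<close>

lemma frontier_face_region_subset:
  assumes e: "e \<in> insert (0, N) D"
  shows "frontier (face_region D e) \<subseteq> plane_graph N D"
proof
  obtain a b where ab: "e = (a, b)" by (cases e)
  then have e': "(a, b) \<in> insert (0, N) D" using e by simp
  fix z assume "z \<in> frontier (face_region D e)"
  then have z: "z \<in> closure (face_region D e)" "z \<notin> face_region D e"
    using face_region_open[of D e] by (auto simp: frontier_def interior_open)
  then have le: "Im z \<le> chord a b (Re z)"
    and ge: "\<And>k l. (k, l) \<in> face_edges D (a, b) \<Longrightarrow> chord k l (Re z) \<le> Im z"
    using closure_face_region[OF face_region_nonempty[OF e]] by (auto simp: ab)
  have bds: "real a \<le> Re z" "Re z \<le> real b"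
    using face_closed_region_bounds[OF e', of z] le ge by fastforce+
  consider "Im z = chord a b (Re z)" | k l where "(k, l) \<in> face_edges D (a, b)" "Im z = chord k l (Re z)"
    using z(2) le ge by (force simp: face_region_def ab)
  then show "z \<in> plane_graph N D"
  proof cases
    case 1
    then show ?thesis using bds e' by (intro plane_graphI[of a b]) auto
  next
    case 2
    obtain k' l' where kl: "(k', l') \<in> face_edges D (a, b)" "real k' \<le> Re z" "Re z \<le> real l'"
      using face_edge_exists[OF D N_gap e' bds] by auto
    have "Im z = chord k' l' (Re z)"
    proof (rule antisym)
      show "Im z \<le> chord k' l' (Re z)"
      proof (cases "real k \<le> Re z \<and> Re z \<le> real l")
        case True
        have "k \<in> face_vertices D (a, b)" "l \<in> face_vertices D (a, b)" "k < l"
          "k' \<in> face_vertices D (a, b)" "l' \<in> face_vertices D (a, b)" "k' < l'"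
          "k' \<le> k \<or> l \<le> k'" "l' \<le> k \<or> l \<le> l'" "k \<le> k' \<or> l' \<le> k" "l \<le> k' \<or> l' \<le> l"
          using 2(1) kl(1) by (auto simp: face_edges_def)
        then have "k = k' \<and> l = l' \<or> l \<le> k' \<or> l' \<le> k" by linarith
        then have "k = k' \<and> l = l' \<or> Re z = real l \<and> l = k' \<or> Re z = real k \<and> l' = k"
          using True kl by fastforce
        then show ?thesis using 2(2) by (auto simp: chord_parabola)
      next
        case False
        have "k < l" using 2(1) by (auto simp: face_edges_def)
        then show ?thesis
          using False 2(2) chord_le_parabola[of k l "Re z"] chord_ge_parabola[OF kl(2,3)] by auto
      qed
    qed (use ge kl in auto)
    then show ?thesis
      using face_edge_in_graph[OF e] kl by (intro plane_graphI[of k' l']) (auto simp: ab)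
  qed
qed

text \<open>The closed inequalities at a point of the parabola say that it is between the endpoints of the top
  chord and not strictly between the endpoints of a lower edge.\<close>

lemma vertex_in_frontier_iff:
  assumes e: "e \<in> insert (0, N) D"
  shows "vertex m \<in> frontier (face_region D e) \<longleftrightarrow> m \<in> face_vertices D e"
proof -
  obtain a b where ab: "e = (a, b)" by (cases e)
  then have e': "(a, b) \<in> insert (0, N) D" using e by simp
  have lt: "a < b" using dissectionsD[OF D N_gap e'] by simp
  have v: "chord c d (real m) = (real m)\<^sup>2 + (real m - real c) * (real d - real m)" for c d
    by (rule chord_parabola)
  have "vertex m \<notin> face_region D e"
  proof
    assume "vertex m \<in> face_region D e"
    then have le: "(real m)\<^sup>2 < chord a b (real m)"
      and ge: "\<And>k l. (k, l) \<in> face_edges D (a, b) \<Longrightarrow> chord k l (real m) < (real m)\<^sup>2"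
      by (auto simp: face_region_def ab vertex_def)
    then have "a < m" "m < b"
      using lt by (auto simp: v zero_less_mult_iff)
    then obtain k l where kl: "(k, l) \<in> face_edges D (a, b)" "real k \<le> real m" "real m \<le> real l"
      using face_edge_exists[OF D N_gap e', of "real m"] by auto
    then show False
      using ge[OF kl(1)] chord_ge_parabola[OF kl(2,3)] by simp
  qed
  then have "vertex m \<in> frontier (face_region D e) \<longleftrightarrow> vertex m \<in> closure (face_region D e)"
    using face_region_open[of D e] by (auto simp: frontier_def interior_open)
  also have "\<dots> \<longleftrightarrow> (real m)\<^sup>2 \<le> chord a b (real m) \<and>
      (\<forall>(k, l)\<in>face_edges D (a, b). chord k l (real m) \<le> (real m)\<^sup>2)"
    unfolding closure_face_region[OF face_region_nonempty[OF e]] by (simp add: ab vertex_def)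
  also have "\<dots> \<longleftrightarrow> m \<in> face_vertices D (a, b)"
  proof
    assume m: "m \<in> face_vertices D (a, b)"
    then have "a \<le> m" "m \<le> b"
      by (auto dest: face_vertices_bounds)
    moreover have "chord k l (real m) \<le> (real m)\<^sup>2" if "(k, l) \<in> face_edges D (a, b)" for k l
      using that m by (intro chord_le_parabola) (auto simp: face_edges_def)
    ultimately show "(real m)\<^sup>2 \<le> chord a b (real m) \<and>
      (\<forall>(k, l)\<in>face_edges D (a, b). chord k l (real m) \<le> (real m)\<^sup>2)"
      by (auto intro!: chord_ge_parabola)
  next
    assume m: "(real m)\<^sup>2 \<le> chord a b (real m) \<and>
      (\<forall>(k, l)\<in>face_edges D (a, b). chord k l (real m) \<le> (real m)\<^sup>2)"
    then have "real a \<le> real m" "real m \<le> real b"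
      using lt by (auto simp: v zero_le_mult_iff)
    then obtain k l where kl: "(k, l) \<in> face_edges D (a, b)" "real k \<le> real m" "real m \<le> real l"
      using face_edge_exists[OF D N_gap e', of "real m"] by auto
    then have "chord k l (real m) \<le> (real m)\<^sup>2"
      using m by blast
    then have "m = k \<or> m = l"
      using kl(2,3) by (auto simp: v mult_le_0_iff)
    then show "m \<in> face_vertices D (a, b)"
      using kl(1) by (auto simp: face_edges_def)
  qed
  finally show ?thesis by (simp add: ab)
qed

definition polygon_hull :: "complex set" where
  "polygon_hull = {z. Im z \<le> chord 0 N (Re z)} \<inter> (\<Inter>k<N. {z. chord k (Suc k) (Re z) \<le> Im z})"

lemma polygon_hull_bounds:
  assumes "z \<in> polygon_hull"
  shows "0 \<le> Re z" "Re z \<le> real N" "\<And>k. k < N \<Longrightarrow> chord k (Suc k) (Re z) \<le> Im z" "Im z \<le> chord 0 N (Re z)"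
proof -
  show 1: "Im z \<le> chord 0 N (Re z)" and 2: "\<And>k. k < N \<Longrightarrow> chord k (Suc k) (Re z) \<le> Im z"
    using assms by (auto simp: polygon_hull_def)
  have "0 \<le> (real N - 1) * Re z"
    using 1 2[of 0] N by (simp add: chord_def algebra_simps)
  then show "0 \<le> Re z" using N by (simp add: zero_le_mult_iff)
  have "chord (N - 1) N (Re z) \<le> chord 0 N (Re z)"
    using 1 2[of "N - 1"] N by simp
  then have "0 \<le> (real N - 1) * (real N - Re z)"
    using N by (simp add: chord_def algebra_simps of_nat_diff)
  then show "Re z \<le> real N" using N by (simp add: zero_le_mult_iff)
qed

lemma polygon_hull_convex: "convex polygon_hull"
  unfolding polygon_hull_def lower_halfplane_closed upper_halfplane_closed
  by (intro convex_Int convex_INT convex_halfspace_le)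

lemma polygon_hull_bounded: "bounded polygon_hull"
proof -
  have "polygon_hull \<subseteq> cbox (Complex 0 0) (Complex (real N) (real N * real N))"
  proof
    fix z assume z: "z \<in> polygon_hull"
    note b = polygon_hull_bounds[OF z]
    have "Im z \<le> real N * Re z"
      using b(4) by (simp add: chord_def)
    also have "\<dots> \<le> real N * real N"
      using b by (intro mult_left_mono) auto
    moreover have "Im z \<ge> 0"
      using b(1) b(3)[of 0] N by (simp add: chord_def)
    ultimately show "z \<in> cbox (Complex 0 0) (Complex (real N) (real N * real N))"
      using b by (auto simp: in_cbox_complex_iff)
  qed
  then show ?thesis using bounded_cbox bounded_subset by blast
qed

lemma plane_graph_subset_hull: "plane_graph N D \<subseteq> polygon_hull"
proof
  fix z assume "z \<in> plane_graph N D"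
  then obtain c d where cd: "(c, d) \<in> sides N \<union> D" "real c \<le> Re z" "Re z \<le> real d" "Im z = chord c d (Re z)"
    unfolding plane_graph_eq by blast
  have "c < d" "d \<le> N"
    using cd(1) N D by (auto simp: sides_def dissections_def)
  then have "chord c d (Re z) \<le> chord 0 N (Re z)"
    using cd by (intro nested_chord_le) auto
  moreover have "chord k (Suc k) (Re z) \<le> chord c d (Re z)" for k
  proof (cases "real k < Re z \<and> Re z < real (Suc k)")
    case True
    then have "real c < real (Suc k)" "real k < real d"
      using cd by linarith+
    then have "c \<le> k" "Suc k \<le> d"
      by auto
    then show ?thesis
      using True by (intro nested_chord_le) auto
  next
    case False
    then show ?thesis
      using chord_le_parabola[of k "Suc k" "Re z"] chord_ge_parabola[OF cd(2,3)] by fastforce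
  qed
  ultimately show "z \<in> polygon_hull"
    using cd(4) by (auto simp: polygon_hull_def)
qed

text \<open>The face is found below the shortest chord that passes above the given point.\<close>

lemma hull_point_in_face_region:
  assumes z: "z \<in> polygon_hull" "z \<notin> plane_graph N D"
  shows "\<exists>e\<in>insert (0, N) D. z \<in> face_region D e"
proof -
  note b = polygon_hull_bounds[OF z(1)]
  \<comment> \<open>Some chord of length \<open>w\<close> passes above the point.\<close>
  define P where "P = (\<lambda>w. \<exists>(a, b)\<in>insert (0, N) D. b - a = w \<and> real a \<le> Re z \<and> Re z \<le> real b \<and> Im z < chord a b (Re z))"
  have "Im z \<noteq> chord 0 N (Re z)"
    using z(2) b plane_graphI[of 0 N z] by auto
  then have "P N"
    using b by (auto simp: P_def intro!: bexI[of _ "(0, N)"])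
  then have "P (LEAST w. P w)"
    by (rule LeastI)
  then obtain a b where ab: "(a, b) \<in> insert (0, N) D" "b - a = (LEAST w. P w)"
    "real a \<le> Re z" "Re z \<le> real b" "Im z < chord a b (Re z)"
    unfolding P_def by blast
  have minimal: "b - a \<le> d - c" if "(c, d) \<in> insert (0, N) D" "real c \<le> Re z" "Re z \<le> real d" "Im z < chord c d (Re z)" for c d
    unfolding ab(2) using that by (intro Least_le) (auto simp: P_def)
  obtain k l where kl: "(k, l) \<in> face_edges D (a, b)" "real k \<le> Re z" "Re z \<le> real l"
    using face_edge_exists[OF D N_gap ab(1,3,4)] by auto
  note in_graph = face_edge_in_graph[OF ab(1) kl(1)]
  have "k \<in> face_vertices D (a, b)" "l \<in> face_vertices D (a, b)" "k < l"
    using kl(1) by (auto simp: face_edges_def)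
  then have bds: "a \<le> k" "k < l" "l \<le> b"
    by (auto dest: face_vertices_bounds)
  have "chord k l (Re z) < Im z"
  proof (rule ccontr)
    assume "\<not> ?thesis"
    moreover have "Im z \<noteq> chord k l (Re z)"
      using z(2) in_graph kl plane_graphI[of k l z] by auto
    ultimately have lt: "Im z < chord k l (Re z)" by simp
    then have "(k, l) \<in> insert (0, N) D"
      using in_graph polygon_hull_bounds(3)[OF z(1), of k] by fastforce
    then have "b - a \<le> l - k"
      using minimal lt kl by blast
    then have "(k, l) = (a, b)"
      using bds by auto
    then show False
      using face_edge_cases[OF D kl(1)] dissectionsD[OF D N_gap ab(1)] by auto
  qed
  moreover have "chord k' l' (Re z) \<le> chord k l (Re z)" if "(k', l') \<in> face_edges D (a, b)" for k' l'
  proof (cases "real k' < Re z \<and> Re z < real l'")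
    case True
    have "k' \<le> k \<or> l \<le> k'" "l' \<le> k \<or> l \<le> l'" "k \<le> k' \<or> l' \<le> k" "l \<le> k' \<or> l' \<le> l" "k' < l'"
      using that kl(1) by (auto simp: face_edges_def)
    moreover have "\<not> l \<le> k'" "\<not> l' \<le> k"
      using True kl by auto
    ultimately have "k = k'" "l = l'" by linarith+
    then show ?thesis by simp
  next
    case False
    have "k' < l'" using that by (auto simp: face_edges_def)
    then show ?thesis
      using False chord_le_parabola[of k' l' "Re z"] chord_ge_parabola[OF kl(2,3)] by fastforce
  qed
  ultimately have "z \<in> face_region D (a, b)"
    using ab(5) by (fastforce simp: face_region_def)
  then show ?thesis using ab(1) by blast
qed

text \<open>A connected set that avoids the frontier of the face cannot leave the face.\<close>

lemma face_region_component:
  assumes e: "e \<in> insert (0, N) D" and z: "z \<in> face_region D e"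
  shows "connected_component_set (- plane_graph N D) z = face_region D e"
proof
  show "face_region D e \<subseteq> connected_component_set (- plane_graph N D) z"
    using z face_region_avoids_graph[OF e] convex_connected[OF face_region_convex]
    by (intro connected_component_maximal) auto
  show "connected_component_set (- plane_graph N D) z \<subseteq> face_region D e"
  proof (rule ccontr)
    let ?C = "connected_component_set (- plane_graph N D) z"
    assume "\<not> ?C \<subseteq> face_region D e"
    moreover have "z \<in> ?C"
      using z face_region_avoids_graph[OF e] by auto
    ultimately have "?C \<inter> frontier (face_region D e) \<noteq> {}"
      using z by (intro connected_Int_frontier connected_connected_component) blast+
    then show False
      using frontier_face_region_subset[OF e] connected_component_subset[of "- plane_graph N D" z] by blast
  qed
qed

text \<open>A component that meets the outside of the polygon contains all of it, since the complement of a
  bounded convex set is connected; so it is unbounded. All other components are faces.\<close>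

lemma bounded_components_eq:
  "{C \<in> components (- plane_graph N D). bounded C} = face_region D ` insert (0, N) D"
proof (intro subset_antisym subsetI)
  fix C assume "C \<in> face_region D ` insert (0, N) D"
  then obtain e where e: "e \<in> insert (0, N) D" "C = face_region D e" by blast
  obtain z where z: "z \<in> C" using face_region_nonempty[OF e(1)] e(2) by blast
  have "C = connected_component_set (- plane_graph N D) z"
    using face_region_component[OF e(1)] z e(2) by simp
  moreover have "z \<in> - plane_graph N D"
    using z e face_region_avoids_graph[OF e(1)] by blast
  ultimately show "C \<in> {C \<in> components (- plane_graph N D). bounded C}"
    using face_region_bounded[OF e(1)] e(2) by (auto simp: components_def)
next
  fix C assume C: "C \<in> {C \<in> components (- plane_graph N D). bounded C}"
  then obtain z where z: "z \<notin> plane_graph N D" "C = connected_component_set (- plane_graph N D) z"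
    by (auto simp: components_def)
  show "C \<in> face_region D ` insert (0, N) D"
  proof (cases "z \<in> polygon_hull")
    case True
    then show ?thesis
      using hull_point_in_face_region[OF True z(1)] face_region_component z(2) by blast
  next
    case False
    have "connected (- polygon_hull)"
      using polygon_hull_bounded polygon_hull_convex
      by (intro connected_complement_bounded_convex) auto
    then have "- polygon_hull \<subseteq> C"
      unfolding z(2) using False plane_graph_subset_hull by (intro connected_component_maximal) auto
    then have "bounded (- polygon_hull)"
      using C bounded_subset by blast
    then have "bounded (- polygon_hull \<union> polygon_hull)"
      using polygon_hull_bounded by (simp only: bounded_Un)
    then show ?thesis
      by (simp add: not_bounded_UNIV)
  qed
qed

text \<open>The outcome of the geometry: from here on, faces are sets of indices.\<close>

lemma faces_eq:
  assumes "length p = Suc N"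
  shows "faces p D = (\<lambda>e. nths p (face_vertices D e)) ` insert (0, N) D"
proof -
  have "faces p D = (\<lambda>C. nths p {k. vertex k \<in> frontier C}) ` {C \<in> components (- plane_graph N D). bounded C}"
    using assms by (auto simp: faces_def)
  also have "\<dots> = (\<lambda>e. nths p (face_vertices D e)) ` insert (0, N) D"
    unfolding bounded_components_eq image_image
    by (intro image_cong refl) (simp add: vertex_in_frontier_iff)
  finally show ?thesis .
qed

end

section \<open>Chains in an order\<close>

fun step_prod :: "('a \<Rightarrow> 'a \<Rightarrow> real) \<Rightarrow> 'a list \<Rightarrow> real" where
  "step_prod w (x # y # zs) = w x y * step_prod w (y # zs)"
| "step_prod w [x] = 1"
| "step_prod w [] = 1"

lemma step_prod_Cons: "v \<noteq> [] \<Longrightarrow> step_prod w (x # v) = w x (hd v) * step_prod w v"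
  by (cases v) auto

text \<open>The recursive form serves inductions on chains, this one serves limits and reindexing.\<close>

lemma step_prod_conv_prod: "step_prod w v = (\<Prod>j\<in>{1..<length v}. w (v ! (j - 1)) (v ! j))"
proof (induction v)
  case (Cons x v)
  show ?case
  proof (cases v)
    case v: (Cons y zs)
    have "(\<Prod>j\<in>{1..<length (x # v)}. w ((x # v) ! (j - 1)) ((x # v) ! j))
          = w x y * (\<Prod>j\<in>{2..<Suc (length v)}. w ((x # v) ! (j - 1)) ((x # v) ! j))"
      using v by (subst prod.atLeast_Suc_lessThan) (auto simp: numeral_2_eq_2)
    also have "(\<Prod>j\<in>{2..<Suc (length v)}. w ((x # v) ! (j - 1)) ((x # v) ! j))
          = (\<Prod>j\<in>{1..<length v}. w (v ! (j - 1)) (v ! j))"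
      by (rule prod.reindex_bij_witness[of _ Suc "\<lambda>j. j - 1"]) auto
    finally show ?thesis
      using Cons.IH v by simp
  qed simp
qed simp

lemma step_prod_cong:
  assumes "\<And>j. 0 < j \<Longrightarrow> j < length v \<Longrightarrow> w (v ! (j - 1)) (v ! j) = w' (v ! (j - 1)) (v ! j)"
  shows "step_prod w v = step_prod w' v"
  unfolding step_prod_conv_prod using assms by (intro prod.cong) auto

definition chains_between :: "'a::order \<Rightarrow> 'a \<Rightarrow> 'a list set" where
  "chains_between a b = {v. v \<noteq> [] \<and> hd v = a \<and> last v = b \<and> sorted_wrt (<) v}"

lemma chains_between_bounds:
  assumes "v \<in> chains_between a b" "c \<in> set v"
  shows "a \<le> c" "c \<le> b"
proof -
  have v: "v \<noteq> []" "hd v = a" "last v = b" "sorted_wrt (<) v"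
    using assms(1) by (auto simp: chains_between_def)
  obtain i where i: "i < length v" "v ! i = c"
    using assms(2) by (auto simp: in_set_conv_nth)
  show "a \<le> c"
    using v i sorted_wrt_nth_less[OF v(4), of 0 i] by (cases "i = 0") (auto simp: hd_conv_nth)
  show "c \<le> b"
  proof (cases "i = length v - 1")
    case False
    then have "v ! i < v ! (length v - 1)"
      using i by (intro sorted_wrt_nth_less[OF v(4)]) auto
    then show ?thesis using v i by (simp add: last_conv_nth)
  qed (use v i in \<open>simp add: last_conv_nth\<close>)
qed

lemma chains_between_self: "chains_between a a = {[a]}"
proof -
  have "v = [a]" if "v \<in> chains_between a a" for v
  proof (cases v)
    case (Cons x w)
    have "w = []"
    proof (rule ccontr)
      assume "w \<noteq> []"
      then have "last v \<in> set w" "a = x"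
        using that Cons by (auto simp: chains_between_def)
      then show False
        using that Cons by (auto simp: chains_between_def)
    qed
    then show ?thesis using that Cons by (auto simp: chains_between_def)
  qed (use that in \<open>simp add: chains_between_def\<close>)
  then show ?thesis by (auto simp: chains_between_def)
qed

lemma chains_between_less:
  assumes "a < b"
  shows "chains_between a b = (\<Union>c\<in>{a<..b}. (#) a ` chains_between c b)"
proof (intro subset_antisym subsetI)
  fix v assume v: "v \<in> chains_between a b"
  then obtain w where w: "v = a # w" "w \<noteq> []"
    using assms by (cases v) (auto simp: chains_between_def split: if_splits)
  have "w \<in> chains_between (hd w) b"
    using v w by (auto simp: chains_between_def)
  moreover have "a < hd w"
    using v w by (auto simp: chains_between_def)
  moreover have "hd w \<le> b"
    using chains_between_bounds(2)[OF v, of "hd w"] w by simp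
  ultimately show "v \<in> (\<Union>c\<in>{a<..b}. (#) a ` chains_between c b)"
    using w by auto
next
  fix v assume "v \<in> (\<Union>c\<in>{a<..b}. (#) a ` chains_between c b)"
  then obtain c w where cw: "a < c" "c \<le> b" "v = a # w" "w \<in> chains_between c b"
    by auto
  then have "\<forall>x\<in>set w. a < x"
    using chains_between_bounds(1)[OF cw(4)] by (auto intro: less_le_trans)
  then show "v \<in> chains_between a b"
    using cw by (auto simp: chains_between_def)
qed

lemma chains_between_distinct: "v \<in> chains_between a b \<Longrightarrow> distinct v"
  unfolding distinct_conv_nth chains_between_def
  by (auto simp: neq_iff dest: sorted_wrt_nth_less)

lemma finite_chains_between:
  assumes "finite {a..b}"
  shows "finite (chains_between a b)"
proof (rule finite_subset)
  show "chains_between a b \<subseteq> {v. set v \<subseteq> {a..b} \<and> distinct v}"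
    using chains_between_bounds chains_between_distinct by fastforce
qed (use assms in \<open>rule finite_subset_distinct\<close>)

text \<open>All inductions on chains split off the first step.\<close>

lemma sum_chains_between:
  assumes "a < b" "finite {a..b}"
  shows "sum F (chains_between a b) = (\<Sum>c\<in>{a<..b}. \<Sum>v\<in>chains_between c b. F (a # v))"
proof -
  have fin: "finite {a<..b}" "finite (chains_between c b)" if "c \<in> {a<..b}" for c
  proof -
    have "{c..b} \<subseteq> {a..b}" "{a<..b} \<subseteq> {a..b}"
      using that by (auto intro: order_trans less_imp_le)
    then show "finite {a<..b}" "finite (chains_between c b)"
      using assms(2) finite_subset finite_chains_between by metis+
  qed
  have hd: "v \<noteq> [] \<and> hd v = c" if "v \<in> chains_between c b" for v c
    using that by (simp add: chains_between_def)
  have "sum F (chains_between a b) = (\<Sum>c\<in>{a<..b}. sum F ((#) a ` chains_between c b))"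
    unfolding chains_between_less[OF assms(1)]
  proof (rule sum.UNION_disjoint)
    show "finite {a<..b}" using fin(1)[of b] assms(1) by simp
    show "\<forall>c\<in>{a<..b}. finite ((#) a ` chains_between c b)" using fin(2) by auto
    show "\<forall>c\<in>{a<..b}. \<forall>d\<in>{a<..b}. c \<noteq> d \<longrightarrow>
        (#) a ` chains_between c b \<inter> (#) a ` chains_between d b = {}"
      using hd by blast
  qed
  then show ?thesis
    by (simp add: sum.reindex)
qed

section \<open>Sums over dissections\<close>

text \<open>In contrast to \<open>dissections\<close>, the chord \<open>(i, j)\<close> itself is permitted. This class is closed under
  cutting at a visible vertex, which the recursion needs.\<close>

definition chord_sets :: "nat \<Rightarrow> nat \<Rightarrow> (nat \<times> nat) set set" where
  "chord_sets i j =
     {D. D \<subseteq> {(a, b). i \<le> a \<and> a + 2 \<le> b \<and> b \<le> j} \<and> (\<forall>e\<in>D. \<forall>f\<in>D. \<not> crossing e f)}"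

text \<open>If \<open>(i, j)\<close> is not in \<open>D\<close>, these are the vertices of the face at the base edge.\<close>

definition visible :: "nat \<Rightarrow> nat \<Rightarrow> (nat \<times> nat) set \<Rightarrow> nat set" where
  "visible i j D = {k. i \<le> k \<and> k \<le> j \<and> \<not> (\<exists>f\<in>D. fst f < k \<and> k < snd f)}"

definition face_weight :: "(nat set \<Rightarrow> real) \<Rightarrow> (nat \<times> nat) set \<Rightarrow> real" where
  "face_weight \<phi> D = (\<Prod>e\<in>D. \<phi> (face_vertices D e))"

text \<open>A side bounds no polygon and contributes the factor \<open>1\<close>.\<close>

definition dissection_sum :: "(nat set \<Rightarrow> real) \<Rightarrow> nat \<Rightarrow> nat \<Rightarrow> real" where
  "dissection_sum \<phi> i j =
     (if j \<le> Suc i then 1 else \<Sum>D\<in>dissections i j. face_weight \<phi> (insert (i, j) D))"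

lemma dissections_chord_sets: "dissections i j = {D \<in> chord_sets i j. (i, j) \<notin> D}"
  by (auto simp: dissections_def chord_sets_def)

lemma chord_setsD:
  assumes "D \<in> chord_sets i j" "f \<in> D"
  shows "i \<le> fst f" "fst f + 2 \<le> snd f" "snd f \<le> j" "e \<in> D \<Longrightarrow> \<not> crossing e f"
  using assms by (auto simp: chord_sets_def)

lemma finite_chord_sets: "finite (chord_sets i j)"
  by (rule finite_subset[of _ "Pow ({..j} \<times> {..j})"]) (auto simp: chord_sets_def)

lemma finite_chord_set: "D \<in> chord_sets i j \<Longrightarrow> finite D"
  by (rule finite_subset[of _ "{..j} \<times> {..j}"]) (auto simp: chord_sets_def)

lemma face_vertices_insert:
  assumes "D \<in> chord_sets i j" "e \<in> insert (i, j) D"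
  shows "face_vertices (insert (i, j) D) e = face_vertices D e"
proof -
  have "(i, j) = e" if "fst e \<le> i" "j \<le> snd e"
    using assms that chord_setsD[OF assms(1)] by (cases e) fastforce
  then show ?thesis
    by (auto simp: face_vertices_def)
qed

text \<open>The chord sets over \<open>{i..k}\<close> in which \<open>i\<close> and \<open>k\<close> are neighbouring visible vertices.\<close>

definition lid_sets :: "nat \<Rightarrow> nat \<Rightarrow> (nat \<times> nat) set set" where
  "lid_sets i k = {D \<in> chord_sets i k. k = Suc i \<or> (i, k) \<in> D}"

lemma sum_lid_sets:
  assumes "i < k"
  shows "(\<Sum>D\<in>lid_sets i k. face_weight \<phi> D) = dissection_sum \<phi> i k"
proof (cases "k = Suc i")
  case True
  have "lid_sets i k = {{}}"
    using True by (auto simp: lid_sets_def chord_sets_def)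
  then show ?thesis
    using True by (simp add: dissection_sum_def face_weight_def)
next
  case False
  have "lid_sets i k = insert (i, k) ` dissections i k"
  proof (intro subset_antisym subsetI)
    fix D assume "D \<in> lid_sets i k"
    then have "(i, k) \<in> D" "D - {(i, k)} \<in> dissections i k"
      using False by (auto simp: lid_sets_def dissections_def chord_sets_def)
    then show "D \<in> insert (i, k) ` dissections i k"
      by (metis imageI insert_Diff)
  next
    fix D assume "D \<in> insert (i, k) ` dissections i k"
    then obtain E where E: "E \<in> dissections i k" "D = insert (i, k) E" by blast
    have "\<not> crossing e f" if "e \<in> D" "f \<in> D" for e f
      using dissections_not_crossing[OF E(1)] that E(2) by blast
    then show "D \<in> lid_sets i k"
      using E assms False by (auto simp: lid_sets_def dissections_def chord_sets_def)
  qed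
  moreover have "inj_on (insert (i, k)) (dissections i k)"
    unfolding inj_on_def dissections_chord_sets by (auto simp: insert_ident)
  ultimately show ?thesis
    using assms False by (simp add: dissection_sum_def sum.reindex)
qed

text \<open>The longest chord from \<open>i\<close> hides all vertices below it.\<close>

definition first_visible :: "nat \<Rightarrow> (nat \<times> nat) set \<Rightarrow> nat" where
  "first_visible i D = (if \<exists>d. (i, d) \<in> D then Max {d. (i, d) \<in> D} else Suc i)"

text \<open>Noncrossing chords cannot pass over the first visible vertex, so the chord set falls apart there.\<close>

lemma first_visible_props:
  assumes D: "D \<in> chord_sets i j" and ij: "i < j"
  defines "k \<equiv> first_visible i D"
  shows "i < k" "k \<le> j" "{f \<in> D. snd f \<le> k} \<in> lid_sets i k" "{f \<in> D. k \<le> fst f} \<in> chord_sets k j"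
    "D = {f \<in> D. snd f \<le> k} \<union> {f \<in> D. k \<le> fst f}"
proof -
  have fin: "finite {d. (i, d) \<in> D}"
    by (rule finite_subset[of _ "{..j}"]) (use D in \<open>auto simp: chord_sets_def\<close>)
  have k: "k = Suc i \<and> (\<forall>d. (i, d) \<notin> D) \<or> (i, k) \<in> D"
    using Max_in[OF fin] by (auto simp: k_def first_visible_def)
  have max: "d \<le> k" if "(i, d) \<in> D" for d
    using that Max_ge[OF fin] by (auto simp: k_def first_visible_def)
  show ik: "i < k" "k \<le> j"
    using k ij chord_setsD[OF D, of "(i, k)"] by auto
  show "{f \<in> D. snd f \<le> k} \<in> lid_sets i k"
    using D k by (fastforce simp: lid_sets_def chord_sets_def)
  show "{f \<in> D. k \<le> fst f} \<in> chord_sets k j"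
    using D by (fastforce simp: chord_sets_def)
  have "snd f \<le> k \<or> k \<le> fst f" if f: "f \<in> D" for f
  proof (rule ccontr)
    assume not: "\<not> ?thesis"
    then have "fst f \<noteq> i"
      using max[of "snd f"] f by (cases f) auto
    then have "i < fst f"
      using chord_setsD(1)[OF D f] by simp
    then have "(i, k) \<in> D"
      using k not by auto
    then have "\<not> crossing (i, k) f"
      using chord_setsD(4)[OF D f] by blast
    then show False
      using not \<open>i < fst f\<close> by (auto simp: crossing_def)
  qed
  then show "D = {f \<in> D. snd f \<le> k} \<union> {f \<in> D. k \<le> fst f}" by blast
qed

text \<open>The converse of the cut at the first visible vertex. The weight is multiplicative because the face
  below a chord depends only on the chords nested in it.\<close>

lemma lid_chord_union:
  assumes D1: "D1 \<in> lid_sets i k" and D2: "D2 \<in> chord_sets k j" and k: "i < k" "k \<le> j"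
  shows "D1 \<union> D2 \<in> chord_sets i j" "first_visible i (D1 \<union> D2) = k"
    "{f \<in> D1 \<union> D2. snd f \<le> k} = D1" "{f \<in> D1 \<union> D2. k \<le> fst f} = D2"
    "visible i j (D1 \<union> D2) = insert i (visible k j D2)"
    "face_weight \<phi> (D1 \<union> D2) = face_weight \<phi> D1 * face_weight \<phi> D2"
proof -
  have D1c: "D1 \<in> chord_sets i k" and lid: "k = Suc i \<or> (i, k) \<in> D1"
    using D1 by (auto simp: lid_sets_def)
  have b1: "i \<le> fst f \<and> fst f + 2 \<le> snd f \<and> snd f \<le> k" if "f \<in> D1" for f
    using chord_setsD[OF D1c that] by blast
  have b2: "k \<le> fst f \<and> fst f + 2 \<le> snd f \<and> snd f \<le> j" if "f \<in> D2" for f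
    using chord_setsD[OF D2 that] by blast
  show "D1 \<union> D2 \<in> chord_sets i j"
    unfolding chord_sets_def
  proof (intro CollectI conjI)
    show "D1 \<union> D2 \<subseteq> {(a, b). i \<le> a \<and> a + 2 \<le> b \<and> b \<le> j}"
      using b1 b2 k by fastforce
    show "\<forall>e\<in>D1 \<union> D2. \<forall>f\<in>D1 \<union> D2. \<not> crossing e f"
    proof (intro ballI)
      fix e f assume "e \<in> D1 \<union> D2" "f \<in> D1 \<union> D2"
      then consider "e \<in> D1" "f \<in> D1" | "e \<in> D2" "f \<in> D2" | "e \<in> D1" "f \<in> D2" | "e \<in> D2" "f \<in> D1"
        by blast
      then show "\<not> crossing e f"
      proof cases
        case 1 then show ?thesis using chord_setsD(4)[OF D1c] by blast
      next
        case 2 then show ?thesis using chord_setsD(4)[OF D2] by blast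
      next
        case 3 then show ?thesis using b1[of e] b2[of f] by (auto simp: crossing_def)
      next
        case 4 then show ?thesis using b1[of f] b2[of e] by (auto simp: crossing_def)
      qed
    qed
  qed
  show "{f \<in> D1 \<union> D2. snd f \<le> k} = D1" "{f \<in> D1 \<union> D2. k \<le> fst f} = D2"
    using b1 b2 by fastforce+
  show "first_visible i (D1 \<union> D2) = k"
  proof (cases "(i, k) \<in> D1")
    case True
    have "{d. (i, d) \<in> D1 \<union> D2} \<subseteq> {..k}"
      using b1 b2 k by fastforce
    then have "Max {d. (i, d) \<in> D1 \<union> D2} = k"
      using True by (intro Max_eqI) (auto intro: finite_subset)
    then show ?thesis using True by (auto simp: first_visible_def)
  next
    case False
    then have "k = Suc i" using lid by simp
    moreover have "(i, d) \<notin> D1 \<union> D2" for d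
      using b1[of "(i, d)"] b2[of "(i, d)"] \<open>k = Suc i\<close> by auto
    ultimately show ?thesis by (auto simp: first_visible_def)
  qed
  show "visible i j (D1 \<union> D2) = insert i (visible k j D2)"
  proof (intro set_eqI iffI)
    fix m assume m: "m \<in> visible i j (D1 \<union> D2)"
    have "\<not> (i < m \<and> m < k)"
    proof
      assume im: "i < m \<and> m < k"
      then have "(i, k) \<in> D1" using lid by auto
      then show False using m im by (force simp: visible_def)
    qed
    then show "m \<in> insert i (visible k j D2)"
      using m by (auto simp: visible_def)
  next
    fix m assume m: "m \<in> insert i (visible k j D2)"
    have "\<not> (fst f < m \<and> m < snd f)" if "f \<in> D1 \<union> D2" for f
      using that m b1[of f] b2[of f] k by (auto simp: visible_def)
    then show "m \<in> visible i j (D1 \<union> D2)"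
      using m k by (auto simp: visible_def)
  qed
  have disj: "D1 \<inter> D2 = {}" using b1 b2 by fastforce
  have fv1: "face_vertices (D1 \<union> D2) e = face_vertices D1 e" if "e \<in> D1" for e
  proof -
    have "\<not> (fst e \<le> fst f \<and> snd f \<le> snd e)" if "f \<in> D2" for f
      using b1[OF \<open>e \<in> D1\<close>] b2[OF that] by auto
    then show ?thesis by (fastforce simp: face_vertices_def)
  qed
  have fv2: "face_vertices (D1 \<union> D2) e = face_vertices D2 e" if "e \<in> D2" for e
  proof -
    have "\<not> (fst e \<le> fst f \<and> snd f \<le> snd e)" if "f \<in> D1" for f
      using b2[OF \<open>e \<in> D2\<close>] b1[OF that] by auto
    then show ?thesis by (fastforce simp: face_vertices_def)
  qed
  show "face_weight \<phi> (D1 \<union> D2) = face_weight \<phi> D1 * face_weight \<phi> D2"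
    unfolding face_weight_def
    using finite_chord_set[OF D1c] finite_chord_set[OF D2] disj
    by (simp add: prod.union_disjoint fv1 fv2)
qed

lemma sorted_list_visible_insert:
  assumes "i < k"
  shows "sorted_list_of_set (insert i (visible k j D)) = i # sorted_list_of_set (visible k j D)"
proof -
  have fin: "finite (visible k j D)"
    by (rule finite_subset[of _ "{..j}"]) (auto simp: visible_def)
  have lt: "\<forall>m\<in>visible k j D. i < m"
    using assms by (auto simp: visible_def)
  show ?thesis
    by (rule strict_sorted_equal[symmetric])
      (use fin lt in \<open>auto simp del: sorted_list_of_set_insert_remove\<close>)
qed

text \<open>Grouping chord sets by their visible vertices: below two neighbouring visible vertices there is an
  arbitrary dissection of the polygon that their chord cuts off. The proof peels off the first visible
  vertex; \<open>F\<close> is arbitrary because it absorbs the peeled vertices in the induction.\<close>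

lemma sum_chord_sets:
  assumes "i \<le> j"
  shows "(\<Sum>D\<in>chord_sets i j. F (sorted_list_of_set (visible i j D)) * face_weight \<phi> D)
           = (\<Sum>ks\<in>chains_between i j. F ks * step_prod (dissection_sum \<phi>) ks)"
  using assms
proof (induction "j - i" arbitrary: i F rule: less_induct)
  case less
  show ?case
  proof (cases "i = j")
    case True
    have "chord_sets i j = {{}}" "visible i j {} = {i}"
      using True by (auto simp: chord_sets_def visible_def)
    then show ?thesis
      using True by (simp add: chains_between_self face_weight_def)
  next
    case False
    then have ij: "i < j" using less.prems by simp
    let ?P = "SIGMA k:{i<..j}. lid_sets i k \<times> chord_sets k j"
    let ?glue = "\<lambda>(k, D1, D2). D1 \<union> D2"
    let ?split = "\<lambda>D. let k = first_visible i D in (k, {f \<in> D. snd f \<le> k}, {f \<in> D. k \<le> fst f})"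
    let ?term = "\<lambda>(k, D1, D2). face_weight \<phi> D1 *
      (F (i # sorted_list_of_set (visible k j D2)) * face_weight \<phi> D2)"
    have "(\<Sum>D\<in>chord_sets i j. F (sorted_list_of_set (visible i j D)) * face_weight \<phi> D) = sum ?term ?P"
    proof (rule sum.reindex_bij_witness[where i = ?glue and j = ?split])
      fix D assume D: "D \<in> chord_sets i j"
      define k where "k = first_visible i D"
      define D1 D2 where D12: "D1 = {f \<in> D. snd f \<le> k}" "D2 = {f \<in> D. k \<le> fst f}"
      note p = first_visible_props[OF D ij, folded k_def, folded D12]
      note u = lid_chord_union[OF p(3,4,1,2), folded p(5)]
      show "?glue (?split D) = D"
        by (simp only: Let_def prod.case k_def[symmetric] D12[symmetric]) (rule p(5)[symmetric])
      show "?split D \<in> ?P"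
        unfolding Let_def k_def[symmetric] D12[symmetric] using p(1-4) by simp
      show "?term (?split D) = F (sorted_list_of_set (visible i j D)) * face_weight \<phi> D"
        using u(5) u(6)[of \<phi>] sorted_list_visible_insert[OF p(1)]
        by (simp add: Let_def k_def[symmetric] D12[symmetric])
    next
      fix t assume "t \<in> ?P"
      then obtain k D1 D2 where t: "t = (k, D1, D2)" "i < k" "k \<le> j" "D1 \<in> lid_sets i k" "D2 \<in> chord_sets k j"
        by auto
      note u = lid_chord_union[OF t(4,5,2,3)]
      show "?split (?glue t) = t"
        using u(2,3,4) by (simp add: t(1) Let_def)
      show "?glue t \<in> chord_sets i j"
        using u(1) by (simp add: t(1))
    qed
    also have "sum ?term ?P = (\<Sum>k\<in>{i<..j}. (\<Sum>D1\<in>lid_sets i k. face_weight \<phi> D1) *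
        (\<Sum>D2\<in>chord_sets k j. F (i # sorted_list_of_set (visible k j D2)) * face_weight \<phi> D2))"
      by (subst sum.Sigma[symmetric])
        (auto simp: sum_product sum.cartesian_product lid_sets_def finite_chord_sets intro!: sum.cong)
    also have "\<dots> = (\<Sum>k\<in>{i<..j}. dissection_sum \<phi> i k *
        (\<Sum>ks\<in>chains_between k j. F (i # ks) * step_prod (dissection_sum \<phi>) ks))"
    proof (intro sum.cong refl)
      fix k assume "k \<in> {i<..j}"
      then have k: "i < k" "k \<le> j" by auto
      then have "(\<Sum>D2\<in>chord_sets k j. F (i # sorted_list_of_set (visible k j D2)) * face_weight \<phi> D2)
          = (\<Sum>ks\<in>chains_between k j. F (i # ks) * step_prod (dissection_sum \<phi>) ks)"
        by (intro less.hyps[where F = "\<lambda>ks. F (i # ks)"]) auto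
      then show "(\<Sum>D1\<in>lid_sets i k. face_weight \<phi> D1) *
          (\<Sum>D2\<in>chord_sets k j. F (i # sorted_list_of_set (visible k j D2)) * face_weight \<phi> D2)
        = dissection_sum \<phi> i k * (\<Sum>ks\<in>chains_between k j. F (i # ks) * step_prod (dissection_sum \<phi>) ks)"
        using sum_lid_sets[OF k(1)] by simp
    qed
    also have "\<dots> = (\<Sum>ks\<in>chains_between i j. F ks * step_prod (dissection_sum \<phi>) ks)"
      unfolding sum_chains_between[OF ij finite_atLeastAtMost] sum_distrib_left
      by (intro sum.cong refl) (auto simp: chains_between_def step_prod_Cons)
    finally show ?thesis .
  qed
qed

text \<open>The recursion for sums over dissections. One chooses the face at the base edge and then, independently,
  a dissection of each of the remaining polygons. A chord set is a dissection iff the base edge is not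
  among its chords, that is, iff at least three vertices are visible.\<close>

lemma dissection_sum_rec:
  assumes "i + 2 \<le> j"
  shows "dissection_sum \<phi> i j =
    (\<Sum>ks | ks \<in> chains_between i j \<and> 3 \<le> length ks. \<phi> (set ks) * step_prod (dissection_sum \<phi>) ks)"
proof -
  \<comment> \<open>The weight \<open>0\<close> for two visible vertices discards the chord sets that contain the base edge.\<close>
  define F where "F = (\<lambda>ks. if 3 \<le> length ks then \<phi> (set ks) else 0 :: real)"
  have fin: "finite (visible i j D)" for D
    by (rule finite_subset[of _ "{..j}"]) (auto simp: visible_def)
  have "F (sorted_list_of_set (visible i j D)) * face_weight \<phi> D =
      (if (i, j) \<in> D then 0 else face_weight \<phi> (insert (i, j) D))" if D: "D \<in> chord_sets i j" for D
  proof (cases "(i, j) \<in> D")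
    case True
    have "visible i j D \<subseteq> {i, j}"
      using True by (force simp: visible_def)
    then have "card (visible i j D) \<le> card {i, j}"
      by (intro card_mono) auto
    also have "\<dots> \<le> 2"
      by (simp add: card_insert_if)
    finally show ?thesis
      using True by (simp add: F_def)
  next
    case False
    then have D': "D \<in> dissections i j"
      using D by (simp add: dissections_chord_sets)
    have vis: "visible i j D = face_vertices D (i, j)"
      using False chord_setsD[OF D] by (fastforce simp: visible_def face_vertices_def)
    obtain m where "m \<in> face_vertices D (i, j)" "i < m" "m < j"
      using face_inner_vertex[OF D' assms, of i j] by auto
    then have "{i, m, j} \<subseteq> visible i j D"
      using face_vertices_endpoints[OF D' assms, of i j] vis by auto
    then have "card {i, m, j} \<le> card (visible i j D)"
      using fin by (intro card_mono)
    then have "3 \<le> card (visible i j D)"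
      using \<open>i < m\<close> \<open>m < j\<close> by simp
    then have "F (sorted_list_of_set (visible i j D)) = \<phi> (face_vertices D (i, j))"
      using fin[of D] by (simp add: F_def vis)
    moreover have "face_weight \<phi> (insert (i, j) D) = \<phi> (face_vertices D (i, j)) * face_weight \<phi> D"
      using False finite_chord_set[OF D] face_vertices_insert[OF D] by (simp add: face_weight_def)
    ultimately show ?thesis using False by simp
  qed
  then have "(\<Sum>D\<in>chord_sets i j. F (sorted_list_of_set (visible i j D)) * face_weight \<phi> D)
      = (\<Sum>D\<in>chord_sets i j. if (i, j) \<in> D then 0 else face_weight \<phi> (insert (i, j) D))"
    by (intro sum.cong) auto
  also have "\<dots> = dissection_sum \<phi> i j"
    using assms unfolding dissections_chord_sets dissection_sum_def
    by (subst sum.inter_filter) (auto simp: finite_chord_sets intro!: sum.cong)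
  finally have "dissection_sum \<phi> i j = (\<Sum>ks\<in>chains_between i j. F ks * step_prod (dissection_sum \<phi>) ks)"
    using sum_chord_sets[of i j F \<phi>] assms by simp
  also have "\<dots> = (\<Sum>ks | ks \<in> chains_between i j \<and> 3 \<le> length ks. \<phi> (set ks) * step_prod (dissection_sum \<phi>) ks)"
    using finite_chains_between[of i j]
    by (intro sum.mono_neutral_cong_right) (auto simp: F_def)
  finally show ?thesis .
qed

lemma dissection_sum_cong:
  assumes "\<And>K. K \<subseteq> {i..j} \<Longrightarrow> \<phi> K = \<psi> K"
  shows "dissection_sum \<phi> i j = dissection_sum \<psi> i j"
proof (cases "j \<le> Suc i")
  case False
  have "face_weight \<phi> (insert (i, j) D) = face_weight \<psi> (insert (i, j) D)" if D: "D \<in> dissections i j" for D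
    unfolding face_weight_def
  proof (intro prod.cong refl assms)
    fix e assume e: "e \<in> insert (i, j) D"
    then have "i \<le> fst e \<and> snd e \<le> j"
      using dissectionsD[OF D, of "fst e" "snd e"] False by simp
    then show "face_vertices (insert (i, j) D) e \<subseteq> {i..j}"
      by (auto simp: face_vertices_def)
  qed
  then show ?thesis
    using False by (simp add: dissection_sum_def)
qed (simp add: dissection_sum_def)

section \<open>Sums over lattice paths and dissections\<close>

lemma abs_index_strict_mono: "a < b \<Longrightarrow> abs_index a < abs_index b"
proof -
  assume "a < b"
  then have "\<forall>r. a $ r \<le> b $ r" "\<exists>r. a $ r < b $ r"
    by (auto simp: less_vec_def less_eq_vec_def not_le)
  then show ?thesis
    unfolding abs_index_def by (intro sum_strict_mono_ex1) auto
qed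

lemma abs_index_mono: "a \<le> b \<Longrightarrow> abs_index a \<le> abs_index b"
  using abs_index_strict_mono[of a b] by (auto simp: le_less)

lemma abs_index_eqD: "a \<le> b \<Longrightarrow> abs_index a = abs_index b \<Longrightarrow> a = b"
  using abs_index_strict_mono[of a b] by (auto simp: le_less)

lemma finite_multi_index_interval: "finite {a..b :: nat ^ 'q::finite}"
proof (rule finite_subset)
  show "{a..b} \<subseteq> vec_lambda ` (PiE UNIV (\<lambda>r. {..b $ r}))"
  proof
    fix c assume "c \<in> {a..b}"
    then have "c = vec_lambda (vec_nth c)" "vec_nth c \<in> PiE UNIV (\<lambda>r. {..b $ r})"
      by (auto simp: less_eq_vec_def)
    then show "c \<in> vec_lambda ` (PiE UNIV (\<lambda>r. {..b $ r}))" by blast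
  qed
qed (simp add: finite_PiE)

text \<open>Maximal chains from \<open>a\<close> to \<open>b\<close>, parametrised by the level \<open>abs_index\<close>. Then a segment of a path is
  addressed by the levels of its ends, without shifting indices. Paths are continued by constants, which
  makes cutting and gluing plain operations on functions.\<close>

definition lattice_paths :: "nat ^ 'q::finite \<Rightarrow> nat ^ 'q \<Rightarrow> (nat \<Rightarrow> nat ^ 'q) set" where
  "lattice_paths a b =
     {p. mono p \<and> (\<forall>l\<le>abs_index a. p l = a) \<and> (\<forall>l\<ge>abs_index b. p l = b)
       \<and> (\<forall>l. abs_index a \<le> l \<longrightarrow> l \<le> abs_index b \<longrightarrow> abs_index (p l) = l)}"

lemma lattice_path_bounds:
  assumes "p \<in> lattice_paths a b"
  shows "a \<le> p l" "p l \<le> b"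
proof -
  have p: "mono p" "p 0 = a" "p (max l (abs_index b)) = b"
    using assms by (auto simp: lattice_paths_def)
  show "a \<le> p l" using monoD[OF p(1), of 0 l] p(2) by simp
  show "p l \<le> b" using monoD[OF p(1), of l "max l (abs_index b)"] p(3) by simp
qed

lemma finite_lattice_paths: "finite (lattice_paths a b)"
proof (rule finite_imageD)
  let ?f = "\<lambda>p. map p [0..<Suc (abs_index b)]"
  show "finite (?f ` lattice_paths a b)"
    by (rule finite_subset[of _ "{xs. set xs \<subseteq> {a..b} \<and> length xs = Suc (abs_index b)}"])
      (auto simp: lattice_path_bounds finite_lists_length_eq finite_multi_index_interval simp del: upt_Suc)
  show "inj_on ?f (lattice_paths a b)"
  proof (rule inj_onI, rule ext)
    fix p p' l
    assume p: "p \<in> lattice_paths a b" "p' \<in> lattice_paths a b" "?f p = ?f p'"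
    show "p l = p' l"
    proof (cases "l \<le> abs_index b")
      case True
      then have "l \<in> set [0..<Suc (abs_index b)]" by auto
      then show ?thesis using p(3) map_eq_conv by metis
    next
      case False
      then show ?thesis using p(1,2) by (auto simp: lattice_paths_def)
    qed
  qed
qed

lemma lattice_paths_self: "lattice_paths a a = {\<lambda>_. a}"
proof (intro subset_antisym subsetI)
  fix p assume "p \<in> lattice_paths a a"
  then have "p l = a" for l
    using lattice_path_bounds[of p a a l] by (simp add: order.antisym)
  then show "p \<in> {\<lambda>_. a}" by auto
next
  fix p assume "p \<in> {\<lambda>_::nat. a}"
  then show "p \<in> lattice_paths a a"
    by (auto simp: lattice_paths_def mono_def)
qed

lemma lattice_path_split:
  assumes p: "p \<in> lattice_paths a b" and k: "abs_index a \<le> k" "k \<le> abs_index b"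
  shows "(\<lambda>l. p (min l k)) \<in> lattice_paths a (p k)" "(\<lambda>l. p (max l k)) \<in> lattice_paths (p k) b"
    "abs_index (p k) = k"
proof -
  show pk: "abs_index (p k) = k"
    using p k by (simp add: lattice_paths_def)
  have "mono p" using p by (simp add: lattice_paths_def)
  then have "mono (\<lambda>l. p (min l k))" "mono (\<lambda>l. p (max l k))"
    by (auto intro!: monoI monoD[of p])
  then show "(\<lambda>l. p (min l k)) \<in> lattice_paths a (p k)" "(\<lambda>l. p (max l k)) \<in> lattice_paths (p k) b"
    using p k pk by (auto simp: lattice_paths_def min_def max_def)
qed

lemma lattice_path_glue:
  assumes p1: "p1 \<in> lattice_paths a c" and p2: "p2 \<in> lattice_paths c b" and c: "a \<le> c" "c \<le> b"
  defines "p \<equiv> \<lambda>l. if l \<le> abs_index c then p1 l else p2 l"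
  shows "p \<in> lattice_paths a b" "p (abs_index c) = c"
    "(\<lambda>l. p (min l (abs_index c))) = p1" "(\<lambda>l. p (max l (abs_index c))) = p2"
proof -
  have le: "abs_index a \<le> abs_index c" "abs_index c \<le> abs_index b"
    using c abs_index_mono by auto
  have q1: "p1 l = c" if "abs_index c \<le> l" for l
    using p1 that by (simp add: lattice_paths_def)
  have q2: "p2 l = c" if "l \<le> abs_index c" for l
    using p2 that by (simp add: lattice_paths_def)
  show "p (abs_index c) = c" by (simp add: p_def q1)
  have mono: "mono p1" "mono p2" using p1 p2 by (auto simp: lattice_paths_def)
  have "mono p"
  proof (rule monoI)
    fix l l' :: nat assume l: "l \<le> l'"
    show "p l \<le> p l'"
      using monoD[OF mono(1) l] monoD[OF mono(2) l] l
        lattice_path_bounds(2)[OF p1, of l] lattice_path_bounds(1)[OF p2, of l']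
      by (auto simp: p_def intro: order_trans)
  qed
  then show "p \<in> lattice_paths a b"
    using p1 p2 le q1 q2 unfolding lattice_paths_def p_def by auto
  show "(\<lambda>l. p (min l (abs_index c))) = p1" "(\<lambda>l. p (max l (abs_index c))) = p2"
    by (rule ext; auto simp: p_def q1 q2 min_def max_def)+
qed

lemma sum_lattice_paths_split:
  "(\<Sum>k\<in>{abs_index a<..abs_index b}. \<Sum>p\<in>lattice_paths a b. H k p)
    = (\<Sum>c\<in>{a<..b}. \<Sum>p1\<in>lattice_paths a c. \<Sum>p2\<in>lattice_paths c b.
        H (abs_index c) (\<lambda>l. if l \<le> abs_index c then p1 l else p2 l))"
proof -
  let ?K = "{abs_index a<..abs_index b} \<times> lattice_paths a b"
  let ?C = "SIGMA c:{a<..b}. lattice_paths a c \<times> lattice_paths c b"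
  let ?split = "\<lambda>(k, p). (p k, (\<lambda>l. p (min l k)), (\<lambda>l. p (max l k)))"
  let ?glue = "\<lambda>(c, p1, p2). (abs_index c, \<lambda>l. if l \<le> abs_index c then p1 l else p2 l)"
  have "(\<Sum>(k, p)\<in>?K. H k p)
    = (\<Sum>(c, p1, p2)\<in>?C. H (abs_index c) (\<lambda>l. if l \<le> abs_index c then p1 l else p2 l))" (is "_ = sum ?H _")
  proof (rule sum.reindex_bij_witness[where j = ?split and i = ?glue])
    fix t assume "t \<in> ?K"
    then obtain k p where t: "t = (k, p)" "abs_index a < k" "k \<le> abs_index b" "p \<in> lattice_paths a b"
      by auto
    note s = lattice_path_split[OF t(4) less_imp_le[OF t(2)] t(3)]
    have "a < p k" using t(2) s(3) lattice_path_bounds(1)[OF t(4), of k] by (auto simp: le_less)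
    moreover have eq: "(\<lambda>l. if l \<le> k then p (min l k) else p (max l k)) = p"
      by (auto simp: min_def max_def)
    ultimately show "?split t \<in> ?C"
      using s lattice_path_bounds(2)[OF t(4)] by (simp add: t(1))
    show "?glue (?split t) = t" "?H (?split t) = (case t of (k, p) \<Rightarrow> H k p)"
      using eq by (simp_all add: t(1) s(3))
  next
    fix t assume "t \<in> ?C"
    then obtain c p1 p2 where t: "t = (c, p1, p2)" "a < c" "c \<le> b"
        "p1 \<in> lattice_paths a c" "p2 \<in> lattice_paths c b"
      by auto
    note g = lattice_path_glue[OF t(4,5) less_imp_le[OF t(2)] t(3)]
    show "?split (?glue t) = t"
      unfolding t(1) prod.case g(2,3,4) ..
    show "?glue t \<in> ?K"
      using g(1) abs_index_strict_mono[OF t(2)] abs_index_mono[OF t(3)] by (simp add: t(1))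
  qed
  moreover have "finite {a<..b}"
    by (rule finite_subset[OF _ finite_multi_index_interval[of a b]]) auto
  ultimately show ?thesis
    by (simp add: sum.cartesian_product sum.Sigma finite_lattice_paths)
qed

text \<open>A path with marked levels is the same as a chain, namely the marked points, with a path for each of
  its steps.\<close>

lemma sum_lattice_paths_chains:
  assumes local: "\<And>p p' k l. (\<And>m. k \<le> m \<Longrightarrow> m \<le> l \<Longrightarrow> p m = p' m) \<Longrightarrow> w p k l = w p' k l"
    and ab: "a \<le> b"
  shows "(\<Sum>p\<in>lattice_paths a b. \<Sum>ks\<in>chains_between (abs_index a) (abs_index b).
            F (map p ks) * step_prod (w p) ks)
    = (\<Sum>v\<in>chains_between a b.
          F v * step_prod (\<lambda>c d. \<Sum>p\<in>lattice_paths c d. w p (abs_index c) (abs_index d)) v)"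
    (is "_ = (\<Sum>v\<in>_. F v * step_prod ?T v)")
  using ab
proof (induction "abs_index b - abs_index a" arbitrary: a F rule: less_induct)
  case less
  show ?case
  proof (cases "a = b")
    case True
    then show ?thesis by (simp add: lattice_paths_self chains_between_self)
  next
    case False
    then have lt: "a < b" using less.prems by simp
    note alt = abs_index_strict_mono[OF lt]
    have step: "(\<Sum>ks\<in>chains_between (abs_index a) (abs_index b). F (map p ks) * step_prod (w p) ks)
        = (\<Sum>k\<in>{abs_index a<..abs_index b}. w p (abs_index a) k *
            (\<Sum>ks\<in>chains_between k (abs_index b). F (a # map p ks) * step_prod (w p) ks))"
      if "p \<in> lattice_paths a b" for p
    proof -
      have "p (abs_index a) = a" using that by (simp add: lattice_paths_def)
      then show ?thesis
        unfolding sum_chains_between[OF alt finite_atLeastAtMost] sum_distrib_left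
        by (intro sum.cong refl) (auto simp: chains_between_def step_prod_Cons)
    qed
    have "(\<Sum>p\<in>lattice_paths a b. \<Sum>ks\<in>chains_between (abs_index a) (abs_index b).
            F (map p ks) * step_prod (w p) ks)
      = (\<Sum>k\<in>{abs_index a<..abs_index b}. \<Sum>p\<in>lattice_paths a b. w p (abs_index a) k *
            (\<Sum>ks\<in>chains_between k (abs_index b). F (a # map p ks) * step_prod (w p) ks))"
      by (subst sum.swap) (simp add: step)
    also have "\<dots> = (\<Sum>c\<in>{a<..b}. \<Sum>p1\<in>lattice_paths a c. \<Sum>p2\<in>lattice_paths c b.
        w p1 (abs_index a) (abs_index c) *
        (\<Sum>ks\<in>chains_between (abs_index c) (abs_index b). F (a # map p2 ks) * step_prod (w p2) ks))"
      unfolding sum_lattice_paths_split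
    proof (intro sum.cong refl arg_cong2[of _ _ _ _ "(*)"])
      fix c p1 p2 ks
      assume c: "c \<in> {a<..b}" and p: "p1 \<in> lattice_paths a c" "p2 \<in> lattice_paths c b"
      let ?p = "\<lambda>l. if l \<le> abs_index c then p1 l else p2 l"
      show "w ?p (abs_index a) (abs_index c) = w p1 (abs_index a) (abs_index c)"
        by (rule local) auto
      assume ks: "ks \<in> chains_between (abs_index c) (abs_index b)"
      have same: "?p m = p2 m" if "abs_index c \<le> m" for m
        using that p by (auto simp: lattice_paths_def)
      have ge: "abs_index c \<le> m" if "m \<in> set ks" for m
        using chains_between_bounds[OF ks that] by simp
      show "F (a # map ?p ks) = F (a # map p2 ks)"
      proof (intro arg_cong[of _ _ F] arg_cong[of _ _ "(#) a"] map_cong refl)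
        fix m assume "m \<in> set ks"
        then show "?p m = p2 m" by (rule same[OF ge])
      qed
      show "step_prod (w ?p) ks = step_prod (w p2) ks"
      proof (intro step_prod_cong local same)
        fix j m assume "0 < j" "j < length ks" "ks ! (j - 1) \<le> m"
        then show "abs_index c \<le> m"
          using ge[of "ks ! (j - 1)"] by force
      qed
    qed
    also have "\<dots> = (\<Sum>c\<in>{a<..b}. ?T a c * (\<Sum>p2\<in>lattice_paths c b.
        \<Sum>ks\<in>chains_between (abs_index c) (abs_index b). F (a # map p2 ks) * step_prod (w p2) ks))"
      by (simp add: sum_product)
    also have "\<dots> = (\<Sum>c\<in>{a<..b}. ?T a c * (\<Sum>v\<in>chains_between c b. F (a # v) * step_prod ?T v))"
    proof (intro sum.cong refl arg_cong2[of _ _ _ _ "(*)"])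
      fix c assume c: "c \<in> {a<..b}"
      then have "abs_index b - abs_index c < abs_index b - abs_index a"
        using abs_index_strict_mono[of a c] abs_index_mono[of c b] by auto
      then show "(\<Sum>p2\<in>lattice_paths c b. \<Sum>ks\<in>chains_between (abs_index c) (abs_index b).
            F (a # map p2 ks) * step_prod (w p2) ks)
          = (\<Sum>v\<in>chains_between c b. F (a # v) * step_prod ?T v)"
        using c less.hyps[of c "\<lambda>v. F (a # v)"] by auto
    qed
    also have "\<dots> = (\<Sum>v\<in>chains_between a b. F v * step_prod ?T v)"
      unfolding sum_chains_between[OF lt finite_multi_index_interval] sum_distrib_left
      by (intro sum.cong refl) (auto simp: chains_between_def step_prod_Cons)
    finally show ?thesis .
  qed
qed

text \<open>The right-hand side of the formula, for an arbitrary weight \<open>f\<close> of faces and arbitrary endpoints.\<close>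

definition partition_sum :: "((nat ^ 'q::finite) list \<Rightarrow> real) \<Rightarrow> nat ^ 'q \<Rightarrow> nat ^ 'q \<Rightarrow> real" where
  "partition_sum f a b =
     (\<Sum>p\<in>lattice_paths a b. dissection_sum (\<lambda>K. f (map p (sorted_list_of_set K))) (abs_index a) (abs_index b))"

lemma partition_sum_unit_step:
  assumes "a \<le> b" "abs_index b = Suc (abs_index a)"
  shows "partition_sum f a b = 1"
proof -
  have "lattice_paths a b = {\<lambda>l. if l \<le> abs_index a then a else b}"
  proof (intro subset_antisym subsetI)
    fix p assume "p \<in> lattice_paths a b"
    then show "p \<in> {\<lambda>l. if l \<le> abs_index a then a else b}"
      using assms by (auto simp: lattice_paths_def fun_eq_iff)
  next
    fix p assume "p \<in> {\<lambda>l. if l \<le> abs_index a then a else b}"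
    then show "p \<in> lattice_paths a b"
      using assms by (auto simp: lattice_paths_def mono_def le_Suc_eq)
  qed
  then show ?thesis
    using assms by (simp add: partition_sum_def dissection_sum_def)
qed

text \<open>This has the form of the recursion for divided differences proved later: the chain is the
  base face, and each of its steps is the base edge of a smaller polygon.\<close>

lemma partition_sum_rec:
  assumes "a \<le> b" "abs_index a + 2 \<le> abs_index b"
  shows "partition_sum f a b =
    (\<Sum>v | v \<in> chains_between a b \<and> 3 \<le> length v. f v * step_prod (partition_sum f) v)"
proof -
  define w where "w = (\<lambda>p. dissection_sum (\<lambda>K. f (map p (sorted_list_of_set K))))"
  define F where "F = (\<lambda>v. if 3 \<le> length v then f v else 0)"
  have local: "w p k l = w p' k l" if "\<And>m. k \<le> m \<Longrightarrow> m \<le> l \<Longrightarrow> p m = p' m" for p p' k l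
    unfolding w_def
  proof (rule dissection_sum_cong)
    fix K assume "K \<subseteq> {k..l}"
    moreover then have "finite K" by (rule finite_subset) simp
    ultimately have "map p (sorted_list_of_set K) = map p' (sorted_list_of_set K)"
      using that by (intro map_cong) auto
    then show "f (map p (sorted_list_of_set K)) = f (map p' (sorted_list_of_set K))" by (rule arg_cong)
  qed
  have "w p (abs_index a) (abs_index b) =
      (\<Sum>ks\<in>chains_between (abs_index a) (abs_index b). F (map p ks) * step_prod (w p) ks)" for p
  proof -
    have "w p (abs_index a) (abs_index b) =
      (\<Sum>ks | ks \<in> chains_between (abs_index a) (abs_index b) \<and> 3 \<le> length ks.
        f (map p (sorted_list_of_set (set ks))) * step_prod (w p) ks)"
      unfolding w_def by (rule dissection_sum_rec[OF assms(2)])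
    also have "\<dots> = (\<Sum>ks\<in>chains_between (abs_index a) (abs_index b). F (map p ks) * step_prod (w p) ks)"
      using finite_chains_between[of "abs_index a" "abs_index b"]
      by (intro sum.mono_neutral_cong_left)
        (auto simp: F_def chains_between_def sorted_list_of_set.idem_if_sorted_distinct
          strict_sorted_iff)
    finally show ?thesis .
  qed
  moreover have "partition_sum f a b = (\<Sum>p\<in>lattice_paths a b. w p (abs_index a) (abs_index b))"
    by (simp add: partition_sum_def w_def)
  ultimately have "partition_sum f a b = (\<Sum>p\<in>lattice_paths a b.
      \<Sum>ks\<in>chains_between (abs_index a) (abs_index b). F (map p ks) * step_prod (w p) ks)"
    by (simp only:)
  also have "\<dots> = (\<Sum>v\<in>chains_between a b. F v * step_prod (partition_sum f) v)"
  proof -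
    have "partition_sum f = (\<lambda>c d. \<Sum>p\<in>lattice_paths c d. w p (abs_index c) (abs_index d))"
      by (simp add: partition_sum_def w_def fun_eq_iff)
    then show ?thesis
      using sum_lattice_paths_chains[of w, OF local assms(1)] by (simp only:)
  qed
  also have "\<dots> = (\<Sum>v | v \<in> chains_between a b \<and> 3 \<le> length v. f v * step_prod (partition_sum f) v)"
    using finite_chains_between[OF finite_multi_index_interval, of a b]
    by (intro sum.mono_neutral_cong_right) (auto simp: F_def)
  finally show ?thesis .
qed

lemma nths_eq_map_nth:
  assumes "K \<subseteq> {..<length p}"
  shows "nths p K = map ((!) p) (sorted_list_of_set K)"
proof -
  have fin: "finite K" using assms finite_subset by blast
  have "nths [0..<length p] K = nths [0..<length p] {i. i < length [0..<length p] \<and> [0..<length p] ! i \<in> K}"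
    using assms by (intro arg_cong[of _ _ "nths _"]) auto
  also have "\<dots> = filter (\<lambda>k. k \<in> K) [0..<length p]"
    by (rule filter_eq_nths[symmetric])
  also have "\<dots> = sorted_list_of_set K"
    by (rule strict_sorted_equal)
      (use assms fin in \<open>auto simp: sorted_wrt_filter\<close>)
  finally have "nths [0..<length p] K = sorted_list_of_set K" .
  then have "nths (map ((!) p) [0..<length p]) K = map ((!) p) (sorted_list_of_set K)"
    by (simp add: nths_map)
  then show ?thesis by (simp add: map_nth)
qed

text \<open>Distinct chords have distinct faces, since the ends of a chord are the extreme vertices of the face
  below it. So the product over the set of faces is a product over chords.\<close>

lemma prod_faces:
  assumes D: "D \<in> dissections 0 N" and N: "2 \<le> N" and p: "length p = Suc N" "distinct p"
  shows "(\<Prod>v\<in>faces p D. f v)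
    = face_weight (\<lambda>K. f (map ((!) p) (sorted_list_of_set K))) (insert (0, N) D)"
proof -
  have N': "0 + 2 \<le> N" using N by simp
  have sub: "face_vertices D e \<subseteq> {..N}" if "e \<in> insert (0, N) D" for e
    using that dissectionsD[OF D N', of "fst e" "snd e"] by (auto simp: face_vertices_def)
  have "inj_on (\<lambda>e. nths p (face_vertices D e)) (insert (0, N) D)"
  proof (rule inj_onI)
    fix e e' assume e: "e \<in> insert (0, N) D" "e' \<in> insert (0, N) D"
      and eq: "nths p (face_vertices D e) = nths p (face_vertices D e')"
    have "set (nths p K) = (!) p ` K" if "K \<subseteq> {..N}" for K
      using that p(1) by (fastforce simp: set_nths)
    then have "(!) p ` face_vertices D e = (!) p ` face_vertices D e'"
      using eq sub[OF e(1)] sub[OF e(2)] by metis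
    moreover have "inj_on ((!) p) {..N}"
      using p by (simp add: inj_on_def nth_eq_iff_index_eq)
    ultimately have "face_vertices D e = face_vertices D e'"
      using sub[OF e(1)] sub[OF e(2)] inj_on_image_eq_iff by metis
    moreover have "fst e = Min (face_vertices D e)" "snd e = Max (face_vertices D e)"
      if e: "e \<in> insert (0, N) D" for e
    proof -
      have "fst e \<in> face_vertices D e" "snd e \<in> face_vertices D e"
        using face_vertices_endpoints[OF D N', of "fst e" "snd e"] e by simp_all
      then show "fst e = Min (face_vertices D e)" "snd e = Max (face_vertices D e)"
        by (auto intro!: Min_eqI[symmetric] Max_eqI[symmetric] simp: finite_face_vertices
            dest: face_vertices_bounds)
    qed
    ultimately show "e = e'"
      using e by (metis prod_eq_iff)
  qed
  then have "(\<Prod>v\<in>faces p D. f v) = (\<Prod>e\<in>insert (0, N) D. f (nths p (face_vertices D e)))"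
    unfolding faces_eq[OF D N p(1)] by (simp only: prod.reindex o_def)
  also have "\<dots> = face_weight (\<lambda>K. f (map ((!) p) (sorted_list_of_set K))) (insert (0, N) D)"
    unfolding face_weight_def
  proof (rule prod.cong[OF refl])
    fix e assume e: "e \<in> insert (0, N) D"
    have "face_vertices (insert (0, N) D) e = face_vertices D e"
      using D e by (intro face_vertices_insert) (auto simp: dissections_chord_sets)
    moreover have "face_vertices D e \<subseteq> {..<length p}"
      using sub[OF e] p(1) by (auto simp: less_Suc_eq_le)
    ultimately show "f (nths p (face_vertices D e))
        = f (map ((!) p) (sorted_list_of_set (face_vertices (insert (0, N) D) e)))"
      by (simp add: nths_eq_map_nth)
  qed
  finally show ?thesis .
qed

lemma chains_toD:
  assumes "p \<in> chains_to n"
  shows "length p = Suc (abs_index n)" "p ! 0 = 0" "p ! abs_index n = n" "sorted_wrt (<) p"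
proof -
  have p: "length p = Suc (abs_index n)" "hd p = 0" "last p = n" "sorted_wrt (<) p"
    using assms by (auto simp: chains_to_def)
  moreover from p(1) have "p \<noteq> []" by auto
  ultimately show "length p = Suc (abs_index n)" "p ! 0 = 0" "p ! abs_index n = n" "sorted_wrt (<) p"
    by (auto simp: hd_conv_nth last_conv_nth)
qed

text \<open>A chain with \<open>abs_index n + 1\<close> members from \<open>0\<close> to \<open>n\<close> has no room to skip a level.\<close>

lemma chains_to_level:
  assumes p: "p \<in> chains_to n" and "i < length p"
  shows "abs_index (p ! i) = i"
proof -
  note len = chains_toD(1)[OF p] and p0 = chains_toD(2)[OF p] and pn = chains_toD(3)[OF p]
    and s = chains_toD(4)[OF p]
  have inc: "abs_index (p ! i) + (j - i) \<le> abs_index (p ! j)" if "i \<le> j" "j < length p" for i j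
    using that
  proof (induction j rule: dec_induct)
    case (step j)
    have "p ! j < p ! Suc j"
      using step sorted_wrt_nth_less[OF s] by simp
    then show ?case
      using step abs_index_strict_mono[of "p ! j" "p ! Suc j"] by simp
  qed simp
  show ?thesis
    using inc[of 0 i] inc[of i "abs_index n"] assms(2) by (simp add: len p0 pn)
qed

lemma sum_partitions_eq_partition_sum:
  assumes N: "2 \<le> abs_index n"
  shows "(\<Sum>p\<in>chains_to n. \<Sum>D\<in>polygon_partitions (abs_index n). \<Prod>v\<in>faces p D. f v)
    = partition_sum f 0 n"
proof -
  define \<phi> where "\<phi> = (\<lambda>(p :: nat \<Rightarrow> _) K. f (map p (sorted_list_of_set K)))"
  have "(\<Sum>D\<in>polygon_partitions (abs_index n). \<Prod>v\<in>faces p D. f v) = dissection_sum (\<phi> ((!) p)) 0 (abs_index n)"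
    if p: "p \<in> chains_to n" for p
  proof -
    have len: "length p = Suc (abs_index n)"
      using p by (simp add: chains_to_def)
    moreover have "distinct p"
      using chains_to_level[OF p] unfolding distinct_conv_nth by metis
    ultimately show ?thesis
      using N by (simp add: dissection_sum_def polygon_partitions_eq_dissections prod_faces \<phi>_def)
  qed
  then have "(\<Sum>p\<in>chains_to n. \<Sum>D\<in>polygon_partitions (abs_index n). \<Prod>v\<in>faces p D. f v)
    = (\<Sum>p\<in>chains_to n. dissection_sum (\<phi> ((!) p)) 0 (abs_index n))"
    by simp
  also have "\<dots> = (\<Sum>p\<in>lattice_paths 0 n. dissection_sum (\<phi> p) 0 (abs_index n))"
  proof (rule sum.reindex_bij_witness[where
      j = "\<lambda>p l. if l \<le> abs_index n then p ! l else n" and i = "\<lambda>p. map p [0..<Suc (abs_index n)]"])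
    fix p assume p: "p \<in> chains_to n"
    define q where "q = (\<lambda>l. if l \<le> abs_index n then p ! l else n)"
    note len = chains_toD(1)[OF p] and p0 = chains_toD(2)[OF p] and pn = chains_toD(3)[OF p]
      and s = chains_toD(4)[OF p]
    show "map q [0..<Suc (abs_index n)] = p"
      using len by (intro nth_equalityI) (auto simp: q_def nth_append simp del: upt_Suc)
    have le: "p ! l \<le> p ! l'" if "l \<le> l'" "l' \<le> abs_index n" for l l'
      using that sorted_wrt_nth_less[OF s, of l l'] len by (cases "l = l'") (auto intro: less_imp_le)
    have "mono q"
    proof (rule monoI)
      fix l l' :: nat assume "l \<le> l'"
      then show "q l \<le> q l'"
        using le[of l l'] le[of l "abs_index n"] pn by (auto simp: q_def)
    qed
    moreover have "abs_index (q l) = l" if "l \<le> abs_index n" for l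
      using that chains_to_level[OF p, of l] len by (simp add: q_def)
    ultimately show "q \<in> lattice_paths 0 n"
      using p0 pn by (auto simp: lattice_paths_def q_def abs_index_def)
    show "dissection_sum (\<phi> q) 0 (abs_index n) = dissection_sum (\<phi> ((!) p)) 0 (abs_index n)"
    proof (rule dissection_sum_cong)
      fix K assume K: "K \<subseteq> {0..abs_index n}"
      then have "finite K" by (rule finite_subset) simp
      then have "map q (sorted_list_of_set K) = map ((!) p) (sorted_list_of_set K)"
        using K by (intro map_cong) (auto simp: q_def)
      then show "\<phi> q K = \<phi> ((!) p) K" by (simp only: \<phi>_def)
    qed
  next
    fix p assume p: "p \<in> lattice_paths 0 n"
    then have pl: "abs_index (p l) = l" if "l \<le> abs_index n" for l
      using that by (simp add: lattice_paths_def abs_index_def)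
    have p0: "p 0 = 0" and pn: "\<And>l. abs_index n \<le> l \<Longrightarrow> p l = n" and m: "mono p"
      using p by (auto simp: lattice_paths_def)
    show "(\<lambda>l. if l \<le> abs_index n then map p [0..<Suc (abs_index n)] ! l else n) = p"
      using pn by (auto simp: fun_eq_iff simp del: upt_Suc)
    have "p i < p j" if "i < j" "j \<le> abs_index n" for i j
      using monoD[OF m, of i j] pl[of i] pl[of j] that by (auto simp: less_le)
    then have "sorted_wrt (<) (map p [0..<Suc (abs_index n)])"
      by (auto simp: sorted_wrt_iff_nth_less simp del: upt_Suc)
    then show "map p [0..<Suc (abs_index n)] \<in> chains_to n"
      using p0 pn by (auto simp: chains_to_def hd_map last_map simp del: upt_Suc)
  qed
  also have "\<dots> = partition_sum f 0 n"
    by (simp add: partition_sum_def \<phi>_def abs_index_def)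
  finally show ?thesis .
qed

section \<open>Divided differences as weighted sums of values\<close>

text \<open>The coefficient of \<open>f z\<close> in the divided difference of \<open>f\<close> at the points of \<open>S\<close>.\<close>

definition dd_weight :: "real set \<Rightarrow> real \<Rightarrow> real" where
  "dd_weight S z = 1 / (\<Prod>l\<in>S - {z}. z - l)"

text \<open>The univariate divided difference at a set of points, in Lagrange form. It is visibly
  symmetric in the points and linear in \<open>f\<close>.\<close>

definition dd1 :: "(real \<Rightarrow> real) \<Rightarrow> real set \<Rightarrow> real" where
  "dd1 f S = (\<Sum>z\<in>S. f z * dd_weight S z)"

definition set_dd :: "(('d::finite \<Rightarrow> real) \<Rightarrow> real) \<Rightarrow> ('d \<Rightarrow> real set) \<Rightarrow> real" where
  "set_dd f S = (\<Sum>u\<in>PiE UNIV S. f u * (\<Prod>j\<in>UNIV. dd_weight (S j) (u j)))"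

lemma dd_weight_singleton [simp]: "dd_weight {z} z = 1"
  by (simp add: dd_weight_def)

lemma dd_weight_remove:
  assumes "finite S" "a \<in> S" "z \<in> S" "z \<noteq> a"
  shows "dd_weight (S - {a}) z = (z - a) * dd_weight S z"
proof -
  have "S - {z} = insert a (S - {a} - {z})"
    using assms by auto
  then have "(\<Prod>l\<in>S - {z}. z - l) = (z - a) * (\<Prod>l\<in>S - {a} - {z}. z - l)"
    using assms by simp
  then show ?thesis using assms by (simp add: dd_weight_def)
qed

lemma dd1_remove:
  assumes "finite S" "a \<in> S"
  shows "dd1 f (S - {a}) = dd1 (\<lambda>z. (z - a) * f z) S"
proof -
  have "dd1 f (S - {a}) = (\<Sum>z\<in>S - {a}. (z - a) * f z * dd_weight S z)"
    unfolding dd1_def using assms by (intro sum.cong refl) (simp add: dd_weight_remove)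
  also have "\<dots> = dd1 (\<lambda>z. (z - a) * f z) S"
    unfolding dd1_def using assms by (intro sum.mono_neutral_left) auto
  finally show ?thesis .
qed

lemma dd1_rec:
  assumes "finite S" "p \<in> S" "q \<in> S"
  shows "(q - p) * dd1 f S = dd1 f (S - {p}) - dd1 f (S - {q})"
  using assms unfolding dd1_remove[OF assms(1,2)] dd1_remove[OF assms(1,3)]
  by (simp add: dd1_def sum_distrib_left flip: sum_subtractf) (simp add: algebra_simps)

text \<open>The Leibniz rule for a product with the identity, with any point of \<open>S\<close> in the first position.\<close>

lemma dd1_mult_id:
  assumes "finite S" "a \<in> S"
  shows "dd1 (\<lambda>z. z * f z) S = a * dd1 f S + dd1 f (S - {a})"
  unfolding dd1_remove[OF assms]
  by (simp add: dd1_def sum_distrib_left flip: sum.distrib) (simp add: algebra_simps)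

text \<open>The Lagrange interpolation polynomial; its top coefficient is the divided difference.\<close>

lemma interpolation_poly:
  assumes S: "finite S" "S \<noteq> {}"
  obtains P where "degree P < card S" "\<And>z. z \<in> S \<Longrightarrow> poly P z = F z" "coeff P (card S - 1) = dd1 F S"
proof -
  define L where "L = (\<lambda>z. \<Prod>l\<in>S - {z}. [:- l, 1:])"
  define P where "P = (\<Sum>z\<in>S. smult (F z * dd_weight S z) (L z))"
  have cpos: "card S > 0" using S by (simp add: card_gt_0_iff)
  have degL: "degree (L z) = card S - 1" if "z \<in> S" for z
    using that S(1) by (simp add: L_def degree_prod_eq_sum_degree)
  have monic: "coeff (L z) (card S - 1) = 1" if "z \<in> S" for z
  proof -
    have "lead_coeff (L z) = 1" unfolding L_def by (simp add: lead_coeff_prod)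
    then show ?thesis using degL[OF that] by simp
  qed
  have "degree P \<le> card S - 1"
    unfolding P_def using S(1) degL by (intro degree_sum_le) (auto intro: order_trans[OF degree_smult_le])
  moreover have "coeff P (card S - 1) = dd1 F S"
    by (simp add: P_def dd1_def coeff_sum monic[unfolded One_nat_def])
  moreover have "poly P w = F w" if w: "w \<in> S" for w
  proof -
    have pL: "poly (L z) w = (\<Prod>l\<in>S - {z}. w - l)" for z
      by (simp add: L_def poly_prod)
    have "poly (L z) w = 0" if "z \<in> S - {w}" for z
      unfolding pL using that w S(1) by (intro prod_zero) auto
    then have "poly P w = F w * (dd_weight S w * poly (L w) w)"
      using w S(1) by (simp add: P_def poly_sum sum.remove[of S w])
    also have "dd_weight S w * poly (L w) w = 1"
      using S(1) by (simp add: pL dd_weight_def)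
    finally show ?thesis by simp
  qed
  moreover have "degree P < card S"
    using cpos \<open>degree P \<le> card S - 1\<close> by linarith
  ultimately show ?thesis by (intro that[of P])
qed

lemma dd1_poly:
  assumes "finite S" "degree Q < card S"
  shows "dd1 (poly Q) S = coeff Q (card S - 1)"
proof -
  have "S \<noteq> {}" using assms by auto
  then obtain P where P: "degree P < card S" "\<And>z. z \<in> S \<Longrightarrow> poly P z = poly Q z"
      "coeff P (card S - 1) = dd1 (poly Q) S"
    using interpolation_poly[OF assms(1), of "poly Q"] by metis
  then have "P = Q"
    using assms by (intro poly_eqI_degree[of S]) auto
  then show ?thesis using P by simp
qed

lemma dd1_cong: "(\<And>z. z \<in> S \<Longrightarrow> f z = g z) \<Longrightarrow> dd1 f S = dd1 g S"
  unfolding dd1_def by (intro sum.cong) auto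

lemma dd1_const:
  assumes "finite S" "S \<noteq> {}"
  shows "dd1 (\<lambda>_. c) S = (if card S = 1 then c else 0)"
proof -
  have "dd1 (\<lambda>_. c) S = dd1 (poly [:c:]) S" by (rule dd1_cong) simp
  also have "\<dots> = coeff [:c:] (card S - 1)"
    using assms by (intro dd1_poly) (auto simp: card_gt_0_iff)
  also have "\<dots> = (if card S = 1 then c else 0)"
  proof -
    have "card S - 1 = 0 \<longleftrightarrow> card S = 1"
      using assms by (auto simp: card_gt_0_iff Suc_le_eq le_Suc_eq)
    then show ?thesis by (simp add: coeff_pCons split: nat.splits)
  qed
  finally show ?thesis .
qed

text \<open>A mean value theorem that lowers the order by one and leaves a divided difference of the
  derivative. Unlike the classical version with a single intermediate point, it can be iterated in
  several variables. Rolle's theorem, applied to \<open>F - P\<close> for the interpolation polynomial \<open>P\<close> of \<open>F\<close>, shows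
  that \<open>P'\<close> interpolates \<open>F'\<close> at \<open>n\<close> points, and one compares top coefficients.\<close>

lemma dd1_mean_value:
  assumes S: "finite S" "card S = Suc n" "0 < n"
    and der: "\<And>z. Min S \<le> z \<Longrightarrow> z \<le> Max S \<Longrightarrow> (F has_real_derivative F' z) (at z)"
  obtains T where "finite T" "card T = n" "T \<subseteq> {Min S..Max S}" "dd1 F S = dd1 F' T / n"
proof -
  have ne: "S \<noteq> {}" using S by auto
  obtain P where P: "degree P < card S" "\<And>z. z \<in> S \<Longrightarrow> poly P z = F z" "coeff P (card S - 1) = dd1 F S"
    using interpolation_poly[OF S(1) ne, of F] by metis
  define zs where "zs = sorted_list_of_set S"
  have zs: "sorted_wrt (<) zs" "set zs = S" "length zs = Suc n"
    using S by (auto simp: zs_def)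
  have mem: "zs ! i \<in> S" if "i \<le> n" for i
    using that zs nth_mem[of i zs] by auto
  have "\<exists>\<xi>. zs ! i < \<xi> \<and> \<xi> < zs ! Suc i \<and> F' \<xi> = poly (pderiv P) \<xi>" if i: "i < n" for i
  proof -
    have lt: "zs ! i < zs ! Suc i"
      using i zs by (intro sorted_wrt_nth_less[OF zs(1)]) auto
    have hull: "Min S \<le> z \<and> z \<le> Max S" if "zs ! i \<le> z" "z \<le> zs ! Suc i" for z
      using that i mem[of i] mem[of "Suc i"] Min_le[OF S(1), of "zs ! i"] Max_ge[OF S(1), of "zs ! Suc i"] by auto
    have der': "((\<lambda>z. F z - poly P z) has_real_derivative (F' z - poly (pderiv P) z)) (at z)"
      if "zs ! i \<le> z" "z \<le> zs ! Suc i" for z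
      using der hull that by (intro DERIV_diff poly_DERIV) auto
    have "\<exists>\<xi>. zs ! i < \<xi> \<and> \<xi> < zs ! Suc i \<and> (*) (F' \<xi> - poly (pderiv P) \<xi>) = (\<lambda>v. 0)"
    proof (rule Rolle_deriv[OF lt, of "\<lambda>z. F z - poly P z"])
      show "F (zs ! i) - poly P (zs ! i) = F (zs ! Suc i) - poly P (zs ! Suc i)"
        using P(2) mem i by simp
      show "continuous_on {zs ! i..zs ! Suc i} (\<lambda>z. F z - poly P z)"
        using der' by (intro DERIV_continuous_on) (auto intro: has_field_derivative_at_within)
      show "((\<lambda>z. F z - poly P z) has_derivative (*) (F' z - poly (pderiv P) z)) (at z)"
        if "zs ! i < z" "z < zs ! Suc i" for z
        using der'[of z] that by (simp add: has_field_derivative_def)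
    qed
    then show ?thesis by (metis eq_iff_diff_eq_0 mult_cancel_left1 mult.right_neutral)
  qed
  then obtain \<xi> where \<xi>: "\<And>i. i < n \<Longrightarrow> zs ! i < \<xi> i" "\<And>i. i < n \<Longrightarrow> \<xi> i < zs ! Suc i"
      "\<And>i. i < n \<Longrightarrow> F' (\<xi> i) = poly (pderiv P) (\<xi> i)"
    by metis
  define T where "T = \<xi> ` {..<n}"
  have "\<xi> i < \<xi> j" if "i < j" "j < n" for i j
  proof -
    have "zs ! Suc i \<le> zs ! j"
      using that zs sorted_wrt_nth_less[OF zs(1), of "Suc i" j] by (cases "Suc i = j") auto
    then show ?thesis using \<xi>(2)[of i] \<xi>(1)[of j] that by simp
  qed
  then have "inj_on \<xi> {..<n}"
    by (intro linorder_inj_onI) (auto simp: less_le)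
  then have cT: "card T = n" "finite T"
    by (auto simp: T_def card_image)
  have "T \<subseteq> {Min S..Max S}"
  proof
    fix t assume "t \<in> T"
    then obtain i where i: "i < n" "t = \<xi> i" by (auto simp: T_def)
    then show "t \<in> {Min S..Max S}"
      using \<xi>(1,2)[of i] Min_le[OF S(1) mem[of i]] Max_ge[OF S(1) mem[of "Suc i"]] by auto
  qed
  moreover have "dd1 F S = dd1 F' T / n"
  proof -
    have "dd1 F' T = dd1 (poly (pderiv P)) T"
      using \<xi>(3) by (intro dd1_cong) (auto simp: T_def)
    also have "\<dots> = coeff (pderiv P) (card T - 1)"
      using cT S P(1) by (intro dd1_poly) (auto simp: degree_pderiv)
    also have "\<dots> = n * coeff P n"
      using cT S by (simp add: coeff_pderiv)
    finally show ?thesis using P(3) S by simp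
  qed
  ultimately show ?thesis using that cT by blast
qed

text \<open>Reduces statements about one of the variables to the univariate case.\<close>

lemma set_dd_expand:
  assumes "\<And>i. finite (S i)"
  shows "set_dd f S = dd1 (\<lambda>z. set_dd f (S(j := {z}))) (S j)"
proof -
  have un: "PiE UNIV S = (\<Union>z\<in>S j. PiE UNIV (S(j := {z})))"
    by (auto simp: PiE_iff fun_upd_def split: if_splits)
  have "set_dd f S = (\<Sum>z\<in>S j. \<Sum>u\<in>PiE UNIV (S(j := {z})). f u * (\<Prod>j\<in>UNIV. dd_weight (S j) (u j)))"
    unfolding set_dd_def un
  proof (rule sum.UNION_disjoint)
    show "\<forall>z\<in>S j. finite (PiE UNIV (S(j := {z})))"
      using assms by (auto intro!: finite_PiE)
    show "\<forall>z\<in>S j. \<forall>z'\<in>S j. z \<noteq> z' \<longrightarrow> PiE UNIV (S(j := {z})) \<inter> PiE UNIV (S(j := {z'})) = {}"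
    proof (intro ballI impI equals0I)
      fix z z' u assume "z \<noteq> z'" and u: "u \<in> PiE UNIV (S(j := {z})) \<inter> PiE UNIV (S(j := {z'}))"
      have "u j \<in> (S(j := {z})) j" "u j \<in> (S(j := {z'})) j"
        using u PiE_mem[OF _ UNIV_I] by blast+
      then show False using \<open>z \<noteq> z'\<close> by simp
    qed
  qed (use assms in auto)
  also have "\<dots> = (\<Sum>z\<in>S j. set_dd f (S(j := {z})) * dd_weight (S j) z)"
    unfolding set_dd_def sum_distrib_right
  proof (intro sum.cong refl)
    fix z u assume u: "u \<in> PiE UNIV (S(j := {z}))"
    have uj: "u j = z"
      using PiE_mem[OF u UNIV_I, of j] by simp
    have "(\<Prod>i\<in>UNIV. dd_weight (S i) (u i)) = dd_weight (S j) z * (\<Prod>i\<in>UNIV - {j}. dd_weight (S i) (u i))"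
      using uj by (simp add: prod.remove[of UNIV j])
    moreover have "(\<Prod>i\<in>UNIV. dd_weight ((S(j := {z})) i) (u i)) = (\<Prod>i\<in>UNIV - {j}. dd_weight (S i) (u i))"
      using uj by (subst prod.remove[of UNIV j]) (auto intro!: prod.cong)
    ultimately show "f u * (\<Prod>i\<in>UNIV. dd_weight (S i) (u i)) =
        f u * (\<Prod>i\<in>UNIV. dd_weight ((S(j := {z})) i) (u i)) * dd_weight (S j) z"
      by simp
  qed
  finally show ?thesis by (simp add: dd1_def)
qed

lemma set_dd_rec:
  assumes "\<And>i. finite (S i)" "p \<in> S j" "q \<in> S j"
  shows "(q - p) * set_dd f S = set_dd f (S(j := S j - {p})) - set_dd f (S(j := S j - {q}))"
proof -
  have "set_dd f (S(j := S j - {a})) = dd1 (\<lambda>z. set_dd f (S(j := {z}))) (S j - {a})" for a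
    using assms(1) by (subst set_dd_expand[of _ _ j]) auto
  then show ?thesis
    unfolding set_dd_expand[where f = f and j = j and S = S, OF assms(1)] using assms by (simp add: dd1_rec)
qed

lemma dd_distinct_eq_set_dd:
  assumes "\<And>j. distinct (X j)" "\<And>j. X j \<noteq> []"
  shows "dd_distinct f X = set_dd f (\<lambda>j. set (X j))"
  using assms
proof (induction "\<Sum>j\<in>UNIV. length (X j)" arbitrary: X rule: less_induct)
  case less
  show ?case
  proof (cases "\<forall>j. length (X j) \<le> 1")
    case True
    then have X: "X j = [hd (X j)]" for j
      using less.prems(2)[of j] spec[OF True, of j] by (cases "X j") auto
    have s: "set (X j) = {hd (X j)}" for j
      by (subst X) simp
    have "PiE UNIV (\<lambda>j. {hd (X j)}) = {\<lambda>j. hd (X j)}"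
      by (auto simp: PiE_iff fun_eq_iff)
    then show ?thesis
      using True by (subst dd_distinct.simps) (simp add: set_dd_def s)
  next
    case False
    then obtain j where j: "length (X j) > 1" by (auto simp: not_le)
    obtain a xs where Xj: "X j = a # xs" "xs \<noteq> []"
      using j by (cases "X j") auto
    have d: "distinct (X j)" using less.prems by blast
    have ends: "hd (X j) \<in> set (X j)" "last (X j) \<in> set (X j)" "hd (X j) \<noteq> last (X j)"
      using Xj d by auto
    have tl: "set (tl (X j)) = set (X j) - {hd (X j)}"
      using Xj d by auto
    have bl: "set (butlast (X j)) = set (X j) - {last (X j)}"
    proof -
      have "X j = butlast (X j) @ [last (X j)]" using Xj by simp
      then have "distinct (butlast (X j) @ [last (X j)])" "set (X j) = set (butlast (X j) @ [last (X j)])"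
        using d by metis+
      then show ?thesis by auto
    qed
    have IH: "dd_distinct f (X(j := ys)) = set_dd f (\<lambda>i. set ((X(j := ys)) i))"
      if "distinct ys" "ys \<noteq> []" "length ys < length (X j)" for ys
      using that less.prems by (intro less.hyps sum_length_update_less) auto
    have fs: "(\<lambda>i. set ((X(j := ys)) i)) = (\<lambda>i. set (X i))(j := set ys)" for ys
      by (simp add: fun_eq_iff)
    have "(last (X j) - hd (X j)) * set_dd f (\<lambda>i. set (X i)) =
        set_dd f (\<lambda>i. set ((X(j := tl (X j))) i)) - set_dd f (\<lambda>i. set ((X(j := butlast (X j))) i))"
      unfolding fs tl bl using ends by (intro set_dd_rec) auto
    also have "\<dots> = dd_distinct f (X(j := tl (X j))) - dd_distinct f (X(j := butlast (X j)))"
    proof -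
      have "dd_distinct f (X(j := tl (X j))) = set_dd f (\<lambda>i. set ((X(j := tl (X j))) i))"
        using Xj d by (intro IH) auto
      moreover have "dd_distinct f (X(j := butlast (X j))) = set_dd f (\<lambda>i. set ((X(j := butlast (X j))) i))"
        using Xj d by (intro IH distinct_butlast) auto
      ultimately show ?thesis by (simp only:)
    qed
    finally show ?thesis
      using ends(3) unfolding dd_distinct_rec[where X = X and j = j, OF j] by (simp add: field_simps)
  qed
qed

section \<open>Existence of limits of divided differences\<close>

text \<open>Stated with a common bound for all coordinates, because that is how tuples of groups of points
  approach each other.\<close>

definition box_continuous :: "(('d::finite \<Rightarrow> real) \<Rightarrow> real) \<Rightarrow> ('d \<Rightarrow> real set) \<Rightarrow> bool" where
  "box_continuous f B \<longleftrightarrow>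
     (\<forall>u\<in>Pi UNIV B. \<forall>e>0. \<exists>d>0. \<forall>v\<in>Pi UNIV B. (\<forall>j. \<bar>v j - u j\<bar> < d) \<longrightarrow> \<bar>f v - f u\<bar> < e)"

text \<open>Smoothness in the form that the induction on the order consumes: one partial derivative at a time,
  in an arbitrary order of the variables.\<close>

fun partials_continuous :: "nat \<Rightarrow> (('d::finite \<Rightarrow> real) \<Rightarrow> real) \<Rightarrow> ('d \<Rightarrow> real set) \<Rightarrow> bool" where
  "partials_continuous 0 f B \<longleftrightarrow> box_continuous f B"
| "partials_continuous (Suc k) f B \<longleftrightarrow> box_continuous f B \<and>
     (\<forall>j. \<exists>f'. (\<forall>u\<in>Pi UNIV B. ((\<lambda>t. f (u(j := t))) has_real_derivative f' u) (at (u j)))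
        \<and> partials_continuous k f' B)"

lemma partials_continuous_imp_continuous: "partials_continuous k f B \<Longrightarrow> box_continuous f B"
  by (cases k) auto

lemma partials_continuous_SucD: "partials_continuous (Suc k) f B \<Longrightarrow> partials_continuous k f B"
proof (induction k arbitrary: f)
  case (Suc k)
  show ?case
    using Suc.prems Suc.IH by (subst partials_continuous.simps, subst (asm) partials_continuous.simps) metis
qed simp

lemma partials_continuous_mono:
  assumes "partials_continuous k f B" "m \<le> k"
  shows "partials_continuous m f B"
  using assms(2)
proof (induction rule: inc_induct)
  case base
  show ?case by (rule assms(1))
next
  case (step n)
  show ?case using step.IH by (rule partials_continuous_SucD)
qed

definition near_groups :: "real \<Rightarrow> ('d \<Rightarrow> real list) \<Rightarrow> ('d \<Rightarrow> real list) \<Rightarrow> bool" where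
  "near_groups e X Z \<longleftrightarrow> (\<forall>j. distinct (Z j) \<and> list_all2 (\<lambda>z x. dist z x < e) (Z j) (X j))"

lemma near_groupsD:
  assumes "near_groups e X Z"
  shows "distinct (Z j)" "list_all2 (\<lambda>z x. dist z x < e) (Z j) (X j)"
  using assms by (auto simp: near_groups_def)

lemma near_groups_mono:
  assumes "near_groups d X Z" "d \<le> e"
  shows "near_groups e X Z"
  unfolding near_groups_def
proof (intro allI conjI)
  fix j
  show "distinct (Z j)" using assms(1) by (rule near_groupsD)
  show "list_all2 (\<lambda>z x. dist z x < e) (Z j) (X j)"
    by (rule list_all2_mono[OF near_groupsD(2)[OF assms(1)]]) (use assms(2) in simp)
qed

lemma eventually_distinct_near:
  "eventually P (distinct_near X) \<longleftrightarrow> (\<exists>e>0. \<forall>Z. near_groups e X Z \<longrightarrow> P Z)"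
proof -
  have "eventually P (distinct_near X) \<longleftrightarrow> (\<exists>e\<in>{0<..}. eventually P (principal {Z. near_groups e X Z}))"
    unfolding distinct_near_def near_groups_def[symmetric]
  proof (rule eventually_INF_base)
    fix d e :: real assume de: "d \<in> {0<..}" "e \<in> {0<..}"
    show "\<exists>x\<in>{0<..}. principal {Z. near_groups x X Z}
        \<le> inf (principal {Z. near_groups d X Z}) (principal {Z. near_groups e X Z})"
    proof (rule bexI)
      show "principal {Z. near_groups (min d e) X Z}
        \<le> inf (principal {Z. near_groups d X Z}) (principal {Z. near_groups e X Z})"
        using near_groups_mono[where d = "min d e" and X = X] by auto
    qed (use de in auto)
  qed auto
  then show ?thesis by (auto simp: eventually_principal)
qed

lemma near_groups_length: "near_groups e X Z \<Longrightarrow> length (Z j) = length (X j)"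
  by (rule list_all2_lengthD[OF near_groupsD(2)])

lemma near_groups_nth: "near_groups e X Z \<Longrightarrow> i < length (X j) \<Longrightarrow> dist (Z j ! i) (X j ! i) < e"
  by (rule list_all2_nthD2[OF near_groupsD(2)])

lemma tendsto_group_point:
  assumes "i < length (X j)"
  shows "((\<lambda>Z. Z j ! i) \<longlongrightarrow> X j ! i) (distinct_near X)"
  unfolding tendsto_iff eventually_distinct_near using near_groups_nth[of _ X _ i j] assms by blast

lemma near_groups_update:
  assumes "near_groups e X Z" "distinct zs" "list_all2 (\<lambda>z x. dist z x < e) zs xs"
  shows "near_groups e (X(j := xs)) (Z(j := zs))"
  using assms by (auto simp: near_groups_def)

definition del_nth :: "nat \<Rightarrow> 'a list \<Rightarrow> 'a list" where
  "del_nth i xs = take i xs @ drop (Suc i) xs"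

lemma length_del_nth: "i < length xs \<Longrightarrow> length (del_nth i xs) = length xs - 1"
  by (simp add: del_nth_def)

lemma set_del_nth_subset: "set (del_nth i xs) \<subseteq> set xs"
  by (auto simp: del_nth_def dest: in_set_takeD in_set_dropD)

lemma del_nth_distinct:
  assumes "distinct xs" "i < length xs"
  shows "distinct (del_nth i xs)" "set (del_nth i xs) = set xs - {xs ! i}"
proof -
  have "xs = take i xs @ xs ! i # drop (Suc i) xs"
    using assms(2) by (simp add: id_take_nth_drop)
  then have "distinct (take i xs @ xs ! i # drop (Suc i) xs)" "set xs = set (take i xs @ xs ! i # drop (Suc i) xs)"
    using assms(1) by metis+
  then show "distinct (del_nth i xs)" "set (del_nth i xs) = set xs - {xs ! i}"
    by (auto simp: del_nth_def)
qed

lemma list_all2_del_nth: "list_all2 P xs ys \<Longrightarrow> list_all2 P (del_nth i xs) (del_nth i ys)"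
  unfolding del_nth_def by (intro list_all2_appendI list_all2_takeI list_all2_dropI)

lemma filterlim_del_nth:
  assumes "i < length (X j)"
  shows "filterlim (\<lambda>Z. Z(j := del_nth i (Z j))) (distinct_near (X(j := del_nth i (X j)))) (distinct_near X)"
  unfolding filterlim_iff
proof (intro allI impI)
  fix P assume "eventually P (distinct_near (X(j := del_nth i (X j))))"
  then obtain e where e: "e > 0" "\<And>Z. near_groups e (X(j := del_nth i (X j))) Z \<Longrightarrow> P Z"
    unfolding eventually_distinct_near by blast
  have "P (Z(j := del_nth i (Z j)))" if Z: "near_groups e X Z" for Z
  proof (intro e(2) near_groups_update Z)
    show "distinct (del_nth i (Z j))"
      using near_groupsD[OF Z] assms near_groups_length[OF Z, of j] by (intro del_nth_distinct) auto
    show "list_all2 (\<lambda>z x. dist z x < e) (del_nth i (Z j)) (del_nth i (X j))"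
      by (intro list_all2_del_nth near_groupsD[OF Z])
  qed
  then show "\<forall>\<^sub>F Z in distinct_near X. P (Z(j := del_nth i (Z j)))"
    unfolding eventually_distinct_near using e(1) by blast
qed

text \<open>All other groups of points being fixed, the divided difference is a univariate one, of a linear
  combination of sections of \<open>f\<close>.\<close>

lemma set_dd_mean_value:
  assumes S: "\<And>i. finite (S i)" "\<And>i. S i \<noteq> {}" "card (S j) = Suc n" "0 < n"
    and sub: "\<And>i. i \<noteq> j \<Longrightarrow> S i \<subseteq> B i" "{Min (S j)..Max (S j)} \<subseteq> B j"
    and der: "\<And>u. u \<in> Pi UNIV B \<Longrightarrow> ((\<lambda>t. f (u(j := t))) has_real_derivative f' u) (at (u j))"
  obtains T where "finite T" "card T = n" "T \<subseteq> {Min (S j)..Max (S j)}"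
    "set_dd f S = set_dd f' (S(j := T)) / n"
proof -
  define H where "H = (\<lambda>h z. set_dd h (S(j := {z})))"
  have H: "H h z = (\<Sum>u\<in>PiE UNIV (S(j := {undefined})). h (u(j := z)) * (\<Prod>i\<in>UNIV - {j}. dd_weight (S i) (u i)))" for h z
    unfolding H_def set_dd_def
  proof (rule sum.reindex_bij_witness[where i = "\<lambda>u. u(j := z)" and j = "\<lambda>u. u(j := undefined)"])
    fix u assume u: "u \<in> PiE UNIV (S(j := {z}))"
    have uj: "u j = z" using PiE_mem[OF u UNIV_I, of j] by simp
    have ui: "u i \<in> S i" if "i \<noteq> j" for i
      using PiE_mem[OF u UNIV_I, of i] that by simp
    show "u(j := undefined, j := z) = u" using uj by auto
    show "u(j := undefined) \<in> PiE UNIV (S(j := {undefined}))"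
      using ui by (auto simp: PiE_iff)
    show "h (u(j := undefined, j := z)) * (\<Prod>i\<in>UNIV - {j}. dd_weight (S i) ((u(j := undefined)) i))
        = h u * (\<Prod>i\<in>UNIV. dd_weight ((S(j := {z})) i) (u i))"
      using uj by (simp add: prod.remove[of UNIV j] fun_upd_idem)
  next
    fix u assume u: "u \<in> PiE UNIV (S(j := {undefined}))"
    have uj: "u j = undefined" using PiE_mem[OF u UNIV_I, of j] by simp
    have ui: "u i \<in> S i" if "i \<noteq> j" for i
      using PiE_mem[OF u UNIV_I, of i] that by simp
    show "u(j := z, j := undefined) = u" using uj by auto
    show "u(j := z) \<in> PiE UNIV (S(j := {z}))"
      using ui by (auto simp: PiE_iff)
  qed
  have "(H f has_real_derivative H f' z) (at z)" if z: "Min (S j) \<le> z" "z \<le> Max (S j)" for z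
    unfolding H[abs_def]
  proof (intro DERIV_sum DERIV_cmult_right)
    fix u assume u: "u \<in> PiE UNIV (S(j := {undefined}))"
    have "u i \<in> S i" if "i \<noteq> j" for i
      using PiE_mem[OF u UNIV_I, of i] that by simp
    then have "u(j := z) \<in> Pi UNIV B"
      using sub z by fastforce
    from der[OF this] show "((\<lambda>z. f (u(j := z))) has_real_derivative f' (u(j := z))) (at z)"
      by simp
  qed
  then obtain T where T: "finite T" "card T = n" "T \<subseteq> {Min (S j)..Max (S j)}" "dd1 (H f) (S j) = dd1 (H f') T / n"
    using dd1_mean_value[of "S j" n "H f" "H f'"] S by metis
  have "set_dd f S = dd1 (H f) (S j)"
    unfolding H_def by (rule set_dd_expand[OF S(1)])
  moreover have "set_dd f' (S(j := T)) = dd1 (H f') T"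
    unfolding H_def using S(1) T(1) by (subst set_dd_expand[of _ _ j]) auto
  ultimately show ?thesis using that T by metis
qed

lemma eventually_groups_in_box:
  fixes B :: "'d::finite \<Rightarrow> real set"
  assumes "\<And>j. open (B j)" "\<And>j. set (X j) \<subseteq> B j"
  obtains e where "e > 0" "\<And>j x z. x \<in> set (X j) \<Longrightarrow> dist z x < e \<Longrightarrow> z \<in> B j"
proof -
  define A where "A = (SIGMA j:UNIV. set (X j))"
  have finA: "finite A" by (auto simp: A_def)
  have "\<forall>a\<in>A. \<exists>e>0. ball (snd a) e \<subseteq> B (fst a)"
    using assms by (auto simp: A_def subset_iff open_contains_ball)
  then obtain \<epsilon> where \<epsilon>: "\<And>a. a \<in> A \<Longrightarrow> \<epsilon> a > 0" "\<And>a. a \<in> A \<Longrightarrow> ball (snd a) (\<epsilon> a) \<subseteq> B (fst a)"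
    by metis
  define e where "e = Min (insert 1 (\<epsilon> ` A))"
  have "e > 0" using finA \<epsilon>(1) by (auto simp: e_def)
  moreover have "z \<in> B j" if "x \<in> set (X j)" "dist z x < e" for j x z
  proof -
    have "(j, x) \<in> A" using that by (simp add: A_def)
    then have "e \<le> \<epsilon> (j, x)" using finA by (auto simp: e_def)
    then have "z \<in> ball x (\<epsilon> (j, x))" using that by (simp add: dist_commute)
    then show ?thesis using \<epsilon>(2)[OF \<open>(j, x) \<in> A\<close>] by auto
  qed
  ultimately show ?thesis using that by blast
qed

lemma dd_distinct_near_eq_set_dd:
  fixes f :: "('d::finite \<Rightarrow> real) \<Rightarrow> real"
  assumes Z: "near_groups e X Z" and ne: "\<And>j. X j \<noteq> []"
  shows "dd_distinct f Z = set_dd f (\<lambda>j. set (Z j))"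
proof (rule dd_distinct_eq_set_dd)
  show "Z j \<noteq> []" for j using near_groups_length[OF Z, of j] ne[of j] by auto
qed (rule near_groupsD[OF Z])

text \<open>Two points of a group that remain distinct in the limit give a difference quotient of lower order
  whose denominator does not tend to \<open>0\<close>. By symmetry the two points can be anywhere in the group.\<close>

lemma dd_distinct_tendsto_from_deletions:
  fixes f :: "('d::finite \<Rightarrow> real) \<Rightarrow> real"
  assumes ne: "\<And>j. X j \<noteq> []"
    and diff: "p < length (X j)" "q < length (X j)" "X j ! p \<noteq> X j ! q"
    and L: "(dd_distinct f \<longlongrightarrow> Lp) (distinct_near (X(j := del_nth p (X j))))"
      "(dd_distinct f \<longlongrightarrow> Lq) (distinct_near (X(j := del_nth q (X j))))"
  shows "(dd_distinct f \<longlongrightarrow> (Lp - Lq) / (X j ! q - X j ! p)) (distinct_near X)"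
proof -
  have two: "1 < length (X j)"
  proof (rule ccontr)
    assume "\<not> 1 < length (X j)"
    then have "p = q" using diff by auto
    then show False using diff by simp
  qed
  have lim: "((\<lambda>Z. (dd_distinct f (Z(j := del_nth p (Z j))) - dd_distinct f (Z(j := del_nth q (Z j))))
      / (Z j ! q - Z j ! p)) \<longlongrightarrow> (Lp - Lq) / (X j ! q - X j ! p)) (distinct_near X)"
    using diff L 
    by (intro tendsto_divide tendsto_diff tendsto_group_point)
      (auto intro: filterlim_compose[OF _ filterlim_del_nth])
  have "dd_distinct f Z = (dd_distinct f (Z(j := del_nth p (Z j))) - dd_distinct f (Z(j := del_nth q (Z j))))
      / (Z j ! q - Z j ! p)" if Z: "near_groups 1 X Z" for Z
  proof -
    have len: "length (Z i) = length (X i)" for i by (rule near_groups_length[OF Z])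
    have d: "distinct (Z i)" for i by (rule near_groupsD[OF Z])
    have ZX: "dd_distinct f (Z(j := del_nth r (Z j))) = set_dd f ((\<lambda>i. set (Z i))(j := set (Z j) - {Z j ! r}))"
      if r: "r < length (X j)" for r
    proof -
      have "dd_distinct f (Z(j := del_nth r (Z j))) = set_dd f (\<lambda>i. set ((Z(j := del_nth r (Z j))) i))"
      proof (rule dd_distinct_eq_set_dd)
        show "distinct ((Z(j := del_nth r (Z j))) i)" for i
          using d[of i] d[of j] r len[of j] by (auto simp: del_nth_distinct)
        show "(Z(j := del_nth r (Z j))) i \<noteq> []" for i
          using ne[of i] len[of i] two r length_del_nth[of r "Z j"] by auto
      qed
      also have "(\<lambda>i. set ((Z(j := del_nth r (Z j))) i)) = (\<lambda>i. set (Z i))(j := set (Z j) - {Z j ! r})"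
        using d[of j] r len[of j] by (auto simp: del_nth_distinct fun_eq_iff)
      finally show ?thesis .
    qed
    have "Z j ! p \<noteq> Z j ! q"
      using d[of j] diff len[of j] by (auto simp: nth_eq_iff_index_eq)
    moreover have "(Z j ! q - Z j ! p) * set_dd f (\<lambda>i. set (Z i)) =
        dd_distinct f (Z(j := del_nth p (Z j))) - dd_distinct f (Z(j := del_nth q (Z j)))"
      unfolding ZX[OF diff(1)] ZX[OF diff(2)] using diff len[of j] by (intro set_dd_rec) auto
    ultimately show ?thesis using dd_distinct_near_eq_set_dd[OF Z ne] by (simp add: field_simps)
  qed
  then have "\<forall>\<^sub>F Z in distinct_near X. dd_distinct f Z =
      (dd_distinct f (Z(j := del_nth p (Z j))) - dd_distinct f (Z(j := del_nth q (Z j)))) / (Z j ! q - Z j ! p)"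
    unfolding eventually_distinct_near by (intro exI[of _ 1]) simp
  from iffD2[OF tendsto_cong[OF this] lim] show ?thesis .
qed

text \<open>If a whole group collapses to one point, the order is lowered by a derivative instead: the points
  supplied by the mean value theorem collapse to the same point.\<close>

lemma dd_distinct_tendsto_from_derivative:
  fixes f :: "('d::finite \<Rightarrow> real) \<Rightarrow> real"
  assumes B: "\<And>j. open (B j)" and ne: "\<And>j. X j \<noteq> []" and sub: "\<And>j. set (X j) \<subseteq> B j"
    and Xj: "X j = replicate (Suc n) x" and n: "0 < n"
    and der: "\<And>u. u \<in> Pi UNIV B \<Longrightarrow> ((\<lambda>t. f (u(j := t))) has_real_derivative f' u) (at (u j))"
    and L: "(dd_distinct f' \<longlongrightarrow> L) (distinct_near (X(j := replicate n x)))"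
  shows "(dd_distinct f \<longlongrightarrow> L / n) (distinct_near X)"
proof -
  obtain e0 where e0: "e0 > 0" "\<And>j x z. x \<in> set (X j) \<Longrightarrow> dist z x < e0 \<Longrightarrow> z \<in> B j"
    using eventually_groups_in_box[where B = B and X = X] B sub by metis
  show ?thesis
    unfolding tendsto_iff
  proof (intro allI impI)
    fix r :: real assume r: "r > 0"
    have "\<forall>\<^sub>F Z in distinct_near (X(j := replicate n x)). dist (dd_distinct f' Z) L < r * n"
      using L r n by (simp add: tendsto_iff)
    then obtain e1 where e1: "e1 > 0" "\<And>Z. near_groups e1 (X(j := replicate n x)) Z \<Longrightarrow> dist (dd_distinct f' Z) L < r * n"
      unfolding eventually_distinct_near by blast
    have "dist (dd_distinct f Z) (L / n) < r" if Z: "near_groups (min e0 e1) X Z" for Z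
    proof -
      have len: "length (Z i) = length (X i)" for i by (rule near_groups_length[OF Z])
      have Zne: "Z i \<noteq> []" for i using len[of i] ne[of i] by auto
      have close: "dist z x < min e0 e1" if z: "z \<in> set (Z j)" for z
      proof -
        obtain i where "i < length (X j)" "z = Z j ! i"
          using z len[of j] by (auto simp: in_set_conv_nth)
        then show ?thesis using near_groups_nth[OF Z, of i j] by (simp add: Xj del: replicate_Suc)
      qed
      have hull: "dist z x < min e0 e1" if "z \<in> {Min (set (Z j))..Max (set (Z j))}" for z
      proof -
        have "Min (set (Z j)) \<in> set (Z j)" "Max (set (Z j)) \<in> set (Z j)"
          using Zne[of j] by (auto intro!: Min_in Max_in)
        then show ?thesis
          using close[of "Min (set (Z j))"] close[of "Max (set (Z j))"] that by (auto simp: dist_real_def)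
      qed
      have inB: "set (Z i) \<subseteq> B i" for i
      proof
        fix z assume "z \<in> set (Z i)"
        then obtain k where k: "k < length (X i)" "z = Z i ! k"
          using len[of i] by (auto simp: in_set_conv_nth)
        then show "z \<in> B i"
          using near_groups_nth[OF Z k(1)] e0(2)[of "X i ! k" i z] by simp
      qed
      have card: "card (set (Z j)) = Suc n"
        using near_groupsD(1)[OF Z, of j] len[of j] by (simp add: distinct_card Xj)
      have hullB: "{Min (set (Z j))..Max (set (Z j))} \<subseteq> B j"
        using hull e0(2)[of x j] Xj by auto
      obtain T where T: "finite T" "card T = n" "T \<subseteq> {Min (set (Z j))..Max (set (Z j))}"
        "set_dd f (\<lambda>i. set (Z i)) = set_dd f' ((\<lambda>i. set (Z i))(j := T)) / n"
        using set_dd_mean_value[where S = "\<lambda>i. set (Z i)" and j = j and n = n and B = B and f = f and f' = f']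
          der inB hullB card n Zne by (metis List.finite_set set_empty)
      define zs where "zs = sorted_list_of_set T"
      have zs: "distinct zs" "set zs = T" "length zs = n"
        using T by (auto simp: zs_def)
      have Zne': "near_groups e1 (X(j := replicate n x)) (Z(j := zs))"
      proof (rule near_groups_update)
        show "near_groups e1 X Z" using Z by (rule near_groups_mono) simp
        show "list_all2 (\<lambda>z x. dist z x < e1) zs (replicate n x)"
        proof -
          have "dist z x < e1" if "z \<in> set zs" for z
            using hull[of z] T(3) zs(2) that by auto
          then show ?thesis
            using zs(3) nth_mem[of _ zs] by (auto simp: list_all2_conv_all_nth)
        qed
      qed (rule zs)
      have "dd_distinct f' (Z(j := zs)) = set_dd f' (\<lambda>i. set ((Z(j := zs)) i))"
      proof (rule dd_distinct_eq_set_dd)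
        show "distinct ((Z(j := zs)) i)" for i by (rule near_groupsD[OF Zne'])
        show "(Z(j := zs)) i \<noteq> []" for i using Zne[of i] zs n by auto
      qed
      also have "(\<lambda>i. set ((Z(j := zs)) i)) = (\<lambda>i. set (Z i))(j := T)"
        using zs by (auto simp: fun_eq_iff)
      finally have "dd_distinct f Z = dd_distinct f' (Z(j := zs)) / n"
        by (simp only: dd_distinct_near_eq_set_dd[OF Z ne] T(4))
      moreover have "\<bar>dd_distinct f' (Z(j := zs)) - L\<bar> < r * n"
        using e1(2)[OF Zne'] by (simp add: dist_real_def)
      ultimately show ?thesis
        using n by (simp add: dist_real_def pos_divide_less_eq flip: diff_divide_distrib)
    qed
    then show "\<forall>\<^sub>F Z in distinct_near X. dist (dd_distinct f Z) (L / n) < r"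
      unfolding eventually_distinct_near using e0(1) e1(1) by (intro exI[of _ "min e0 e1"]) auto
  qed
qed

lemma dd_distinct_tendsto_singletons:
  fixes f :: "('d::finite \<Rightarrow> real) \<Rightarrow> real"
  assumes cont: "box_continuous f B" and B: "\<And>j. open (B j)" and sub: "\<And>j. set (X j) \<subseteq> B j"
    and single: "\<And>j. length (X j) = 1"
  shows "(dd_distinct f \<longlongrightarrow> f (\<lambda>j. hd (X j))) (distinct_near X)"
proof -
  obtain e0 where e0: "e0 > 0" "\<And>j x z. x \<in> set (X j) \<Longrightarrow> dist z x < e0 \<Longrightarrow> z \<in> B j"
    using eventually_groups_in_box[where B = B and X = X] B sub by metis
  have ne: "X j \<noteq> []" for j using single[of j] by auto
  have Xhd: "hd (X j) \<in> set (X j)" "hd (X j) = X j ! 0" for j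
    using ne[of j] by (auto simp: hd_conv_nth)
  show ?thesis
    unfolding tendsto_iff
  proof (intro allI impI)
    fix r :: real assume r: "r > 0"
    have "(\<lambda>j. hd (X j)) \<in> Pi UNIV B" using Xhd sub by blast
    then obtain d where d: "d > 0"
      "\<And>v. v \<in> Pi UNIV B \<Longrightarrow> (\<And>j. \<bar>v j - hd (X j)\<bar> < d) \<Longrightarrow> \<bar>f v - f (\<lambda>j. hd (X j))\<bar> < r"
      using cont r unfolding box_continuous_def by metis
    have "dist (dd_distinct f Z) (f (\<lambda>j. hd (X j))) < r" if Z: "near_groups (min d e0) X Z" for Z
    proof -
      have len: "length (Z j) = 1" for j using near_groups_length[OF Z, of j] single[of j] by simp
      have hdZ: "hd (Z j) = Z j ! 0" for j using len[of j] by (cases "Z j") auto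
      have close: "dist (hd (Z j)) (hd (X j)) < min d e0" for j
        using near_groups_nth[OF Z, of 0 j] single[of j] Xhd hdZ by simp
      have "dd_distinct f Z = f (\<lambda>j. hd (Z j))"
        using len by (subst dd_distinct.simps) simp
      moreover have "\<bar>f (\<lambda>j. hd (Z j)) - f (\<lambda>j. hd (X j))\<bar> < r"
        using close e0(2)[OF Xhd(1)] by (intro d(2)) (auto simp: dist_real_def)
      ultimately show ?thesis by (simp add: dist_real_def)
    qed
    then show "\<forall>\<^sub>F Z in distinct_near X. dist (dd_distinct f Z) (f (\<lambda>j. hd (X j))) < r"
      unfolding eventually_distinct_near using e0(1) d(1) by (intro exI[of _ "min d e0"]) auto
  qed
qed

text \<open>Confluent divided differences exist for functions of sufficient smoothness. The induction is on the
  order: as long as some group has more than one point, one of the two reductions applies.\<close>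

theorem dd_distinct_convergent:
  fixes f :: "('d::finite \<Rightarrow> real) \<Rightarrow> real"
  assumes "partials_continuous N f B" "\<And>j. open (B j)" "\<And>j. X j \<noteq> []" "\<And>j. set (X j) \<subseteq> B j"
    "(\<Sum>j\<in>UNIV. length (X j) - 1) \<le> N"
  shows "\<exists>L. (dd_distinct f \<longlongrightarrow> L) (distinct_near X)"
  using assms
proof (induction N arbitrary: f X rule: less_induct)
  case (less N)
  note B = less.prems(2) and ne = less.prems(3) and sub = less.prems(4) and ord = less.prems(5)
  have order_update: "(\<Sum>i\<in>UNIV. length ((X(j := xs)) i) - 1) < (\<Sum>i\<in>UNIV. length (X i) - 1)"
    if "length xs < length (X j)" "1 < length (X j)" for j xs
    by (rule sum_strict_mono_ex1) (use that in auto)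
  consider (diff) j p q where "p < length (X j)" "q < length (X j)" "X j ! p \<noteq> X j ! q"
    | (const) j where "1 < length (X j)" "\<And>p q. p < length (X j) \<Longrightarrow> q < length (X j) \<Longrightarrow> X j ! p = X j ! q"
    | (single) "\<And>j. length (X j) = 1"
  proof -
    have "length (X j) = 1 \<or> 1 < length (X j)" for j
      using ne[of j] by (cases "X j") auto
    then show ?thesis using that by metis
  qed
  then show ?case
  proof cases
    case diff
    define Xp where "Xp = (\<lambda>p. X(j := del_nth p (X j)))"
    have two: "1 < length (X j)"
    proof (rule ccontr)
      assume "\<not> 1 < length (X j)"
      then have "p = q" using diff by auto
      then show False using diff by simp
    qed
    have ex: "\<exists>L. (dd_distinct f \<longlongrightarrow> L) (distinct_near (Xp p))" if p: "p < length (X j)" for p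
    proof -
      have lt: "(\<Sum>i\<in>UNIV. length (Xp p i) - 1) < (\<Sum>i\<in>UNIV. length (X i) - 1)"
        unfolding Xp_def using two p by (intro order_update) (auto simp: length_del_nth)
      then have N: "N - 1 < N" "(\<Sum>i\<in>UNIV. length (Xp p i) - 1) \<le> N - 1"
        using ord by linarith+
      show ?thesis
      proof (rule less.IH[OF N(1) _ B _ _ N(2)])
        show "partials_continuous (N - 1) f B"
          using less.prems(1) by (rule partials_continuous_mono) simp
        show "Xp p i \<noteq> []" for i
          using ne[of i] two p length_del_nth[of p "X j"] by (auto simp: Xp_def)
        show "set (Xp p i) \<subseteq> B i" for i
          using sub[of i] set_del_nth_subset[of p "X j"] by (auto simp: Xp_def)
      qed
    qed
    obtain Lp Lq where L: "(dd_distinct f \<longlongrightarrow> Lp) (distinct_near (Xp p))" "(dd_distinct f \<longlongrightarrow> Lq) (distinct_near (Xp q))"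
      using ex diff by metis
    from dd_distinct_tendsto_from_deletions[OF ne diff L[unfolded Xp_def]] show ?thesis ..
  next
    case const
    define n x where "n = length (X j) - 1" and "x = X j ! 0"
    have Xj: "X j = replicate (Suc n) x"
    proof (rule nth_equalityI)
      show "length (X j) = length (replicate (Suc n) x)" using const(1) by (simp add: n_def)
      fix i assume i: "i < length (X j)"
      then have "X j ! i = x" unfolding x_def using const(1) by (intro const(2)) linarith+
      moreover have "replicate (Suc n) x ! i = x"
        using i const(1) by (intro nth_replicate) (simp add: n_def)
      ultimately show "X j ! i = replicate (Suc n) x ! i" by simp
    qed
    have n: "0 < n" using const(1) by (simp add: n_def)
    have lt: "(\<Sum>i\<in>UNIV. length ((X(j := replicate n x)) i) - 1) < (\<Sum>i\<in>UNIV. length (X i) - 1)"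
      using const(1) by (intro order_update) (auto simp: Xj)
    then obtain M where M: "N = Suc M" using ord by (cases N) auto
    obtain f' where f': "\<And>u. u \<in> Pi UNIV B \<Longrightarrow> ((\<lambda>t. f (u(j := t))) has_real_derivative f' u) (at (u j))"
      "partials_continuous M f' B"
      using less.prems(1) unfolding M partials_continuous.simps by metis
    have "\<exists>L. (dd_distinct f' \<longlongrightarrow> L) (distinct_near (X(j := replicate n x)))"
    proof (rule less.IH[OF _ f'(2) B])
      show "(\<Sum>i\<in>UNIV. length ((X(j := replicate n x)) i) - 1) \<le> M" using lt ord M by linarith
      show "(X(j := replicate n x)) i \<noteq> []" for i using ne[of i] n by auto
      show "set ((X(j := replicate n x)) i) \<subseteq> B i" for i using sub[of i] sub[of j] Xj by auto
    qed (simp add: M)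
    then obtain L where L: "(dd_distinct f' \<longlongrightarrow> L) (distinct_near (X(j := replicate n x)))" by blast
    from dd_distinct_tendsto_from_derivative[OF B ne sub Xj n f'(1) L] show ?thesis ..
  next
    case single
    from dd_distinct_tendsto_singletons[OF partials_continuous_imp_continuous[OF less.prems(1)] B sub single]
    show ?thesis ..
  qed
qed

corollary dd_distinct_tendsto_divdiff:
  fixes f :: "('d::finite \<Rightarrow> real) \<Rightarrow> real"
  assumes "partials_continuous N f B" "\<And>j. open (B j)" "\<And>j. X j \<noteq> []" "\<And>j. set (X j) \<subseteq> B j"
    "(\<Sum>j\<in>UNIV. length (X j) - 1) \<le> N" and nontriv: "distinct_near X \<noteq> bot"
  shows "(dd_distinct f \<longlongrightarrow> divdiff f X) (distinct_near X)"
proof -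
  obtain L where L: "(dd_distinct f \<longlongrightarrow> L) (distinct_near X)"
    using dd_distinct_convergent[OF assms(1-5)] by blast
  have "divdiff f X = L"
  proof (cases "\<forall>j. distinct (X j)")
    case True
    have "dist (dd_distinct f X) L < e" if e: "e > 0" for e
    proof -
      obtain d where "d > 0" "\<And>Z. near_groups d X Z \<Longrightarrow> dist (dd_distinct f Z) L < e"
        using L e unfolding tendsto_iff eventually_distinct_near by blast
      then show ?thesis using True by (simp add: list_all2_refl near_groups_def)
    qed
    then have "dd_distinct f X = L"
      using zero_less_dist_iff[of "dd_distinct f X" L] by blast
    then show ?thesis using True by (simp add: divdiff_def)
  next
    case False
    then show ?thesis using tendsto_Lim[OF nontriv L] by (auto simp: divdiff_def)
  qed
  then show ?thesis using L by simp
qed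

section \<open>The Leibniz rule and the chain rule on a grid\<close>

text \<open>The extension by \<open>0\<close> outside of \<open>{a..b}\<close> allows all sums over subintervals to run over a common interval.\<close>

definition idx_weight :: "(nat \<Rightarrow> real) \<Rightarrow> nat \<Rightarrow> nat \<Rightarrow> nat \<Rightarrow> real" where
  "idx_weight \<xi> a b i = (if a \<le> i \<and> i \<le> b then dd_weight (\<xi> ` {a..b}) (\<xi> i) else 0)"

text \<open>The divided difference of a sequence \<open>h\<close> of values attached to the nodes \<open>\<xi> a, \<dots>, \<xi> b\<close>.\<close>

definition idx_dd :: "(nat \<Rightarrow> real) \<Rightarrow> (nat \<Rightarrow> real) \<Rightarrow> nat \<Rightarrow> nat \<Rightarrow> real" where
  "idx_dd \<xi> h a b = (\<Sum>i\<in>{a..b}. h i * idx_weight \<xi> a b i)"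

lemma idx_weight_self [simp]: "idx_weight \<xi> a a a = 1"
  by (simp add: idx_weight_def)

lemma idx_dd_eq_dd1:
  assumes "inj_on \<xi> {a..b}" "\<And>i. i \<in> {a..b} \<Longrightarrow> h i = f (\<xi> i)"
  shows "idx_dd \<xi> h a b = dd1 f (\<xi> ` {a..b})"
  unfolding idx_dd_def dd1_def using assms by (simp add: sum.reindex idx_weight_def)

lemma idx_dd_rec:
  assumes inj: "inj_on \<xi> {a..b}" and ab: "a < b"
  shows "(\<xi> b - \<xi> a) * idx_dd \<xi> h a b = idx_dd \<xi> h (Suc a) b - idx_dd \<xi> h a (b - 1)"
proof -
  \<comment> \<open>\<open>dd1\<close> takes the values as a function of the nodes.\<close>
  define f where "f = h \<circ> the_inv_into {a..b} \<xi>"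
  have f: "h i = f (\<xi> i)" if "i \<in> {a..b}" for i
    using that inj by (simp add: f_def the_inv_into_f_f)
  have sub: "idx_dd \<xi> h c d = dd1 f (\<xi> ` {c..d})" if "{c..d} \<subseteq> {a..b}" for c d
    using that f by (intro idx_dd_eq_dd1 inj_on_subset[OF inj]) auto
  have "{Suc a..b} = {a..b} - {a}" "{a..b - 1} = {a..b} - {b}"
    using ab by auto
  then have "\<xi> ` {Suc a..b} = \<xi> ` {a..b} - {\<xi> a}" "\<xi> ` {a..b - 1} = \<xi> ` {a..b} - {\<xi> b}"
    using inj ab by (simp_all add: inj_on_image_set_diff[OF inj])
  then show ?thesis
    using sub[of a b] sub[of "Suc a" b] sub[of a "b - 1"] ab by (simp add: dd1_rec)
qed

text \<open>By induction on the length of the interval. In the difference of the two shorter Leibniz sums, each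
  term is rewritten by the recursion; the shifted terms cancel, and the others add up to
  \<open>\<xi> m - \<xi> a + (\<xi> b - \<xi> m) = \<xi> b - \<xi> a\<close> times the claim.\<close>

lemma idx_dd_Leibniz:
  assumes "inj_on \<xi> {a..b}" "a \<le> b"
  shows "idx_dd \<xi> (\<lambda>i. f i * g i) a b = (\<Sum>m\<in>{a..b}. idx_dd \<xi> f a m * idx_dd \<xi> g m b)"
  using assms
proof (induction "b - a" arbitrary: a b rule: less_induct)
  case less
  show ?case
  proof (cases "a = b")
    case True
    then show ?thesis by (simp add: idx_dd_def)
  next
    case False
    then have ab: "a < b" using less.prems by simp
    note inj = less.prems(1)
    let ?F = "idx_dd \<xi> f" and ?G = "idx_dd \<xi> g"
    have "(\<xi> b - \<xi> a) * idx_dd \<xi> (\<lambda>i. f i * g i) a b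
        = idx_dd \<xi> (\<lambda>i. f i * g i) (Suc a) b - idx_dd \<xi> (\<lambda>i. f i * g i) a (b - 1)"
      by (rule idx_dd_rec[OF inj ab])
    also have "idx_dd \<xi> (\<lambda>i. f i * g i) (Suc a) b = (\<Sum>m\<in>{Suc a..b}. ?F (Suc a) m * ?G m b)"
      using ab by (intro less.hyps inj_on_subset[OF inj]) auto
    also have "\<dots> = (\<Sum>m\<in>{Suc a..b}. ((\<xi> m - \<xi> a) * ?F a m + ?F a (m - 1)) * ?G m b)"
    proof (intro sum.cong refl)
      fix m assume m: "m \<in> {Suc a..b}"
      have "(\<xi> m - \<xi> a) * ?F a m = ?F (Suc a) m - ?F a (m - 1)"
        using m by (intro idx_dd_rec inj_on_subset[OF inj]) auto
      then show "?F (Suc a) m * ?G m b = ((\<xi> m - \<xi> a) * ?F a m + ?F a (m - 1)) * ?G m b" by simp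
    qed
    also have "\<dots> = (\<Sum>m\<in>{a..b}. (\<xi> m - \<xi> a) * ?F a m * ?G m b) + (\<Sum>m\<in>{Suc a..b}. ?F a (m - 1) * ?G m b)"
      using ab by (simp add: sum.atLeast_Suc_atMost[of a b] distrib_right sum.distrib)
    also have "idx_dd \<xi> (\<lambda>i. f i * g i) a (b - 1) = (\<Sum>m\<in>{a..b - 1}. ?F a m * ?G m (b - 1))"
      using ab by (intro less.hyps inj_on_subset[OF inj]) auto
    also have "\<dots> = (\<Sum>m\<in>{a..b - 1}. ?F a m * (?G (Suc m) b - (\<xi> b - \<xi> m) * ?G m b))"
    proof (intro sum.cong refl)
      fix m assume m: "m \<in> {a..b - 1}"
      have "(\<xi> b - \<xi> m) * ?G m b = ?G (Suc m) b - ?G m (b - 1)"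
        using m ab by (intro idx_dd_rec inj_on_subset[OF inj]) auto
      then show "?F a m * ?G m (b - 1) = ?F a m * (?G (Suc m) b - (\<xi> b - \<xi> m) * ?G m b)" by simp
    qed
    also have "\<dots> = (\<Sum>m\<in>{a..b - 1}. ?F a m * ?G (Suc m) b) - (\<Sum>m\<in>{a..b}. (\<xi> b - \<xi> m) * ?F a m * ?G m b)"
    proof -
      have "{a..b} = insert b {a..b - 1}" using ab by auto
      then have "(\<Sum>m\<in>{a..b}. (\<xi> b - \<xi> m) * ?F a m * ?G m b) = (\<Sum>m\<in>{a..b - 1}. (\<xi> b - \<xi> m) * ?F a m * ?G m b)"
        using ab by simp
      then show ?thesis by (simp add: right_diff_distrib sum_subtractf mult_ac)
    qed
    also have "(\<Sum>m\<in>{a..b - 1}. ?F a m * ?G (Suc m) b) = (\<Sum>m\<in>{Suc a..b}. ?F a (m - 1) * ?G m b)"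
      using ab by (intro sum.reindex_bij_witness[of _ "\<lambda>m. m - 1" Suc]) auto
    finally have "(\<xi> b - \<xi> a) * idx_dd \<xi> (\<lambda>i. f i * g i) a b = (\<xi> b - \<xi> a) * (\<Sum>m\<in>{a..b}. ?F a m * ?G m b)"
      by (simp add: sum_distrib_left algebra_simps flip: sum.distrib)
    moreover have "\<xi> b - \<xi> a \<noteq> 0"
      using inj_onD[OF inj, of a b] ab by auto
    ultimately show ?thesis by simp
  qed
qed

lemma idx_dd_const:
  assumes "inj_on \<xi> {a..b}" "a \<le> b"
  shows "idx_dd \<xi> (\<lambda>_. c) a b = (if a = b then c else 0)"
proof -
  have "idx_dd \<xi> (\<lambda>_. c) a b = dd1 (\<lambda>_. c) (\<xi> ` {a..b})"
    using assms by (intro idx_dd_eq_dd1) auto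
  also have "\<dots> = (if card (\<xi> ` {a..b}) = 1 then c else 0)"
    using assms by (intro dd1_const) auto
  also have "card (\<xi> ` {a..b}) = Suc b - a"
    using assms by (simp add: card_image)
  finally show ?thesis using assms by auto
qed

text \<open>The Leibniz rule for two indicator functions: an identity between weights, which can be multiplied
  over the coordinates.\<close>

lemma sum_idx_weight_mult:
  assumes "inj_on \<xi> {a..b}" "a \<le> b" "i \<in> {a..b}" "l \<in> {a..b}"
  shows "(\<Sum>m\<in>{a..b}. idx_weight \<xi> a m i * idx_weight \<xi> m b l) = (if i = l then idx_weight \<xi> a b i else 0)"
proof -
  define \<delta> :: "nat \<Rightarrow> nat \<Rightarrow> real" where "\<delta> = (\<lambda>i k. if k = i then 1 else 0)"
  have \<delta>: "idx_dd \<xi> (\<delta> i) c d = idx_weight \<xi> c d i" for i c d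
    unfolding idx_dd_def \<delta>_def by (simp add: if_distrib[of "\<lambda>x. x * _"] sum.delta idx_weight_def cong: if_cong)
  have "(\<Sum>m\<in>{a..b}. idx_weight \<xi> a m i * idx_weight \<xi> m b l) = idx_dd \<xi> (\<lambda>k. \<delta> i k * \<delta> l k) a b"
    using idx_dd_Leibniz[OF assms(1,2), of "\<delta> i" "\<delta> l"] by (simp add: \<delta>)
  also have "(\<lambda>k. \<delta> i k * \<delta> l k) = (if i = l then \<delta> i else (\<lambda>_. 0))"
    by (auto simp: \<delta>_def fun_eq_iff)
  also have "idx_dd \<xi> (if i = l then \<delta> i else (\<lambda>_. 0)) a b = (if i = l then idx_weight \<xi> a b i else 0)"
  proof (cases "i = l")
    case False
    then show ?thesis by (simp add: idx_dd_def)
  qed (simp add: \<delta>)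
  finally show ?thesis .
qed

lemma sum_prod_box:
  fixes a b :: "nat ^ 'q::finite" and F :: "'q \<Rightarrow> nat \<Rightarrow> real"
  shows "(\<Sum>m\<in>{a..b}. \<Prod>r\<in>UNIV. F r (m $ r)) = (\<Prod>r\<in>UNIV. \<Sum>i\<in>{a $ r..b $ r}. F r i)"
proof -
  have "(\<Prod>r\<in>UNIV. \<Sum>i\<in>{a $ r..b $ r}. F r i) = (\<Sum>m\<in>PiE UNIV (\<lambda>r. {a $ r..b $ r}). \<Prod>r\<in>UNIV. F r (m r))"
    by (intro prod_sum_PiE) auto
  also have "\<dots> = (\<Sum>m\<in>{a..b}. \<Prod>r\<in>UNIV. F r (m $ r))"
    by (rule sum.reindex_bij_witness[of _ vec_nth vec_lambda])
      (auto simp: less_eq_vec_def PiE_iff)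
  finally show ?thesis by simp
qed

text \<open>The divided difference over the subgrid from \<open>a\<close> to \<open>b\<close>. The values belong to the indices and not
  to the points, so that they can be perturbed freely.\<close>

definition grid_dd :: "('q::finite \<Rightarrow> nat \<Rightarrow> real) \<Rightarrow> (nat ^ 'q \<Rightarrow> real) \<Rightarrow> nat ^ 'q \<Rightarrow> nat ^ 'q \<Rightarrow> real" where
  "grid_dd x h a b = (\<Sum>c\<in>{a..b}. h c * (\<Prod>r\<in>UNIV. idx_weight (x r) (a $ r) (b $ r) (c $ r)))"

lemma grid_dd_self [simp]: "grid_dd x h a a = h a"
  by (simp add: grid_dd_def)

lemma grid_dd_sum: "grid_dd x (\<lambda>c. \<Sum>z\<in>Z. h z c) a b = (\<Sum>z\<in>Z. grid_dd x (h z) a b)"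
  unfolding grid_dd_def sum_distrib_right by (rule sum.swap)

lemma grid_dd_add: "grid_dd x (\<lambda>c. h c + k c) a b = grid_dd x h a b + grid_dd x k a b"
  unfolding grid_dd_def by (simp add: distrib_right sum.distrib)

lemma grid_dd_cong: "(\<And>c. a \<le> c \<Longrightarrow> c \<le> b \<Longrightarrow> h c = k c) \<Longrightarrow> grid_dd x h a b = grid_dd x k a b"
  unfolding grid_dd_def by (intro sum.cong) auto

lemma grid_dd_const:
  assumes inj: "\<And>r. inj_on (x r) {a $ r..b $ r}" and ab: "a \<le> b"
  shows "grid_dd x (\<lambda>_. k) a b = (if a = b then k else 0)"
proof -
  have "grid_dd x (\<lambda>_. k) a b = k * (\<Prod>r\<in>UNIV. idx_dd (x r) (\<lambda>_. 1) (a $ r) (b $ r))"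
    using sum_prod_box[of "\<lambda>r. idx_weight (x r) (a $ r) (b $ r)" a b]
    by (simp add: grid_dd_def idx_dd_def flip: sum_distrib_left)
  also have "(\<Prod>r\<in>UNIV. idx_dd (x r) (\<lambda>_. 1) (a $ r) (b $ r)) = (\<Prod>r\<in>UNIV. if a $ r = b $ r then 1 else 0)"
    using inj ab by (intro prod.cong refl idx_dd_const) (auto simp: less_eq_vec_def)
  also have "\<dots> = (if a = b then 1 else 0)"
    by (auto simp: vec_eq_iff)
  finally show ?thesis by simp
qed

text \<open>In other words, \<open>h \<mapsto> grid_dd x h\<close> is an algebra homomorphism into the incidence algebra of the
  componentwise order.\<close>

theorem grid_dd_Leibniz:
  assumes inj: "\<And>r. inj_on (x r) {a $ r..b $ r}" and ab: "a \<le> b"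
  shows "grid_dd x (\<lambda>c. h c * k c) a b = (\<Sum>m\<in>{a..b}. grid_dd x h a m * grid_dd x k m b)"
proof -
  let ?w = "\<lambda>a b c. \<Prod>r\<in>UNIV. idx_weight (x r) (a $ r) (b $ r) (c $ r)"
  have zero: "?w c d e = 0" if "\<not> (c \<le> e \<and> e \<le> d)" for c d e
    using that by (auto simp: less_eq_vec_def idx_weight_def intro!: prod_zero)
  have fin: "finite {a..b}" by (rule finite_multi_index_interval)
  have ext: "grid_dd x h' c d = (\<Sum>e\<in>{a..b}. h' e * ?w c d e)" if "a \<le> c" "d \<le> b" for h' c d
    unfolding grid_dd_def using that fin zero
    by (intro sum.mono_neutral_left) (auto intro: order_trans)
  \<comment> \<open>The one-dimensional identity of the weights, multiplied over the coordinates.\<close>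
  have orth: "(\<Sum>m\<in>{a..b}. ?w a m c * ?w m b d) = (if c = d then ?w a b c else 0)"
    if cd: "c \<in> {a..b}" "d \<in> {a..b}" for c d
  proof -
    have "(\<Sum>m\<in>{a..b}. ?w a m c * ?w m b d)
        = (\<Prod>r\<in>UNIV. \<Sum>i\<in>{a $ r..b $ r}. idx_weight (x r) (a $ r) i (c $ r) * idx_weight (x r) i (b $ r) (d $ r))"
      unfolding prod.distrib[symmetric]
      by (rule sum_prod_box[of "\<lambda>r i. idx_weight (x r) (a $ r) i (c $ r) * idx_weight (x r) i (b $ r) (d $ r)"])
    also have "\<dots> = (\<Prod>r\<in>UNIV. if c $ r = d $ r then idx_weight (x r) (a $ r) (b $ r) (c $ r) else 0)"
      using cd ab by (intro prod.cong refl sum_idx_weight_mult inj) (auto simp: less_eq_vec_def)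
    also have "\<dots> = (if c = d then ?w a b c else 0)"
    proof (cases "c = d")
      case False
      then obtain r where "c $ r \<noteq> d $ r" by (auto simp: vec_eq_iff)
      then show ?thesis using False by (auto intro!: prod_zero)
    qed simp
    finally show ?thesis .
  qed
  have "(\<Sum>m\<in>{a..b}. grid_dd x h a m * grid_dd x k m b)
      = (\<Sum>m\<in>{a..b}. \<Sum>c\<in>{a..b}. \<Sum>d\<in>{a..b}. h c * k d * (?w a m c * ?w m b d))"
    by (intro sum.cong refl) (simp add: ext sum_product mult_ac)
  also have "\<dots> = (\<Sum>c\<in>{a..b}. \<Sum>d\<in>{a..b}. \<Sum>m\<in>{a..b}. h c * k d * (?w a m c * ?w m b d))"
    by (subst sum.swap, intro sum.cong refl sum.swap)
  also have "\<dots> = (\<Sum>c\<in>{a..b}. \<Sum>d\<in>{a..b}. h c * k d * (if c = d then ?w a b c else 0))"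
    unfolding sum_distrib_left[symmetric] by (intro sum.cong refl) (simp add: orth)
  also have "\<dots> = (\<Sum>c\<in>{a..b}. h c * k c * ?w a b c)"
    using fin by (intro sum.cong refl) (simp add: if_distrib[of "\<lambda>x. _ * x"] sum.delta cong: if_cong)
  also have "\<dots> = grid_dd x (\<lambda>c. h c * k c) a b"
    by (simp add: grid_dd_def)
  finally show ?thesis by simp
qed

lemma set_dd_grid:
  assumes inj: "\<And>r. inj_on (x r) {a $ r..b $ r}"
  shows "set_dd f (\<lambda>r. x r ` {a $ r..b $ r}) = grid_dd x (\<lambda>c. f (\<lambda>r. x r (c $ r))) a b"
  unfolding set_dd_def grid_dd_def
proof (rule sum.reindex_bij_witness[where
    i = "\<lambda>c r. x r (c $ r)" and j = "\<lambda>u. \<chi> r. the_inv_into {a $ r..b $ r} (x r) (u r)"])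
  fix u assume u: "u \<in> PiE UNIV (\<lambda>r. x r ` {a $ r..b $ r})"
  let ?c = "\<chi> r. the_inv_into {a $ r..b $ r} (x r) (u r)"
  have ur: "u r \<in> x r ` {a $ r..b $ r}" for r by (rule PiE_mem[OF u UNIV_I])
  have inv: "x r (?c $ r) = u r" for r
    using f_the_inv_into_f[OF inj ur] by simp
  have mem: "?c $ r \<in> {a $ r..b $ r}" for r
    using the_inv_into_into[OF inj ur subset_refl] by simp
  show "(\<lambda>r. x r (?c $ r)) = u" using inv by auto
  show "?c \<in> {a..b}" using mem by (auto simp: less_eq_vec_def)
  show "f (\<lambda>r. x r (?c $ r)) * (\<Prod>r\<in>UNIV. idx_weight (x r) (a $ r) (b $ r) (?c $ r))
      = f u * (\<Prod>j\<in>UNIV. dd_weight (x j ` {a $ j..b $ j}) (u j))"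
  proof -
    have "idx_weight (x r) (a $ r) (b $ r) (?c $ r) = dd_weight (x r ` {a $ r..b $ r}) (u r)" for r
      using mem[of r] inv[of r] by (simp add: idx_weight_def)
    then show ?thesis using inv by (simp only:)
  qed
next
  fix c assume c: "c \<in> {a..b}"
  then have mem: "c $ r \<in> {a $ r..b $ r}" for r by (auto simp: less_eq_vec_def)
  show "(\<chi> r. the_inv_into {a $ r..b $ r} (x r) (x r (c $ r))) = c"
    using the_inv_into_f_f[OF inj mem] by (simp add: vec_eq_iff)
  show "(\<lambda>r. x r (c $ r)) \<in> PiE UNIV (\<lambda>r. x r ` {a $ r..b $ r})"
    using mem by auto
qed

lemma set_dd_option:
  fixes f :: "('q::finite option \<Rightarrow> real) \<Rightarrow> real"
  assumes "finite Y" "\<And>r. finite (S r)"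
  shows "set_dd f (case_option Y S) = dd1 (\<lambda>z. set_dd (\<lambda>u. f (case_option z u)) S) Y"
proof -
  have fin: "finite (case_option Y S i)" for i using assms by (cases i) auto
  have "set_dd f ((case_option Y S)(None := {z})) = set_dd (\<lambda>u. f (case_option z u)) S" for z
    unfolding set_dd_def
  proof (rule sum.reindex_bij_witness[where i = "\<lambda>u. case_option z u" and j = "\<lambda>u r. u (Some r)"])
    fix u assume u: "u \<in> PiE UNIV ((case_option Y S)(None := {z}))"
    have un: "u None = z" using PiE_mem[OF u UNIV_I, of None] by simp
    have us: "u (Some r) \<in> S r" for r using PiE_mem[OF u UNIV_I, of "Some r"] by simp
    show eq: "case_option z (\<lambda>r. u (Some r)) = u"
      using un by (auto simp: fun_eq_iff split: option.splits)
    show "(\<lambda>r. u (Some r)) \<in> PiE UNIV S" using us by auto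
    show "f (case_option z (\<lambda>r. u (Some r))) * (\<Prod>j\<in>UNIV. dd_weight (S j) (u (Some j)))
        = f u * (\<Prod>j\<in>UNIV. dd_weight (((case_option Y S)(None := {z})) j) (u j))"
      unfolding eq using un by (simp add: UNIV_option_conv prod.reindex)
  next
    fix u assume "u \<in> PiE UNIV S"
    then show "case_option z u \<in> PiE UNIV ((case_option Y S)(None := {z}))"
      by (auto simp: PiE_iff split: option.splits)
  qed auto
  then show ?thesis
    by (subst set_dd_expand[where j = None, OF fin]) simp
qed

text \<open>The functional calculus of a triangular matrix, applied to \<open>grid_dd x yd\<close>, whose diagonal entries are
  the values of \<open>yd\<close>. A product with the identity corresponds to the Leibniz rule on both sides: on the
  left for grids, on the right for the points \<open>yd ` set v\<close> of a chain, where removing the first point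
  corresponds to removing the first step.\<close>

lemma grid_dd_compose_poly:
  assumes inj: "\<And>r. inj_on (x r) {a $ r..b $ r}" and injy: "inj_on yd {a..b}"
    and ac: "a \<le> c" "c \<le> b"
  shows "grid_dd x (\<lambda>d. poly P (yd d)) c b
    = (\<Sum>v\<in>chains_between c b. dd1 (poly P) (yd ` set v) * step_prod (grid_dd x yd) v)"
  (is "_ = (\<Sum>v\<in>_. _ * ?sp v)")
  using ac
proof (induction P arbitrary: c rule: pCons_induct)
  case (0 c)
  then show ?case by (simp add: grid_dd_def dd1_def)
next
  case (pCons k P c)
  have injc: "inj_on (x r) {c $ r..b $ r}" for r
    using pCons.prems by (intro inj_on_subset[OF inj]) (auto simp: less_eq_vec_def intro: order_trans)
  have card: "card (yd ` set v) = length v" if v: "v \<in> chains_between c b" for v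
  proof -
    have "set v \<subseteq> {a..b}"
      using chains_between_bounds[OF v] order_trans[OF pCons.prems(1)] by auto
    then show ?thesis
      using card_image[OF inj_on_subset[OF injy]] distinct_card[OF chains_between_distinct[OF v]] by simp
  qed
  \<comment> \<open>A constant has nonzero divided differences at single points only.\<close>
  have const: "grid_dd x (\<lambda>_. k) c b = (\<Sum>v\<in>chains_between c b. dd1 (\<lambda>_. k) (yd ` set v) * ?sp v)"
  proof -
    have dd1: "dd1 (\<lambda>_. k) (yd ` set v) = (if length v = 1 then k else 0)" if v: "v \<in> chains_between c b" for v
    proof -
      have "v \<noteq> []" using v by (simp add: chains_between_def)
      then show ?thesis using card[OF v] by (subst dd1_const) auto
    qed
    have len1: "v = [c] \<and> b = c" if "v \<in> chains_between c b" "length v = 1" for v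
      using that by (auto simp: chains_between_def length_Suc_conv)
    show ?thesis
    proof (cases "c = b")
      case True
      then show ?thesis
        using dd1[of "[b]"] by (simp add: chains_between_self)
    next
      case False
      have "(\<Sum>v\<in>chains_between c b. dd1 (\<lambda>_. k) (yd ` set v) * ?sp v) = 0"
        using dd1 len1 False by (intro sum.neutral) force
      then show ?thesis
        using False grid_dd_const[OF injc pCons.prems(2)] by simp
    qed
  qed
  have mult: "grid_dd x (\<lambda>d. yd d * poly P (yd d)) c b
    = (\<Sum>v\<in>chains_between c b. dd1 (\<lambda>z. z * poly P z) (yd ` set v) * ?sp v)"
  proof (cases "c = b")
    case True
    then show ?thesis by (simp add: chains_between_self dd1_def)
  next
    case False
    then have cb: "c < b" using pCons.prems by simp
    have finc: "finite {c..b}" by (rule finite_multi_index_interval)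
    have split: "{c..b} = insert c {c<..b}" using cb by (auto simp: le_less)
    have tail: "dd1 (\<lambda>z. z * poly P z) (yd ` set (c # v)) = yd c * dd1 (poly P) (yd ` set (c # v)) + dd1 (poly P) (yd ` set v)"
      if d: "d \<in> {c<..b}" and v: "v \<in> chains_between d b" for d v
    proof -
      have "yd ` set (c # v) - {yd c} = yd ` set v"
      proof -
        have "e \<in> {a..b} \<and> c < e" if "e \<in> set v" for e
          using chains_between_bounds[OF v that] d pCons.prems by (auto intro: order_trans less_le_trans less_imp_le)
        then have "yd c \<notin> yd ` set v"
          using inj_onD[OF injy, of c] pCons.prems by fastforce
        then show ?thesis by auto
      qed
      then show ?thesis
        using dd1_mult_id[of "yd ` set (c # v)" "yd c" "poly P"] by simp
    qed
    have "grid_dd x (\<lambda>d. yd d * poly P (yd d)) c b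
        = (\<Sum>d\<in>{c..b}. grid_dd x yd c d * grid_dd x (\<lambda>d. poly P (yd d)) d b)"
      by (rule grid_dd_Leibniz[OF injc pCons.prems(2)])
    also have "\<dots> = yd c * grid_dd x (\<lambda>d. poly P (yd d)) c b
        + (\<Sum>d\<in>{c<..b}. grid_dd x yd c d * grid_dd x (\<lambda>d. poly P (yd d)) d b)"
      using finc unfolding split by simp
    also have "grid_dd x (\<lambda>d. poly P (yd d)) c b
        = (\<Sum>d\<in>{c<..b}. \<Sum>v\<in>chains_between d b. dd1 (poly P) (yd ` set (c # v)) * ?sp (c # v))"
      unfolding pCons.IH[OF pCons.prems] sum_chains_between[OF cb finc] ..
    also have "(\<Sum>d\<in>{c<..b}. grid_dd x yd c d * grid_dd x (\<lambda>d. poly P (yd d)) d b)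
        = (\<Sum>d\<in>{c<..b}. \<Sum>v\<in>chains_between d b. dd1 (poly P) (yd ` set v) * ?sp (c # v))"
    proof (intro sum.cong refl)
      fix d assume d: "d \<in> {c<..b}"
      then have "grid_dd x (\<lambda>d. poly P (yd d)) d b
          = (\<Sum>v\<in>chains_between d b. dd1 (poly P) (yd ` set v) * ?sp v)"
        using pCons.prems by (intro pCons.IH) (auto intro: order_trans less_imp_le)
      then show "grid_dd x yd c d * grid_dd x (\<lambda>d. poly P (yd d)) d b
          = (\<Sum>v\<in>chains_between d b. dd1 (poly P) (yd ` set v) * ?sp (c # v))"
        by (simp only: sum_distrib_left)
          (intro sum.cong refl, auto simp: chains_between_def step_prod_Cons)
    qed
    also have "yd c * (\<Sum>d\<in>{c<..b}. \<Sum>v\<in>chains_between d b. dd1 (poly P) (yd ` set (c # v)) * ?sp (c # v))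
        + (\<Sum>d\<in>{c<..b}. \<Sum>v\<in>chains_between d b. dd1 (poly P) (yd ` set v) * ?sp (c # v))
      = (\<Sum>d\<in>{c<..b}. \<Sum>v\<in>chains_between d b. dd1 (\<lambda>z. z * poly P z) (yd ` set (c # v)) * ?sp (c # v))"
      unfolding sum_distrib_left sum.distrib[symmetric]
      by (intro sum.cong refl) (simp only: tail distrib_right mult.assoc)
    also have "\<dots> = (\<Sum>v\<in>chains_between c b. dd1 (\<lambda>z. z * poly P z) (yd ` set v) * ?sp v)"
      unfolding sum_chains_between[OF cb finc] ..
    finally show ?thesis .
  qed
  have "dd1 (poly (pCons k P)) S = dd1 (\<lambda>_. k) S + dd1 (\<lambda>z. z * poly P z) S" for S
    by (simp add: dd1_def distrib_right sum.distrib)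
  moreover have "grid_dd x (\<lambda>d. poly (pCons k P) (yd d)) c b
      = grid_dd x (\<lambda>_. k) c b + grid_dd x (\<lambda>d. yd d * poly P (yd d)) c b"
    by (simp flip: grid_dd_add)
  ultimately show ?case
    by (simp only: const mult distrib_right sum.distrib)
qed

text \<open>On finitely many distinct values, every function is a polynomial.\<close>

lemma grid_dd_compose:
  assumes inj: "\<And>r. inj_on (x r) {a $ r..b $ r}" and injy: "inj_on yd {a..b}"
    and ac: "a \<le> c" "c \<le> b"
  shows "grid_dd x (\<lambda>d. f (yd d)) c b
    = (\<Sum>v\<in>chains_between c b. dd1 f (yd ` set v) * step_prod (grid_dd x yd) v)"
proof -
  have "finite (yd ` {a..b})" "yd ` {a..b} \<noteq> {}"
    using ac finite_multi_index_interval by auto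
  then obtain P where P: "\<And>z. z \<in> yd ` {a..b} \<Longrightarrow> poly P z = f z"
    using interpolation_poly[of "yd ` {a..b}" f] by metis
  have Pd: "poly P (yd d) = f (yd d)" if "c \<le> d" "d \<le> b" for d
    using that ac by (intro P) (auto intro: order_trans)
  have "grid_dd x (\<lambda>d. f (yd d)) c b = grid_dd x (\<lambda>d. poly P (yd d)) c b"
    by (rule grid_dd_cong) (simp add: Pd)
  also have "\<dots> = (\<Sum>v\<in>chains_between c b. dd1 (poly P) (yd ` set v) * step_prod (grid_dd x yd) v)"
    by (rule grid_dd_compose_poly[OF inj injy ac])
  also have "\<dots> = (\<Sum>v\<in>chains_between c b. dd1 f (yd ` set v) * step_prod (grid_dd x yd) v)"
  proof (intro sum.cong refl arg_cong2[of _ _ _ _ "(*)"] dd1_cong)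
    fix v z assume "v \<in> chains_between c b" "z \<in> yd ` set v"
    then show "poly P z = f z"
      using chains_between_bounds Pd by blast
  qed
  finally show ?thesis .
qed

text \<open>Expand \<open>g\<close> in its last variable into indicator functions of the finitely many values of \<open>yd\<close>. Each term
  is a product of a function of the grid point and a function of \<open>yd\<close>; the Leibniz rule separates them at
  an index \<open>c\<close>, and the second factor is a sum over chains from \<open>c\<close>.\<close>

theorem grid_dd_chain_rule:
  fixes g :: "('q::finite option \<Rightarrow> real) \<Rightarrow> real"
  assumes inj: "\<And>r. inj_on (x r) {a $ r..b $ r}" and injy: "inj_on yd {a..b}" and ab: "a \<le> b"
  shows "grid_dd x (\<lambda>c. g (case_option (yd c) (\<lambda>r. x r (c $ r)))) a b
    = (\<Sum>c\<in>{a..b}. \<Sum>v\<in>chains_between c b.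
        set_dd g (case_option (yd ` set v) (\<lambda>r. x r ` {a $ r..c $ r})) * step_prod (grid_dd x yd) v)"
proof -
  define Z where "Z = yd ` {a..b}"
  define \<delta> :: "real \<Rightarrow> real \<Rightarrow> real" where "\<delta> = (\<lambda>z w. if w = z then 1 else 0)"
  define G where "G = (\<lambda>z c. g (case_option z (\<lambda>r. x r (c $ r))))"
  have finZ: "finite Z" unfolding Z_def by (intro finite_imageI finite_multi_index_interval)
  have "grid_dd x (\<lambda>c. g (case_option (yd c) (\<lambda>r. x r (c $ r)))) a b
      = grid_dd x (\<lambda>c. \<Sum>z\<in>Z. G z c * \<delta> z (yd c)) a b"
  proof (rule grid_dd_cong)
    fix c assume "a \<le> c" "c \<le> b"
    then have "yd c \<in> Z" by (auto simp: Z_def)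
    then show "g (case_option (yd c) (\<lambda>r. x r (c $ r))) = (\<Sum>z\<in>Z. G z c * \<delta> z (yd c))"
      using finZ by (simp add: \<delta>_def G_def if_distrib[of "\<lambda>x. _ * x"] sum.delta' cong: if_cong)
  qed
  also have "\<dots> = (\<Sum>z\<in>Z. \<Sum>c\<in>{a..b}. grid_dd x (G z) a c * grid_dd x (\<lambda>c. \<delta> z (yd c)) c b)"
    unfolding grid_dd_sum by (intro sum.cong refl grid_dd_Leibniz inj ab)
  also have "\<dots> = (\<Sum>z\<in>Z. \<Sum>c\<in>{a..b}. \<Sum>v\<in>chains_between c b.
      grid_dd x (G z) a c * dd1 (\<delta> z) (yd ` set v) * step_prod (grid_dd x yd) v)"
  proof (intro sum.cong refl)
    fix z c assume "c \<in> {a..b}"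
    then have "grid_dd x (\<lambda>c. \<delta> z (yd c)) c b
        = (\<Sum>v\<in>chains_between c b. dd1 (\<delta> z) (yd ` set v) * step_prod (grid_dd x yd) v)"
      by (intro grid_dd_compose[OF inj injy]) auto
    then show "grid_dd x (G z) a c * grid_dd x (\<lambda>c. \<delta> z (yd c)) c b
        = (\<Sum>v\<in>chains_between c b. grid_dd x (G z) a c * dd1 (\<delta> z) (yd ` set v) * step_prod (grid_dd x yd) v)"
      by (simp add: sum_distrib_left mult.assoc)
  qed
  also have "\<dots> = (\<Sum>c\<in>{a..b}. \<Sum>v\<in>chains_between c b.
      (\<Sum>z\<in>Z. grid_dd x (G z) a c * dd1 (\<delta> z) (yd ` set v)) * step_prod (grid_dd x yd) v)"
    unfolding sum_distrib_right by (subst sum.swap, intro sum.cong refl sum.swap)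
  also have "\<dots> = (\<Sum>c\<in>{a..b}. \<Sum>v\<in>chains_between c b.
        set_dd g (case_option (yd ` set v) (\<lambda>r. x r ` {a $ r..c $ r})) * step_prod (grid_dd x yd) v)"
  proof (intro sum.cong refl arg_cong2[of _ _ _ _ "(*)"])
    fix c v assume c: "c \<in> {a..b}" and v: "v \<in> chains_between c b"
    have injc: "inj_on (x r) {a $ r..c $ r}" for r
      using c by (intro inj_on_subset[OF inj]) (auto simp: less_eq_vec_def intro: order_trans)
    have sub: "yd ` set v \<subseteq> Z"
      using chains_between_bounds[OF v] c by (fastforce simp: Z_def intro: order_trans)
    have \<delta>: "dd1 (\<delta> z) S = (if z \<in> S then dd_weight S z else 0)" if "finite S" for z S
      using that by (simp add: dd1_def \<delta>_def if_distrib[of "\<lambda>x. x * _"] sum.delta cong: if_cong)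
    have "(\<Sum>z\<in>Z. grid_dd x (G z) a c * dd1 (\<delta> z) (yd ` set v))
        = (\<Sum>z\<in>yd ` set v. grid_dd x (G z) a c * dd_weight (yd ` set v) z)"
      using sub finZ by (intro sum.mono_neutral_cong_right) (auto simp: \<delta>)
    also have "\<dots> = dd1 (\<lambda>z. set_dd (\<lambda>u. g (case_option z u)) (\<lambda>r. x r ` {a $ r..c $ r})) (yd ` set v)"
      unfolding dd1_def G_def set_dd_grid[OF injc] ..
    also have "\<dots> = set_dd g (case_option (yd ` set v) (\<lambda>r. x r ` {a $ r..c $ r}))"
      by (rule set_dd_option[symmetric]) auto
    finally show "(\<Sum>z\<in>Z. grid_dd x (G z) a c * dd1 (\<delta> z) (yd ` set v))
        = set_dd g (case_option (yd ` set v) (\<lambda>r. x r ` {a $ r..c $ r}))" .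
  qed
  finally show ?thesis .
qed

section \<open>From smoothness to limits along a perturbation\<close>

lemma Ck_on_continuous: "Ck_on k f S \<Longrightarrow> continuous_on S f"
  by (cases k) (auto intro!: continuous_at_imp_continuous_on differentiable_imp_continuous_within)

text \<open>The parametrisation \<open>\<Phi>\<close> moves along \<open>e j\<close> with unit speed in its variable \<open>j\<close>, so partial derivatives are
  Frechet derivatives in the directions \<open>e j\<close>. This covers both functions of a vector and functions of a
  vector together with a real number.\<close>

lemma Ck_on_imp_partials_continuous:
  fixes \<Phi> :: "('d::finite \<Rightarrow> real) \<Rightarrow> 'a::real_normed_vector"
  assumes "Ck_on k f S"
    and maps: "\<And>u. u \<in> Pi UNIV B \<Longrightarrow> \<Phi> u \<in> S"
    and affine: "\<And>u j t. \<Phi> (u(j := t)) = \<Phi> u + (t - u j) *\<^sub>R e j"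
    and lipschitz: "\<And>u v. dist (\<Phi> u) (\<Phi> v) \<le> (\<Sum>j\<in>UNIV. \<bar>u j - v j\<bar>)"
  shows "partials_continuous k (\<lambda>u. f (\<Phi> u)) B"
  using assms(1)
proof (induction k arbitrary: f)
  have cont: "box_continuous (\<lambda>u. f (\<Phi> u)) B" if f: "continuous_on S f" for f
    unfolding box_continuous_def
  proof (intro ballI allI impI)
    fix u and r :: real assume u: "u \<in> Pi UNIV B" and r: "r > 0"
    then obtain d where d: "d > 0" "\<And>s. s \<in> S \<Longrightarrow> dist s (\<Phi> u) < d \<Longrightarrow> dist (f s) (f (\<Phi> u)) < r"
      using f maps[OF u] unfolding continuous_on_iff by metis
    show "\<exists>d>0. \<forall>v\<in>Pi UNIV B. (\<forall>j. \<bar>v j - u j\<bar> < d) \<longrightarrow> \<bar>f (\<Phi> v) - f (\<Phi> u)\<bar> < r"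
    proof (intro exI conjI ballI impI)
      show "d / real (CARD('d)) > 0" using d(1) by simp
      fix v assume v: "v \<in> Pi UNIV B" and near: "\<forall>j. \<bar>v j - u j\<bar> < d / real (CARD('d))"
      have "(\<Sum>j\<in>UNIV. \<bar>v j - u j\<bar>) < real (CARD('d)) * (d / real (CARD('d)))"
        using near by (intro sum_bounded_above_strict) auto
      then have "dist (\<Phi> v) (\<Phi> u) < d"
        using lipschitz[of v u] by simp
      then show "\<bar>f (\<Phi> v) - f (\<Phi> u)\<bar> < r"
        using d(2)[OF maps[OF v]] by (simp add: dist_real_def)
    qed
  qed
  {
    case 0
    then show ?case using cont by simp
  next
    case (Suc k)
    have "((\<lambda>t. f (\<Phi> (u(j := t)))) has_real_derivative frechet_derivative f (at (\<Phi> u)) (e j)) (at (u j))"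
      if u: "u \<in> Pi UNIV B" for u j
    proof -
      let ?f' = "frechet_derivative f (at (\<Phi> u))"
      have f: "(f has_derivative ?f') (at (\<Phi> u))"
        using Suc.prems maps[OF u] frechet_derivative_works by auto
      have lin: "linear ?f'"
        using has_derivative_linear[OF f] .
      have "((\<lambda>t. \<Phi> u + (t - u j) *\<^sub>R e j) has_derivative (\<lambda>t. t *\<^sub>R e j)) (at (u j))"
        by (auto intro!: derivative_eq_intros)
      moreover have "(f has_derivative ?f') (at (\<Phi> u + (u j - u j) *\<^sub>R e j))"
        using f by simp
      ultimately have "((\<lambda>t. f (\<Phi> u + (t - u j) *\<^sub>R e j)) has_derivative (\<lambda>t. ?f' (t *\<^sub>R e j))) (at (u j))"
        using has_derivative_compose by fastforce
      moreover have "(\<lambda>t. ?f' (t *\<^sub>R e j)) = (*) (?f' (e j))"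
        using linear_scale[OF lin] by (auto simp: fun_eq_iff mult.commute)
      ultimately show ?thesis
        by (simp add: has_field_derivative_def affine)
    qed
    moreover have "partials_continuous k (\<lambda>u. frechet_derivative f (at (\<Phi> u)) (e j)) B" for j
      using Suc.prems by (intro Suc.IH) simp
    ultimately show ?case
      unfolding partials_continuous.simps
      using cont[OF Ck_on_continuous[OF Suc.prems]]
      by (intro conjI allI exI[of _ "\<lambda>u. frechet_derivative f (at (\<Phi> u)) (e _)"] ballI) auto
  }
qed

lemma filterlim_distinct_near:
  fixes Z :: "'t \<Rightarrow> 'd::finite \<Rightarrow> real list"
  assumes len: "\<And>t j. length (Z t j) = length (X j)"
    and dist: "eventually (\<lambda>t. \<forall>j. distinct (Z t j)) F"
    and lim: "\<And>j i. i < length (X j) \<Longrightarrow> ((\<lambda>t. Z t j ! i) \<longlongrightarrow> X j ! i) F"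
  shows "filterlim Z (distinct_near X) F"
  unfolding filterlim_iff
proof (intro allI impI)
  fix P assume "eventually P (distinct_near X)"
  then obtain e where e: "e > 0" "\<And>Z. near_groups e X Z \<Longrightarrow> P Z"
    unfolding eventually_distinct_near by blast
  have "\<forall>\<^sub>F t in F. \<forall>j\<in>UNIV. \<forall>i\<in>{..<length (X j)}. dist (Z t j ! i) (X j ! i) < e"
    using e(1) by (intro eventually_ball_finite ballI tendstoD lim) auto
  then show "\<forall>\<^sub>F t in F. P (Z t)"
    using dist
  proof eventually_elim
    case (elim t)
    then show ?case
      using len by (intro e(2)) (auto simp: near_groups_def list_all2_conv_all_nth)
  qed
qed

text \<open>The form in which limits are used: along a family of tuples of distinct points. Such a family
  also shows that the filter is not trivial.\<close>

lemma dd_distinct_tendsto_along: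
  fixes f :: "('d::finite \<Rightarrow> real) \<Rightarrow> real" and Z :: "'t \<Rightarrow> 'd \<Rightarrow> real list"
  assumes "partials_continuous N f B" "\<And>j. open (B j)" "\<And>j. X j \<noteq> []" "\<And>j. set (X j) \<subseteq> B j"
    "(\<Sum>j\<in>UNIV. length (X j) - 1) \<le> N" and "F \<noteq> bot"
    and "\<And>t j. length (Z t j) = length (X j)" "eventually (\<lambda>t. \<forall>j. distinct (Z t j)) F"
    and "\<And>j i. i < length (X j) \<Longrightarrow> ((\<lambda>t. Z t j ! i) \<longlongrightarrow> X j ! i) F"
  shows "((\<lambda>t. dd_distinct f (Z t)) \<longlongrightarrow> divdiff f X) F"
proof -
  have Z: "filterlim Z (distinct_near X) F"
    using assms by (intro filterlim_distinct_near)
  then have "distinct_near X \<noteq> bot"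
    using assms(6) by (auto simp: filterlim_def bot_unique filtermap_bot_iff)
  then show ?thesis
    using assms(1-5) by (intro filterlim_compose[OF dd_distinct_tendsto_divdiff Z])
qed

text \<open>Two values collide for at most one \<open>s\<close>.\<close>

lemma eventually_inj_perturbation:
  fixes h \<kappa> :: "'a \<Rightarrow> real"
  assumes "finite C" "inj_on \<kappa> C"
  shows "\<forall>\<^sub>F s in at_right 0. inj_on (\<lambda>c. h c + s * \<kappa> c) C"
proof -
  have "\<forall>\<^sub>F s in at_right 0. h c + s * \<kappa> c \<noteq> h d + s * \<kappa> d" if cd: "c \<in> C" "d \<in> C" "c \<noteq> d" for c d
  proof (cases "h c = h d")
    case True
    have "\<kappa> c \<noteq> \<kappa> d" using assms(2) cd by (auto dest: inj_onD)
    then show ?thesis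
      using True eventually_at_right_less[of "0::real"] by (auto elim!: eventually_mono)
  next
    case False
    have "((\<lambda>s. (h c + s * \<kappa> c) - (h d + s * \<kappa> d)) \<longlongrightarrow> (h c + 0 * \<kappa> c) - (h d + 0 * \<kappa> d)) (at_right 0)"
      by (intro tendsto_intros)
    then have "\<forall>\<^sub>F s in at_right 0. (h c + s * \<kappa> c) - (h d + s * \<kappa> d) \<noteq> 0"
      using False by (intro tendsto_imp_eventually_ne) auto
    then show ?thesis by (auto elim!: eventually_mono)
  qed
  then have "\<forall>\<^sub>F s in at_right 0. \<forall>c\<in>C. \<forall>d\<in>C. c \<noteq> d \<longrightarrow> h c + s * \<kappa> c \<noteq> h d + s * \<kappa> d"
    using assms(1) by (intro eventually_ball_finite ballI) auto
  then show ?thesis by (auto elim!: eventually_mono simp: inj_on_def)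
qed

lemma chains_between_length:
  fixes c b :: "nat ^ 'q::finite"
  assumes v: "v \<in> chains_between c b"
  shows "length v - 1 \<le> abs_index b - abs_index c"
proof -
  have s: "sorted_wrt (<) v" and ne: "v \<noteq> []" and ends: "v ! 0 = c" "v ! (length v - 1) = b"
    using v by (auto simp: chains_between_def hd_conv_nth last_conv_nth)
  have "abs_index c + i \<le> abs_index (v ! i)" if "i < length v" for i
    using that
  proof (induction i)
    case (Suc i)
    have "abs_index (v ! i) < abs_index (v ! Suc i)"
      using Suc by (intro abs_index_strict_mono sorted_wrt_nth_less[OF s]) auto
    then show ?case using Suc by simp
  qed (simp add: ends)
  from this[of "length v - 1"] show ?thesis
    using ne ends by (simp add: le_diff_conv2)
qed

lemma abs_index_diff:
  assumes "c \<le> d"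
  shows "(\<Sum>r\<in>UNIV. d $ r - c $ r) = abs_index d - abs_index c"
  unfolding abs_index_def using assms by (intro sum_subtractf_nat) (auto simp: less_eq_vec_def)

lemma tendsto_step_prod:
  assumes "\<And>j. 0 < j \<Longrightarrow> j < length v \<Longrightarrow> ((\<lambda>t. w t (v ! (j - 1)) (v ! j)) \<longlongrightarrow> w' (v ! (j - 1)) (v ! j)) F"
  shows "((\<lambda>t. step_prod (w t) v) \<longlongrightarrow> step_prod w' v) F"
  unfolding step_prod_conv_prod using assms by (intro tendsto_prod) auto

lemma zero_le_index: "0 \<le> (c :: nat ^ 'q::finite)"
  by (simp add: less_eq_vec_def)

section \<open>The identity satisfied by an implicit function\<close>

text \<open>The setting of the identity between divided differences. The denominators are added when the
  identity is solved for a divided difference of \<open>y\<close>.\<close>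

locale implicit_grid =
  fixes A :: "'q::{finite,linorder} \<Rightarrow> real set" and U :: "(real ^ 'q::{finite,linorder}) set" and V :: "real set"
    and g :: "(real ^ 'q::{finite,linorder}) \<times> real \<Rightarrow> real" and y :: "real ^ 'q::{finite,linorder} \<Rightarrow> real"
    and n :: "nat ^ 'q::{finite,linorder}" and x :: "'q::{finite,linorder} \<Rightarrow> nat \<Rightarrow> real"
  assumes box: "\<And>j. open (A j)" "U = {u. \<forall>j. u $ j \<in> A j}"
    and V: "open V"
    and smooth: "Ck_on (abs_index n) g (U \<times> V)" "Ck_on (abs_index n) y U"
    and y_V: "\<And>u. u \<in> U \<Longrightarrow> y u \<in> V"
    and implicit: "\<And>u. u \<in> U \<Longrightarrow> g (u, y u) = 0"
    and grid: "\<And>j i. i \<le> n $ j \<Longrightarrow> x j i \<in> A j"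
    and increasing: "\<And>j i k. i \<le> k \<Longrightarrow> k \<le> n $ j \<Longrightarrow> x j i \<le> x j k"
begin

abbreviation y_fun :: "('q \<Rightarrow> real) \<Rightarrow> real" where
  "y_fun u \<equiv> y (\<chi> j. u j)"

abbreviation g_fun :: "('q option \<Rightarrow> real) \<Rightarrow> real" where
  "g_fun u \<equiv> g ((\<chi> j. u (Some j)), u None)"

lemma partials_continuous_y: "partials_continuous (abs_index n) y_fun A"
proof (rule Ck_on_imp_partials_continuous[OF smooth(2), where e = "\<lambda>j. axis j 1"])
  show "(\<chi> j. u j) \<in> U" if "u \<in> Pi UNIV A" for u
    using that by (auto simp: box)
  show "(\<chi> i. (u(j := t)) i) = (\<chi> j. u j) + (t - u j) *\<^sub>R axis j 1" for u j t
    by (auto simp: vec_eq_iff axis_def)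
  show "dist (\<chi> j. u j) (\<chi> j. v j) \<le> (\<Sum>j\<in>UNIV. \<bar>u j - v j\<bar>)" for u v :: "'q \<Rightarrow> real"
    using norm_le_l1_cart[of "(\<chi> j. u j) - (\<chi> j. v j)"] by (simp add: dist_norm)
qed

lemma partials_continuous_g: "partials_continuous (abs_index n) g_fun (case_option V A)"
proof (rule Ck_on_imp_partials_continuous[OF smooth(1),
      where e = "case_option (0, 1) (\<lambda>j. (axis j 1, 0))"])
  show "((\<chi> j. u (Some j)), u None) \<in> U \<times> V" if "u \<in> Pi UNIV (case_option V A)" for u
  proof -
    have "u None \<in> V" "\<And>j. u (Some j) \<in> A j"
      using that by (auto simp: Pi_iff split: option.splits)
    then show ?thesis by (auto simp: box)
  qed
  show "((\<chi> j. (u(i := t)) (Some j)), (u(i := t)) None)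
      = ((\<chi> j. u (Some j)), u None) + (t - u i) *\<^sub>R (case i of None \<Rightarrow> (0, 1) | Some j \<Rightarrow> (axis j 1, 0))" for u i t
    by (cases i) (auto simp: vec_eq_iff axis_def)
  show "dist ((\<chi> j. u (Some j)), u None) ((\<chi> j. v (Some j)), v None) \<le> (\<Sum>j\<in>UNIV. \<bar>u j - v j\<bar>)"
    for u v :: "'q option \<Rightarrow> real"
  proof -
    have "dist ((\<chi> j. u (Some j)), u None) ((\<chi> j. v (Some j)), v None)
        \<le> norm ((\<chi> j. u (Some j)) - (\<chi> j. v (Some j))) + norm (u None - v None)"
      using norm_Pair_le[of "(\<chi> j. u (Some j)) - (\<chi> j. v (Some j))" "u None - v None"]
      by (simp add: dist_norm)
    also have "\<dots> \<le> (\<Sum>j\<in>UNIV. \<bar>u (Some j) - v (Some j)\<bar>) + \<bar>u None - v None\<bar>"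
      using norm_le_l1_cart[of "(\<chi> j. u (Some j)) - (\<chi> j. v (Some j))"] by simp
    also have "\<dots> = (\<Sum>j\<in>UNIV. \<bar>u j - v j\<bar>)"
      by (simp add: UNIV_option_conv sum.reindex)
    finally show ?thesis .
  qed
qed

lemma grid_point_in_U: "c \<le> n \<Longrightarrow> grid_point x c \<in> U"
  using grid by (auto simp: grid_point_def box less_eq_vec_def)

text \<open>Grid points made distinct: since the given ones increase weakly, these increase strictly if \<open>t > 0\<close>.\<close>

definition spread :: "real \<Rightarrow> 'q \<Rightarrow> nat \<Rightarrow> real" where
  "spread t r i = x r i + real i * t"

lemma spread_inj:
  assumes "t > 0" "b \<le> n"
  shows "inj_on (spread t r) {a $ r..b $ r}"
proof (rule linorder_inj_onI)
  fix i k assume ik: "i < k" "i \<in> {a $ r..b $ r}" "k \<in> {a $ r..b $ r}"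
  then have "k \<le> n $ r" using assms(2) by (auto simp: less_eq_vec_def intro: order_trans)
  then have "x r i \<le> x r k" using ik increasing by simp
  moreover have "real i * t < real k * t" using ik assms by simp
  ultimately show "spread t r i \<noteq> spread t r k" by (simp add: spread_def)
qed auto

lemma spread_tendsto: "((\<lambda>t. spread t r i) \<longlongrightarrow> x r i) (at_right 0)"
proof -
  have "((\<lambda>t. x r i + real i * t) \<longlongrightarrow> x r i + real i * 0) (at_right 0)"
    by (intro tendsto_intros)
  then show ?thesis by (simp add: spread_def)
qed

lemma eventually_spread_in_U: "\<forall>\<^sub>F t in at_right 0. \<forall>c\<in>{0..n}. grid_point (spread t) c \<in> U"
proof -
  have "\<forall>\<^sub>F t in at_right 0. \<forall>r\<in>UNIV. \<forall>i\<in>{..n $ r}. spread t r i \<in> A r"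
    using topological_tendstoD[OF spread_tendsto] box(1) grid
    by (intro eventually_ball_finite ballI) auto
  then show ?thesis
    by (rule eventually_mono) (auto simp: grid_point_def box less_eq_vec_def)
qed

lemma grid_point_spread_tendsto: "((\<lambda>t. grid_point (spread t) c) \<longlongrightarrow> grid_point x c) (at_right 0)"
  unfolding grid_point_def by (intro tendsto_vec_lambda spread_tendsto)

lemma y_spread_tendsto:
  assumes "c \<le> n"
  shows "((\<lambda>t. y (grid_point (spread t) c)) \<longlongrightarrow> y (grid_point x c)) (at_right 0)"
proof (rule continuous_on_tendsto_compose[OF Ck_on_continuous[OF smooth(2)] grid_point_spread_tendsto])
  show "grid_point x c \<in> U" using assms by (rule grid_point_in_U)
  show "\<forall>\<^sub>F t in at_right 0. grid_point (spread t) c \<in> U"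
    using eventually_spread_in_U by (rule eventually_mono) (use assms in \<open>auto simp: less_eq_vec_def\<close>)
qed

lemma grid_dd_spread_tendsto_divdiff_y:
  assumes cd: "c \<le> d" "d \<le> n"
  shows "((\<lambda>t. grid_dd (spread t) (\<lambda>e. y (grid_point (spread t) e)) c d) \<longlongrightarrow> divdiff_y y x c d) (at_right 0)"
proof -
  have le: "c $ r \<le> d $ r" "d $ r \<le> n $ r" for r using cd by (auto simp: less_eq_vec_def)
  define Z where "Z = (\<lambda>t r. map (spread t r) [c $ r..<Suc (d $ r)])"
  define X where "X = (\<lambda>r. map (x r) [c $ r..<Suc (d $ r)])"
  have "((\<lambda>t. dd_distinct y_fun (Z t)) \<longlongrightarrow> divdiff y_fun X) (at_right 0)"
  proof (rule dd_distinct_tendsto_along[OF partials_continuous_y])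
    show "X r \<noteq> []" for r using le by (simp add: X_def)
    show "set (X r) \<subseteq> A r" for r
      using le[of r] grid by (auto simp: X_def simp del: upt_Suc)
    have "(\<Sum>r\<in>UNIV. length (X r) - 1) = abs_index d - abs_index c"
      unfolding abs_index_diff[OF cd(1), symmetric] using le by (intro sum.cong) (auto simp: X_def Suc_diff_le)
    then show "(\<Sum>r\<in>UNIV. length (X r) - 1) \<le> abs_index n"
      using abs_index_mono[OF cd(2)] by simp
    show "length (Z t r) = length (X r)" for t r by (simp add: X_def Z_def)
    show "\<forall>\<^sub>F t in at_right 0. \<forall>r. distinct (Z t r)"
      using eventually_at_right_less[of "0::real"]
    proof eventually_elim
      case (elim t)
      then show ?case
        using spread_inj[of t d _ c] cd
        by (auto simp: Z_def distinct_map atLeastLessThanSuc_atLeastAtMost simp del: upt_Suc)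
    qed
    show "((\<lambda>t. Z t r ! i) \<longlongrightarrow> X r ! i) (at_right 0)" if "i < length (X r)" for r i
      using that spread_tendsto by (simp add: X_def Z_def del: upt_Suc)
  qed (auto simp: box)
  moreover have "\<forall>\<^sub>F t in at_right 0. dd_distinct y_fun (Z t)
      = grid_dd (spread t) (\<lambda>e. y (grid_point (spread t) e)) c d"
    using eventually_at_right_less[of "0::real"]
  proof eventually_elim
    case (elim t)
    have inj: "inj_on (spread t r) {c $ r..d $ r}" for r
      using elim cd by (intro spread_inj)
    have "dd_distinct y_fun (Z t) = set_dd y_fun (\<lambda>r. set (Z t r))"
    proof (rule dd_distinct_eq_set_dd)
      show "distinct (Z t r)" for r
        using inj[of r] by (simp add: Z_def distinct_map atLeastLessThanSuc_atLeastAtMost del: upt_Suc)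
      show "Z t r \<noteq> []" for r using le[of r] by (simp add: Z_def)
    qed
    also have "(\<lambda>r. set (Z t r)) = (\<lambda>r. spread t r ` {c $ r..d $ r})"
      by (auto simp: Z_def fun_eq_iff atLeastLessThanSuc_atLeastAtMost simp del: upt_Suc)
    also have "set_dd y_fun \<dots> = grid_dd (spread t) (\<lambda>e. y_fun (\<lambda>r. spread t r (e $ r))) c d"
      by (rule set_dd_grid[OF inj])
    finally show ?case by (simp add: grid_point_def)
  qed
  ultimately show ?thesis
    unfolding divdiff_y_def X_def by (rule Lim_transform_eventually)
qed

text \<open>Values \<open>yd\<close> that are pairwise distinct and, up to the error \<open>t\<close>, indistinguishable from the
  values of \<open>y\<close> on the spread grid: by their divided differences, and by how well they solve the equation.
  Distinct values are needed for the chain rule, and \<open>y\<close> itself may well be constant.\<close>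

definition perturbation :: "real \<Rightarrow> nat ^ 'q::{finite,linorder} \<Rightarrow> nat ^ 'q::{finite,linorder}
    \<Rightarrow> (nat ^ 'q::{finite,linorder} \<Rightarrow> real) \<Rightarrow> bool" where
  "perturbation t a b yd \<longleftrightarrow> inj_on yd {0..n}
     \<and> (\<forall>c\<in>{0..n}. \<bar>yd c - y (grid_point (spread t) c)\<bar> < t)
     \<and> (\<forall>c\<in>{0..n}. \<forall>d\<in>{0..n}.
          \<bar>grid_dd (spread t) yd c d - grid_dd (spread t) (\<lambda>e. y (grid_point (spread t) e)) c d\<bar> < t)
     \<and> \<bar>grid_dd (spread t) (\<lambda>c. g (grid_point (spread t) c, yd c)) a b\<bar> < t"

text \<open>The grid being fixed, divided differences are continuous functions of the values, and the exact
  values have all the properties except distinctness.\<close>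

lemma perturbation_exists:
  assumes ab: "a \<le> b" "b \<le> n" and t: "t > 0" and inU: "\<forall>c\<in>{0..n}. grid_point (spread t) c \<in> U"
  shows "\<exists>yd. perturbation t a b yd"
proof -
  define h where "h = (\<lambda>c. y (grid_point (spread t) c))"
  have fin: "finite {0..n}" by (rule finite_multi_index_interval)
  obtain \<kappa>0 :: "_ \<Rightarrow> nat" where "inj_on \<kappa>0 {0..n}"
    using finite_imp_inj_to_nat_seg[OF fin] by metis
  then have \<kappa>: "inj_on (\<lambda>c. real (\<kappa>0 c)) {0..n}"
    by (auto simp: inj_on_def)
  \<comment> \<open>Adding small multiples of distinct numbers separates the values.\<close>
  define Y where "Y = (\<lambda>s c. h c + s * real (\<kappa>0 c))"
  have Ylim: "((\<lambda>s. Y s c) \<longlongrightarrow> h c) (at_right 0)" for c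
  proof -
    have "((\<lambda>s. h c + s * real (\<kappa>0 c)) \<longlongrightarrow> h c + 0 * real (\<kappa>0 c)) (at_right 0)"
      by (intro tendsto_intros)
    then show ?thesis by (simp add: Y_def)
  qed
  have ddlim: "((\<lambda>s. grid_dd (spread t) (Y s) c d) \<longlongrightarrow> grid_dd (spread t) h c d) (at_right 0)" for c d
    unfolding grid_dd_def by (intro tendsto_intros Ylim)
  have glim: "((\<lambda>s. grid_dd (spread t) (\<lambda>c. g (grid_point (spread t) c, Y s c)) a b)
      \<longlongrightarrow> grid_dd (spread t) (\<lambda>c. g (grid_point (spread t) c, h c)) a b) (at_right 0)"
    unfolding grid_dd_def
  proof (intro tendsto_sum tendsto_mult tendsto_const)
    fix c assume "c \<in> {a..b}"
    then have c: "c \<in> {0..n}" using ab zero_le_index[of c] by (auto intro: order_trans)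
    have hV: "h c \<in> V" unfolding h_def using inU c by (intro y_V) blast
    show "((\<lambda>s. g (grid_point (spread t) c, Y s c)) \<longlongrightarrow> g (grid_point (spread t) c, h c)) (at_right 0)"
    proof (rule continuous_on_tendsto_compose[OF Ck_on_continuous[OF smooth(1)]])
      show "((\<lambda>s. (grid_point (spread t) c, Y s c)) \<longlongrightarrow> (grid_point (spread t) c, h c)) (at_right 0)"
        by (intro tendsto_intros Ylim)
      show "(grid_point (spread t) c, h c) \<in> U \<times> V" using inU c hV by auto
      have "\<forall>\<^sub>F s in at_right 0. Y s c \<in> V"
        using topological_tendstoD[OF Ylim V hV] .
      then show "\<forall>\<^sub>F s in at_right 0. (grid_point (spread t) c, Y s c) \<in> U \<times> V"
        by (rule eventually_mono) (use inU c in auto)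
    qed
  qed
  have "grid_dd (spread t) (\<lambda>c. g (grid_point (spread t) c, h c)) a b = grid_dd (spread t) (\<lambda>_. 0) a b"
  proof (rule grid_dd_cong)
    fix c assume "a \<le> c" "c \<le> b"
    then have "c \<in> {0..n}" using ab zero_le_index[of c] by (auto intro: order_trans)
    then show "g (grid_point (spread t) c, h c) = 0"
      unfolding h_def using inU by (intro implicit) blast
  qed
  then have zero: "grid_dd (spread t) (\<lambda>c. g (grid_point (spread t) c, h c)) a b = 0"
    by (simp add: grid_dd_def)
  have "\<forall>\<^sub>F s in at_right 0. inj_on (Y s) {0..n}"
    unfolding Y_def by (rule eventually_inj_perturbation[OF fin \<kappa>])
  moreover have "\<forall>\<^sub>F s in at_right 0. \<forall>c\<in>{0..n}. dist (Y s c) (h c) < t"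
    using tendstoD[OF Ylim t] by (intro eventually_ball_finite[OF fin] ballI)
  moreover have "\<forall>\<^sub>F s in at_right 0. \<forall>c\<in>{0..n}. \<forall>d\<in>{0..n}.
      dist (grid_dd (spread t) (Y s) c d) (grid_dd (spread t) h c d) < t"
    using tendstoD[OF ddlim t] by (intro eventually_ball_finite[OF fin] ballI)
  moreover have "\<forall>\<^sub>F s in at_right 0. dist (grid_dd (spread t) (\<lambda>c. g (grid_point (spread t) c, Y s c)) a b) 0 < t"
    using tendstoD[OF glim t] unfolding zero .
  ultimately have "\<forall>\<^sub>F s in at_right 0. perturbation t a b (Y s)"
    unfolding perturbation_def h_def dist_real_def by (simp add: eventually_conj_iff)
  then show ?thesis
    using eventually_happens'[OF trivial_limit_at_right_real] by blast
qed

text \<open>The chain rule for the composite \<open>g (x, y x) = 0\<close> at possibly coinciding points. It holds for the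
  perturbed values with an error that is at most \<open>t\<close>, and every divided difference in it tends to its confluent
  counterpart as \<open>t\<close> tends to \<open>0\<close>.\<close>

theorem implicit_chain_identity:
  assumes ab: "a \<le> b" "b \<le> n"
  shows "(\<Sum>c\<in>{a..b}. \<Sum>v\<in>chains_between c b.
      divdiff_g g y x (\<lambda>r. [a $ r..<Suc (c $ r)]) v * step_prod (divdiff_y y x) v) = 0"
proof -
  define good where "good = (\<lambda>t::real. t > 0 \<and> (\<forall>c\<in>{0..n}. grid_point (spread t) c \<in> U))"
  have ev_good: "\<forall>\<^sub>F t in at_right 0. good t"
    unfolding good_def using eventually_at_right_less[of "0::real"] eventually_spread_in_U
    by (rule eventually_conj)
  have "\<forall>t. \<exists>yd. good t \<longrightarrow> perturbation t a b yd"
    using perturbation_exists[OF ab] unfolding good_def by blast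
  from choice[OF this] obtain yd where yd: "\<And>t. good t \<Longrightarrow> perturbation t a b (yd t)"
    by blast
  \<comment> \<open>The errors of size \<open>t\<close> disappear in the limit.\<close>
  have close: "(k \<longlongrightarrow> l) (at_right 0)"
    if "\<And>t. good t \<Longrightarrow> \<bar>k t - m t\<bar> < t" "(m \<longlongrightarrow> l) (at_right 0)" for k m :: "real \<Rightarrow> real" and l
  proof -
    have "((\<lambda>t. k t - m t) \<longlongrightarrow> 0) (at_right 0)"
    proof (rule Lim_null_comparison)
      show "\<forall>\<^sub>F t in at_right 0. norm (k t - m t) \<le> t"
        using ev_good by (rule eventually_mono) (use that(1) in \<open>auto intro: less_imp_le\<close>)
      show "((\<lambda>t. t) \<longlongrightarrow> (0::real)) (at_right 0)" by (intro tendsto_intros)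
    qed
    from tendsto_add[OF this that(2)] show ?thesis by simp
  qed
  have in0n: "c \<in> {0..n}" if "c \<le> n" for c using that zero_le_index by simp
  have yd_lim: "((\<lambda>t. yd t c) \<longlongrightarrow> y (grid_point x c)) (at_right 0)" if "c \<le> n" for c
    using yd in0n[OF that] unfolding perturbation_def by (intro close[OF _ y_spread_tendsto[OF that]]) blast
  have dd_lim: "((\<lambda>t. grid_dd (spread t) (yd t) c d) \<longlongrightarrow> divdiff_y y x c d) (at_right 0)"
    if "c \<le> d" "d \<le> n" for c d
    using yd in0n[OF that(2)] in0n[OF order_trans[OF that]] unfolding perturbation_def
    by (intro close[OF _ grid_dd_spread_tendsto_divdiff_y[OF that]]) blast
  define Z where "Z = (\<lambda>c v t. case_option (map (yd t) v) (\<lambda>r. map (spread t r) [a $ r..<Suc (c $ r)]))"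
  define E where "E = (\<lambda>t. \<Sum>c\<in>{a..b}. \<Sum>v\<in>chains_between c b.
      dd_distinct g_fun (Z c v t) * step_prod (grid_dd (spread t) (yd t)) v)"
  have "(E \<longlongrightarrow> (\<Sum>c\<in>{a..b}. \<Sum>v\<in>chains_between c b.
      divdiff_g g y x (\<lambda>r. [a $ r..<Suc (c $ r)]) v * step_prod (divdiff_y y x) v)) (at_right 0)"
    unfolding E_def
  proof (intro tendsto_sum tendsto_mult)
    fix c v assume c: "c \<in> {a..b}" and v: "v \<in> chains_between c b"
    have bnd: "c \<le> d \<and> d \<le> n" if "d \<in> set v" for d
      using chains_between_bounds[OF v that] ab by (auto intro: order_trans)
    have sorted: "sorted_wrt (<) v" and vne: "v \<noteq> []" using v by (auto simp: chains_between_def)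
    show "((\<lambda>t. step_prod (grid_dd (spread t) (yd t)) v) \<longlongrightarrow> step_prod (divdiff_y y x) v) (at_right 0)"
    proof (rule tendsto_step_prod)
      fix j assume j: "0 < j" "j < length v"
      have "v ! (j - 1) \<le> v ! j"
        using j sorted_wrt_nth_less[OF sorted, of "j - 1" j] by (auto intro: less_imp_le)
      then show "((\<lambda>t. grid_dd (spread t) (yd t) (v ! (j - 1)) (v ! j)) \<longlongrightarrow> divdiff_y y x (v ! (j - 1)) (v ! j)) (at_right 0)"
        using bnd[of "v ! j"] j by (intro dd_lim) auto
    qed
    have le: "a $ r \<le> c $ r" "c $ r \<le> n $ r" for r
      using c ab by (auto simp: less_eq_vec_def intro: order_trans)
    define X where "X = case_option (map (\<lambda>j. y (grid_point x j)) v) (\<lambda>r. map (x r) [a $ r..<Suc (c $ r)])"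
    have "((\<lambda>t. dd_distinct g_fun (Z c v t)) \<longlongrightarrow> divdiff g_fun X) (at_right 0)"
    proof (rule dd_distinct_tendsto_along[OF partials_continuous_g])
      show "open (case i of None \<Rightarrow> V | Some j \<Rightarrow> A j)" for i
        using box V by (cases i) auto
      show "X i \<noteq> []" for i using le vne by (cases i) (auto simp: X_def)
      show "set (X i) \<subseteq> (case i of None \<Rightarrow> V | Some j \<Rightarrow> A j)" for i
      proof (cases i)
        case None
        then show ?thesis using bnd y_V grid_point_in_U by (auto simp: X_def)
      next
        case (Some r)
        then show ?thesis using le[of r] grid by (auto simp: X_def simp del: upt_Suc)
      qed
      have "(\<Sum>i\<in>UNIV. length (X i) - 1) = (length v - 1) + (\<Sum>r\<in>UNIV. c $ r - a $ r)"
        using le by (simp add: UNIV_option_conv sum.reindex X_def Suc_diff_le)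
      also have "\<dots> \<le> abs_index n"
        using c chains_between_length[OF v] abs_index_mono[of a c] abs_index_mono[of c b] abs_index_mono[OF ab(2)]
        by (simp add: abs_index_diff)
      finally show "(\<Sum>i\<in>UNIV. length (X i) - 1) \<le> abs_index n" .
      show "length (Z c v t i) = length (X i)" for t i
        by (cases i) (auto simp: X_def Z_def)
      show "\<forall>\<^sub>F t in at_right 0. \<forall>i. distinct (Z c v t i)"
        using ev_good
      proof eventually_elim
        case (elim t)
        have "inj_on (yd t) {0..n}" using yd[OF elim] by (simp add: perturbation_def)
        then have "inj_on (yd t) (set v)"
          by (rule inj_on_subset) (use bnd in0n in blast)
        then have "distinct (map (yd t) v)"
          using chains_between_distinct[OF v] by (simp add: distinct_map)
        moreover have "inj_on (spread t r) {a $ r..c $ r}" for r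
          using elim c ab by (intro spread_inj) (auto simp: good_def intro: order_trans)
        ultimately show ?case
          by (auto simp: Z_def distinct_map atLeastLessThanSuc_atLeastAtMost
              simp del: upt_Suc split: option.splits)
      qed
      show "((\<lambda>t. Z c v t i ! k) \<longlongrightarrow> X i ! k) (at_right 0)" if "k < length (X i)" for i k
        using that spread_tendsto yd_lim bnd
        by (cases i) (simp_all add: X_def Z_def del: upt_Suc)
    qed simp
    then show "((\<lambda>t. dd_distinct g_fun (Z c v t)) \<longlongrightarrow> divdiff_g g y x (\<lambda>r. [a $ r..<Suc (c $ r)]) v) (at_right 0)"
      by (simp add: divdiff_g_def X_def)
  qed
  moreover have "(E \<longlongrightarrow> 0) (at_right 0)"
  proof (rule close[where m = "\<lambda>_. 0"])
    fix t assume good: "good t"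
    then have t: "t > 0" by (simp add: good_def)
    have inj: "inj_on (spread t r) {a $ r..b $ r}" for r
      using t ab by (intro spread_inj)
    have "inj_on (yd t) {0..n}" using yd[OF good] by (simp add: perturbation_def)
    then have injy: "inj_on (yd t) {a..b}"
      by (rule inj_on_subset) (use ab in0n in \<open>auto intro: order_trans\<close>)
    have "grid_dd (spread t) (\<lambda>c. g (grid_point (spread t) c, yd t c)) a b
      = (\<Sum>c\<in>{a..b}. \<Sum>v\<in>chains_between c b.
        set_dd g_fun (case_option (yd t ` set v) (\<lambda>r. spread t r ` {a $ r..c $ r})) * step_prod (grid_dd (spread t) (yd t)) v)"
      using grid_dd_chain_rule[OF inj injy ab(1), of g_fun] by (simp add: grid_point_def)
    also have "\<dots> = E t"
      unfolding E_def
    proof (intro sum.cong refl arg_cong2[of _ _ _ _ "(*)"])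
      fix c v assume c: "c \<in> {a..b}" and v: "v \<in> chains_between c b"
      have le: "a $ r \<le> c $ r" for r using c by (auto simp: less_eq_vec_def)
      have "inj_on (spread t r) {a $ r..c $ r}" for r
        using c by (intro inj_on_subset[OF inj]) (auto simp: less_eq_vec_def intro: order_trans)
      moreover have "inj_on (yd t) (set v)"
        using chains_between_bounds[OF v] order_trans[of a c] c by (intro inj_on_subset[OF injy]) auto
      ultimately have "distinct (Z c v t i)" for i
        using chains_between_distinct[OF v]
        by (cases i) (simp_all add: Z_def distinct_map atLeastLessThanSuc_atLeastAtMost del: upt_Suc)
      moreover have "Z c v t i \<noteq> []" for i
        using v le by (cases i) (auto simp: Z_def chains_between_def)
      ultimately have "dd_distinct g_fun (Z c v t) = set_dd g_fun (\<lambda>i. set (Z c v t i))"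
        by (intro dd_distinct_eq_set_dd)
      also have "(\<lambda>i. set (Z c v t i)) = case_option (yd t ` set v) (\<lambda>r. spread t r ` {a $ r..c $ r})"
        by (auto simp: Z_def fun_eq_iff atLeastLessThanSuc_atLeastAtMost simp del: upt_Suc split: option.splits)
      finally show "set_dd g_fun (case_option (yd t ` set v) (\<lambda>r. spread t r ` {a $ r..c $ r})) = dd_distinct g_fun (Z c v t)" ..
    qed
    finally show "\<bar>E t - 0\<bar> < t" using yd[OF good] by (simp add: perturbation_def)
  qed simp
  ultimately show ?thesis
    using tendsto_unique[OF trivial_limit_at_right_real] by blast
qed

end

section \<open>Compatible tuples as axis-parallel initial paths\<close>

lemma unit_step_iff:
  fixes c d :: "nat ^ 'q::finite"
  shows "(\<exists>r. d = c + axis r 1) \<longleftrightarrow> c \<le> d \<and> abs_index d = Suc (abs_index c)"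
proof
  assume "\<exists>r. d = c + axis r 1"
  then obtain r where r: "d = c + axis r 1" by blast
  show "c \<le> d \<and> abs_index d = Suc (abs_index c)"
    by (auto simp: r less_eq_vec_def abs_index_def axis_def sum.distrib)
next
  assume cd: "c \<le> d \<and> abs_index d = Suc (abs_index c)"
  then have "(\<Sum>j\<in>UNIV. d $ j - c $ j) = 1"
    by (simp add: abs_index_diff)
  then have "\<exists>r\<in>UNIV. d $ r - c $ r = 1 \<and> (\<forall>j\<in>UNIV. r \<noteq> j \<longrightarrow> d $ j - c $ j = 0)"
    by (subst (asm) sum_eq_1_iff) auto
  then obtain r where r: "d $ r - c $ r = 1" "\<And>j. j \<noteq> r \<Longrightarrow> d $ j - c $ j = 0"
    by (metis UNIV_I)
  have "d $ j = c $ j + axis r 1 $ j" for j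
    using cd r(1) r(2)[of j] by (cases "j = r") (auto simp: less_eq_vec_def axis_def dest: spec[of _ j])
  then show "\<exists>r. d = c + axis r 1"
    by (auto simp: vec_eq_iff)
qed

lemma axis_one_eq_iff: "axis r (1::nat) = axis r' 1 \<longleftrightarrow> r = r'"
  by (auto simp: axis_def vec_eq_iff)

text \<open>The path from \<open>a\<close> that makes \<open>s r\<close> steps in the direction \<open>r\<close>, one direction after the other in
  increasing order. The truncated subtraction counts the steps made in direction \<open>r\<close> so far.\<close>

definition axis_path :: "nat ^ 'q::{finite,linorder} \<Rightarrow> ('q \<Rightarrow> nat) \<Rightarrow> nat \<Rightarrow> nat ^ 'q::{finite,linorder}" where
  "axis_path a s j = (\<chi> r. a $ r + min (s r) (j - sum s {..<r}))"

lemma sum_atMost_split: "sum s {..r} = sum s {..<r} + s r" for s :: "'q::{finite,linorder} \<Rightarrow> nat"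
  by (simp add: ivl_disj_un_singleton(2)[symmetric] del: ivl_disj_un_singleton)

lemma axis_path_0: "axis_path a s 0 = a"
  by (simp add: axis_path_def vec_eq_iff)

lemma axis_path_end: "axis_path a s (sum s UNIV) = (\<chi> r. a $ r + s r)"
proof -
  have "s r \<le> sum s UNIV - sum s {..<r}" for r
  proof -
    have "sum s {..r} \<le> sum s UNIV" by (intro sum_mono2) auto
    then show ?thesis by (simp add: sum_atMost_split)
  qed
  then show ?thesis by (simp add: axis_path_def vec_eq_iff min_absorb1)
qed

lemma axis_path_step:
  assumes "sum s {..<r} < j" "j \<le> sum s {..r}"
  shows "axis_path a s j = axis_path a s (j - 1) + axis r 1"
proof -
  have "min (s u) (j - sum s {..<u}) = min (s u) (j - 1 - sum s {..<u}) + (if u = r then 1 else 0)" for u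
  proof -
    consider "u < r" | "u = r" | "r < u" by force
    then show ?thesis
    proof cases
      case 1
      then have "sum s {..u} \<le> sum s {..<r}" by (intro sum_mono2) auto
      then have "sum s {..<u} + s u < j" using assms(1) by (simp add: sum_atMost_split)
      then show ?thesis using 1 by auto
    next
      case 2
      then show ?thesis using assms by (simp add: sum_atMost_split)
    next
      case 3
      then have "sum s {..r} \<le> sum s {..<u}" by (intro sum_mono2) auto
      then show ?thesis using 3 assms(2) by auto
    qed
  qed
  then show ?thesis by (simp add: axis_path_def vec_eq_iff axis_def)
qed

text \<open>Each step belongs to the block of one direction.\<close>

lemma axis_block_exists:
  fixes s :: "'q::{finite,linorder} \<Rightarrow> nat"
  assumes "0 < j" "j \<le> sum s UNIV"
  obtains r where "sum s {..<r} < j" "j \<le> sum s {..r}"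
proof -
  define R where "R = {r. j \<le> sum s {..r}}"
  have "{..Max UNIV} = (UNIV :: 'q set)" by auto
  then have "Max UNIV \<in> R" using assms(2) by (simp add: R_def)
  then have m: "Min R \<in> R" "\<And>r. r \<in> R \<Longrightarrow> Min R \<le> r"
    by (auto intro: Min_in)
  have "sum s {..<Min R} < j"
  proof (cases "{..<Min R} = {}")
    case False
    define r' where "r' = Max {..<Min R}"
    have r': "r' < Min R" using Max_in[OF _ False] by (simp add: r'_def)
    have "{..<Min R} = {..r'}"
      using r' by (auto simp: r'_def intro: le_less_trans)
    moreover have "r' \<notin> R" using m(2)[of r'] r' leD by blast
    ultimately show ?thesis by (simp add: R_def)
  qed (use assms(1) in simp)
  then show ?thesis using that[of "Min R"] m(1) by (simp add: R_def)
qed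

lemma axis_path_less_Suc: "j < sum s UNIV \<Longrightarrow> axis_path a s j < axis_path a s (Suc j)"
proof -
  assume "j < sum s UNIV"
  then obtain r where "sum s {..<r} < Suc j" "Suc j \<le> sum s {..r}"
    using axis_block_exists[of "Suc j" s] by auto
  then have "axis_path a s (Suc j) = axis_path a s j + axis r 1"
    using axis_path_step[of s r "Suc j" a] by simp
  then have "axis_path a s j \<le> axis_path a s (Suc j) \<and> abs_index (axis_path a s (Suc j)) = Suc (abs_index (axis_path a s j))"
    unfolding unit_step_iff[symmetric] by blast
  then show "axis_path a s j < axis_path a s (Suc j)" by (auto simp: less_le)
qed

lemma axis_path_strict_mono:
  assumes "i < j" "j \<le> sum s UNIV"
  shows "axis_path a s i < axis_path a s j"
  using assms
proof (induction j)
  case (Suc j)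
  then show ?case
    using axis_path_less_Suc[of j s a] by (cases "i = j") (auto intro: less_trans)
qed simp

text \<open>A compatible tuple determines the beginning of the chain.\<close>

lemma compatible_axis_path:
  assumes u: "u \<in> chains_between a b" and st: "compatible u s t"
  shows "j \<le> sum s UNIV \<Longrightarrow> u ! j = axis_path a s j"
proof (induction j)
  case 0
  then show ?case using u by (auto simp: axis_path_0 chains_between_def hd_conv_nth)
next
  case (Suc j)
  then obtain r where r: "sum s {..<r} < Suc j" "Suc j \<le> sum s {..r}"
    using axis_block_exists[of "Suc j" s] by auto
  then have "u ! Suc j = u ! j + axis r 1"
    using st unfolding compatible_def by fastforce
  then show ?case
    using Suc axis_path_step[OF r, of a] by simp
qed

lemma compatible_length:
  assumes "u \<in> chains_between a b" "compatible u s t"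
  shows "sum s UNIV + t = length u - 1" "sum s UNIV < length u"
proof -
  show eq: "sum s UNIV + t = length u - 1" using assms(2) by (simp add: compatible_def)
  have "0 < length u" using assms(1) by (simp add: chains_between_def)
  then show "sum s UNIV < length u" using eq by linarith
qed

lemma compatible_split:
  fixes a b :: "nat ^ 'q::{finite,linorder}"
  assumes u: "u \<in> chains_between a b" and st: "compatible u s t"
  defines "c \<equiv> \<chi> r. a $ r + s r" and "v \<equiv> drop (sum s UNIV) u"
  shows "c \<in> {a..b}" "v \<in> chains_between c b"
    "u = map (axis_path a s) [0..<sum s UNIV] @ v" "length v = Suc t"
proof -
  note len = compatible_length[OF u st] and path = compatible_axis_path[OF u st]
  have c: "u ! sum s UNIV = c"
    unfolding c_def axis_path_end[symmetric] by (rule path) simp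
  show "c \<in> {a..b}"
    using chains_between_bounds[OF u, of c] c len nth_mem[of "sum s UNIV" u] by auto
  have "sorted_wrt (<) u" "last u = b" using u by (auto simp: chains_between_def)
  then show "v \<in> chains_between c b"
    using len c by (auto simp: chains_between_def v_def sorted_wrt_drop hd_drop_conv_nth)
  show "length v = Suc t" using len by (simp add: v_def)
  have "take (sum s UNIV) u = map (axis_path a s) [0..<sum s UNIV]"
    using len path by (intro nth_equalityI) auto
  then show "u = map (axis_path a s) [0..<sum s UNIV] @ v"
    unfolding v_def by (metis append_take_drop_id)
qed

lemma compatible_glue:
  fixes a b :: "nat ^ 'q::{finite,linorder}"
  assumes c: "a \<le> c" "c \<le> b" and v: "v \<in> chains_between c b"
  defines "s \<equiv> \<lambda>r. c $ r - a $ r"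
  defines "u \<equiv> map (axis_path a s) [0..<sum s UNIV] @ v"
  shows "u \<in> chains_between a b" "compatible u s (length v - 1)" "drop (sum s UNIV) u = v"
    "(\<chi> r. a $ r + s r) = c"
proof -
  show cs: "(\<chi> r. a $ r + s r) = c"
    using c by (auto simp: s_def vec_eq_iff less_eq_vec_def)
  have v': "v \<noteq> []" "v ! 0 = c" "last v = b" "sorted_wrt (<) v"
    using v by (auto simp: chains_between_def hd_conv_nth)
  have uj: "u ! j = axis_path a s j" if "j \<le> sum s UNIV" for j
    using that v' cs axis_path_end[of a s] by (cases "j = sum s UNIV") (auto simp: u_def nth_append)
  show "drop (sum s UNIV) u = v" by (simp add: u_def)
  have "sorted_wrt (<) (map (axis_path a s) [0..<sum s UNIV])"
    using axis_path_strict_mono[of _ _ s a] by (auto simp: sorted_wrt_iff_nth_less)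
  moreover have "axis_path a s i < d" if "i < sum s UNIV" "d \<in> set v" for i d
    using axis_path_strict_mono[of i "sum s UNIV" s a] that chains_between_bounds(1)[OF v that(2)]
    unfolding axis_path_end cs by (auto intro: less_le_trans)
  ultimately have "sorted_wrt (<) u"
    using v' by (auto simp: u_def sorted_wrt_append)
  moreover have "u \<noteq> []" "last u = b" using v' by (auto simp: u_def)
  moreover have "hd u = a"
    using \<open>u \<noteq> []\<close> uj[of 0] by (simp add: hd_conv_nth axis_path_0)
  ultimately show "u \<in> chains_between a b" by (simp add: chains_between_def)
  show "compatible u s (length v - 1)"
    unfolding compatible_def
  proof (intro conjI allI impI)
    show "sum s UNIV + (length v - 1) = length u - 1"
      using v' by (cases v) (auto simp: u_def)
    fix r j assume j: "sum s {..<r} < j \<and> j \<le> sum s {..r}"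
    have "sum s {..r} \<le> sum s UNIV" by (intro sum_mono2) auto
    then have "j \<le> sum s UNIV" "j - 1 \<le> sum s UNIV"
      using j by linarith+
    then show "u ! j = u ! (j - 1) + axis r 1"
      using j by (simp only: uj axis_path_step[of s r j a])
  qed
qed

lemma finite_compatible: "finite {(s, t). compatible u s t}"
proof (rule finite_subset)
  show "{(s, t). compatible u s t} \<subseteq> PiE UNIV (\<lambda>_. {..length u}) \<times> {..length u}"
  proof
    fix p assume "p \<in> {(s, t). compatible u s t}"
    then obtain s t where p: "p = (s, t)" and "compatible u s t" by blast
    then have st: "sum s UNIV + t = length u - 1" by (simp add: compatible_def)
    have "s r \<le> length u" for r
    proof -
      have "s r \<le> sum s UNIV" by (rule member_le_sum) auto
      then show ?thesis using st by linarith
    qed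
    then show "p \<in> PiE UNIV (\<lambda>_. {..length u}) \<times> {..length u}"
      using st by (auto simp: p)
  qed
qed (simp add: finite_PiE)

text \<open>A chain from \<open>a\<close> to \<open>b\<close> with a compatible tuple is the same as an index \<open>c\<close> with a chain from \<open>c\<close> to \<open>b\<close>: the
  beginning of the chain is the axis-parallel path from \<open>a\<close> to \<open>c\<close>. This matches the definition of the
  symbol \<open>curly\<close> with the double sum of the chain rule.\<close>

lemma sum_compatible:
  fixes a b :: "nat ^ 'q::{finite,linorder}"
  shows "(\<Sum>u\<in>chains_between a b. \<Sum>(s, t) | compatible u s t. H (\<chi> r. a $ r + s r) (drop (sum s UNIV) u))
    = (\<Sum>c\<in>{a..b}. \<Sum>v\<in>chains_between c b. H c v)"
proof -
  have fin: "finite {a..b}" "finite (chains_between c b)" for c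
    by (rule finite_multi_index_interval, intro finite_chains_between finite_multi_index_interval)
  let ?U = "SIGMA u:chains_between a b. {(s, t). compatible u s t}" and ?C = "SIGMA c:{a..b}. chains_between c b"
  let ?split = "\<lambda>(u, s, t). (\<chi> r. a $ r + s r, drop (sum s UNIV) u)"
  let ?glue = "\<lambda>(c, v). let s = (\<lambda>r. c $ r - a $ r) in
    (map (axis_path a s) [0..<sum s UNIV] @ v, s, length v - 1)"
  have "(\<Sum>(u, s, t)\<in>?U. H (\<chi> r. a $ r + s r) (drop (sum s UNIV) u)) = (\<Sum>(c, v)\<in>?C. H c v)"
  proof (rule sum.reindex_bij_witness[where j = ?split and i = ?glue])
    fix p assume "p \<in> ?U"
    then obtain u s t where p: "p = (u, s, t)" "u \<in> chains_between a b" "compatible u s t" by auto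
    note sp = compatible_split[OF p(2,3)]
    have "(\<lambda>r. (\<chi> r. a $ r + s r) $ r - a $ r) = s" by auto
    then show "?glue (?split p) = p"
      using sp(3,4) unfolding p(1) prod.case Let_def by simp
    show "?split p \<in> ?C"
      using sp(1,2) by (simp add: p(1))
  next
    fix p assume "p \<in> ?C"
    then obtain c v where p: "p = (c, v)" "a \<le> c" "c \<le> b" "v \<in> chains_between c b" by auto
    note gl = compatible_glue[OF p(2,3,4)]
    show "?split (?glue p) = p"
      unfolding p(1) prod.case Let_def gl(3,4) ..
    show "?glue p \<in> ?U"
      using gl(1,2) unfolding p(1) prod.case Let_def by simp
  qed auto
  moreover have "(\<Sum>u\<in>chains_between a b. \<Sum>p\<in>{(s, t). compatible u s t}. F u p)
      = (\<Sum>(u, p)\<in>?U. F u p)" for F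
    using fin finite_compatible by (intro sum.Sigma ballI)
  from this[of "\<lambda>u (s, t). H (\<chi> r. a $ r + s r) (drop (sum s UNIV) u)"]
  have "(\<Sum>u\<in>chains_between a b. \<Sum>(s, t) | compatible u s t. H (\<chi> r. a $ r + s r) (drop (sum s UNIV) u))
    = (\<Sum>(u, s, t)\<in>?U. H (\<chi> r. a $ r + s r) (drop (sum s UNIV) u))" .
  moreover have "(\<Sum>c\<in>{a..b}. \<Sum>v\<in>chains_between c b. H c v)
      = (\<Sum>(c, v)\<in>?C. H c v)"
    using fin by (simp add: sum.Sigma)
  ultimately show ?thesis by (simp only:)
qed

section \<open>The recursion and its solution\<close>

lemma chains_between_cover:
  assumes "a < b" "{a<..b} = {b}"
  shows "chains_between a b = {[a, b]}"
  using chains_between_less[OF assms(1)] by (simp add: assms(2) chains_between_self)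

locale implicit_grid_solvable = implicit_grid A U V g y n x
  for A :: "'q::{finite,linorder} \<Rightarrow> real set" and U V g y n x +
  assumes denominators: "\<And>i k. i < k \<Longrightarrow> k \<le> n \<Longrightarrow> divdiff_g g y x (\<lambda>r. [i $ r]) [i, k] \<noteq> 0"
begin

definition Y where "Y = divdiff_y y x"

text \<open>Unit steps get the weight \<open>1\<close> because their divided differences are already among the factors
  of \<open>curly\<close>.\<close>

definition Y_long where "Y_long c d = (if abs_index d = Suc (abs_index c) then 1 else Y c d)"

definition gdd where "gdd I J = divdiff_g g y x I J"

text \<open>For a unit step, the identity has only two terms.\<close>

lemma Y_unit_step:
  assumes b: "b = a + axis r 1" and bn: "b \<le> n"
  shows "Y a b = - (gdd (\<lambda>u. if u < r then [a $ u] else if u = r then [a $ r, b $ r] else [b $ u]) [b]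
      / gdd (\<lambda>u. [a $ u]) [a, b])"
proof -
  have ab: "a \<le> b" "abs_index b = Suc (abs_index a)"
    using unit_step_iff[of b a] b by blast+
  then have lt: "a < b" by (auto simp: less_le)
  have cover: "c = a \<or> c = b" if "a \<le> c" "c \<le> b" for c
  proof -
    have "abs_index a \<le> abs_index c" "abs_index c \<le> abs_index b"
      using that abs_index_mono by auto
    then have "abs_index c = abs_index a \<or> abs_index c = abs_index b"
      using ab(2) by linarith
    then show ?thesis using abs_index_eqD that by metis
  qed
  have two: "{a..b} = {a, b}"
    using lt by (auto dest: cover)
  have "c = b" if "a < c" "c \<le> b" for c
    using cover[OF less_imp_le[OF that(1)] that(2)] that(1) by auto
  then have "{a<..b} = {b}"
    using lt by auto
  then have one: "chains_between a b = {[a, b]}" using chains_between_cover[OF lt] by simp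
  have "gdd (\<lambda>r. [a $ r..<Suc (a $ r)]) [a, b] * Y a b + gdd (\<lambda>r. [a $ r..<Suc (b $ r)]) [b] = 0"
    using implicit_chain_identity[OF ab(1) bn] lt unfolding two
    by (simp add: one chains_between_self gdd_def Y_def del: upt_Suc)
  moreover have "(\<lambda>r. [a $ r..<Suc (a $ r)]) = (\<lambda>u. [a $ u])" by auto
  moreover have "(\<lambda>r. [a $ r..<Suc (b $ r)])
      = (\<lambda>u. if u < r then [a $ u] else if u = r then [a $ r, b $ r] else [b $ u])"
    by (auto simp: fun_eq_iff b axis_def upt_rec)
  ultimately have "gdd (\<lambda>u. [a $ u]) [a, b] * Y a b
      = - gdd (\<lambda>u. if u < r then [a $ u] else if u = r then [a $ r, b $ r] else [b $ u]) [b]"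
    by simp
  then show ?thesis
    using denominators[OF lt bn] by (simp add: gdd_def field_simps)
qed

text \<open>The unit steps after the initial path contribute their divided differences through \<open>curly\<close>, by
  \<open>Y_unit_step\<close>, and the other ones through \<open>Y_long\<close>; the steps of the initial path contribute nothing. So
  together they give the product over all steps after the initial path.\<close>

lemma curly_mult_step_prod:
  assumes ab: "a < b" "b \<le> n" and u: "u \<in> chains_between a b"
  shows "curly g y x u * step_prod Y_long u =
    (\<Sum>(s, t) | compatible u s t.
      - (gdd (\<lambda>r. [a $ r..<Suc (a $ r + s r)]) (drop (sum s UNIV) u) / gdd (\<lambda>r. [a $ r]) [a, b])
      * step_prod Y (drop (sum s UNIV) u))"
proof -
  have u': "u \<noteq> []" "u ! 0 = a" "u ! (length u - 1) = b" "sorted_wrt (<) u"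
    using u by (auto simp: chains_between_def hd_conv_nth last_conv_nth)
  have step: "u ! (j - 1) < u ! j" if "0 < j" "j < length u" for j
    using that u'(4) by (intro sorted_wrt_nth_less) auto
  have uin: "u ! j \<le> n" if "j < length u" for j
    using chains_between_bounds[OF u nth_mem[OF that]] ab by (blast intro: order_trans)
  define Q where "Q = (\<lambda>r j. - (gdd (\<lambda>i. if i < r then [u ! (j - 1) $ i]
         else if i = r then [u ! (j - 1) $ r, u ! j $ r] else [u ! j $ i]) [u ! j]
       / gdd (\<lambda>i. [u ! (j - 1) $ i]) [u ! (j - 1), u ! j]))"
  have term_eq: "(let S = \<Sum>r\<in>UNIV. s r in
        (- (gdd (\<lambda>r. [u ! 0 $ r ..< Suc (u ! 0 $ r + s r)]) (map ((!) u) [S ..< Suc (S + t)])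
            / gdd (\<lambda>r. [u ! 0 $ r]) [u ! 0, u ! (length u - 1)]))
        * (\<Prod>r\<in>UNIV. \<Prod>j | S + 1 \<le> j \<and> j \<le> S + t \<and> u ! j = u ! (j - 1) + axis r 1. Q r j))
      * step_prod Y_long u
    = - (gdd (\<lambda>r. [a $ r..<Suc (a $ r + s r)]) (drop (sum s UNIV) u) / gdd (\<lambda>r. [a $ r]) [a, b])
      * step_prod Y (drop (sum s UNIV) u)" if st: "compatible u s t" for s t
  proof -
    define S where "S = sum s UNIV"
    note len = compatible_length[OF u st, folded S_def]
    have dropS: "map ((!) u) [S ..< Suc (S + t)] = drop S u"
      using len by (intro nth_equalityI) (auto simp del: upt_Suc)
    let ?J = "{S + 1..S + t}"
    have unit: "(\<Prod>r\<in>UNIV. if u ! j = u ! (j - 1) + axis r 1 then Q r j else 1) * Y_long (u ! (j - 1)) (u ! j)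
        = Y (u ! (j - 1)) (u ! j)" if j: "j \<in> ?J" for j
    proof (cases "\<exists>r. u ! j = u ! (j - 1) + axis r 1")
      case True
      then obtain r where r: "u ! j = u ! (j - 1) + axis r 1" by blast
      have jl: "j < length u" using j len by auto
      have "(\<Prod>r'\<in>UNIV. if u ! j = u ! (j - 1) + axis r' 1 then Q r' j else 1)
          = (\<Prod>r'\<in>UNIV. if r' = r then Q r' j else 1)"
        by (intro prod.cong refl) (auto simp: r axis_one_eq_iff[unfolded One_nat_def])
      also have "\<dots> = Y (u ! (j - 1)) (u ! j)"
        unfolding Y_unit_step[OF r uin[OF jl]] by (simp add: Q_def)
      finally show ?thesis
        using True unit_step_iff[of "u ! j" "u ! (j - 1)"] by (simp add: Y_long_def)
    next
      case False
      have "0 < j" "j < length u" using j len by (simp_all, linarith)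
      then have "u ! (j - 1) \<le> u ! j" by (intro less_imp_le step)
      then have "abs_index (u ! j) \<noteq> Suc (abs_index (u ! (j - 1)))"
        using False unit_step_iff[of "u ! j" "u ! (j - 1)"] by blast
      then show ?thesis using False by (simp add: Y_long_def)
    qed
    have "(\<Prod>r\<in>UNIV. \<Prod>j | S + 1 \<le> j \<and> j \<le> S + t \<and> u ! j = u ! (j - 1) + axis r 1. Q r j)
        = (\<Prod>r\<in>UNIV. \<Prod>j\<in>?J. if u ! j = u ! (j - 1) + axis r 1 then Q r j else 1)"
      by (rule prod.cong[OF refl], subst prod.inter_filter[symmetric]) (auto intro!: prod.cong)
    also have "\<dots> = (\<Prod>j\<in>?J. \<Prod>r\<in>UNIV. if u ! j = u ! (j - 1) + axis r 1 then Q r j else 1)"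
      by (rule prod.swap)
    finally have Q: "(\<Prod>r\<in>UNIV. \<Prod>j | S + 1 \<le> j \<and> j \<le> S + t \<and> u ! j = u ! (j - 1) + axis r 1. Q r j)
        = (\<Prod>j\<in>?J. \<Prod>r\<in>UNIV. if u ! j = u ! (j - 1) + axis r 1 then Q r j else 1)" .
    have "step_prod Y_long u = (\<Prod>j\<in>{1..<length u}. Y_long (u ! (j - 1)) (u ! j))"
      by (rule step_prod_conv_prod)
    also have "\<dots> = (\<Prod>j\<in>?J. Y_long (u ! (j - 1)) (u ! j))"
    proof (rule prod.mono_neutral_right)
      show "?J \<subseteq> {1..<length u}" using len by auto
      show "\<forall>j\<in>{1..<length u} - ?J. Y_long (u ! (j - 1)) (u ! j) = 1"
      proof
        fix j assume "j \<in> {1..<length u} - ?J"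
        then have j: "0 < j" "j \<le> S" using len by auto
        obtain r where "sum s {..<r} < j" "j \<le> sum s {..r}"
          using axis_block_exists[of j s] j unfolding S_def by blast
        then have "u ! j = u ! (j - 1) + axis r 1" using st by (auto simp: compatible_def)
        then show "Y_long (u ! (j - 1)) (u ! j) = 1"
          using unit_step_iff[of "u ! j" "u ! (j - 1)"] by (auto simp: Y_long_def)
      qed
    qed simp
    finally have "(\<Prod>r\<in>UNIV. \<Prod>j | S + 1 \<le> j \<and> j \<le> S + t \<and> u ! j = u ! (j - 1) + axis r 1. Q r j) * step_prod Y_long u
        = (\<Prod>j\<in>?J. Y (u ! (j - 1)) (u ! j))"
      unfolding Q by (simp only: prod.distrib[symmetric] unit cong: prod.cong)
    also have "\<dots> = (\<Prod>j\<in>{1..<length (drop S u)}. Y (drop S u ! (j - 1)) (drop S u ! j))"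
      using len by (intro prod.reindex_bij_witness[of _ "\<lambda>j. j + S" "\<lambda>j. j - S"]) auto
    also have "\<dots> = step_prod Y (drop S u)"
      by (rule step_prod_conv_prod[symmetric])
    finally show ?thesis
      unfolding Let_def S_def[symmetric] dropS u' by (simp add: mult.assoc)
  qed
  show ?thesis
    unfolding curly_def gdd_def[symmetric] sum_distrib_right
    by (rule sum.cong[OF refl], erule CollectE, erule case_prodE,
        simp only: prod.case term_eq[unfolded Q_def])
qed

text \<open>In \<open>implicit_chain_identity\<close>, the divided difference \<open>Y a b\<close> occurs only in the term of the one-step chain
  \<open>[a, b]\<close>, with the coefficient \<open>\<delta>\<close>. Solve for it. The other terms are those in which initial path and
  chain together have at least three points.\<close>

theorem Y_recursion:
  assumes ab: "a \<le> b" "b \<le> n" and size: "abs_index a + 2 \<le> abs_index b"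
  shows "Y a b = (\<Sum>u | u \<in> chains_between a b \<and> 3 \<le> length u. curly g y x u * step_prod Y_long u)"
proof -
  have lt: "a < b" using ab size by (auto simp: less_le)
  define \<delta> where "\<delta> = gdd (\<lambda>r. [a $ r]) [a, b]"
  have \<delta>: "\<delta> \<noteq> 0" unfolding \<delta>_def gdd_def by (rule denominators[OF lt ab(2)])
  define K where "K = (\<lambda>c v. gdd (\<lambda>r. [a $ r..<Suc (c $ r)]) v * step_prod Y v)"
  define long where "long = (\<lambda>(c :: nat ^ 'q::{finite,linorder}) (v :: (nat ^ 'q::{finite,linorder}) list).
    3 \<le> (abs_index c - abs_index a) + length v)"
  define P where "P = (SIGMA c:{a..b}. chains_between c b)"
  have fin: "finite {a..b}" "finite (chains_between c b)" for c
    by (rule finite_multi_index_interval, intro finite_chains_between finite_multi_index_interval)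
  then have finP: "finite P" by (auto simp: P_def)
  \<comment> \<open>The hypothesis on \<open>b\<close> excludes the chain \<open>[b]\<close> after an initial path of a single step.\<close>
  have short: "(c, v) = (a, [a, b])" if "(c, v) \<in> P" "\<not> long c v" for c v
  proof -
    have c: "a \<le> c" "c \<le> b" and v: "v \<in> chains_between c b" using that by (auto simp: P_def)
    have vne: "v \<noteq> []" and ends: "hd v = c" "last v = b" using v by (auto simp: chains_between_def)
    have le2: "abs_index c - abs_index a + length v \<le> 2" using that(2) by (simp add: long_def)
    have "length v \<noteq> 1"
    proof
      assume l: "length v = 1"
      then have "c = b" using ends by (cases v) auto
      then show False using le2 l size by simp
    qed
    moreover have "length v \<noteq> 0" using vne by simp
    ultimately have l: "length v = 2" using le2 by linarith
    then have "abs_index c = abs_index a" using le2 abs_index_mono[OF c(1)] by simp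
    then have "c = a" using abs_index_eqD[OF c(1)] by simp
    moreover have "v = [c, b]" using l ends by (auto simp: numeral_2_eq_2 length_Suc_conv)
    ultimately show ?thesis by simp
  qed
  have trivial: "(a, [a, b]) \<in> P" "\<not> long a [a, b]"
    using lt by (auto simp: P_def long_def chains_between_def)
  have "0 = (\<Sum>(c, v)\<in>P. K c v)"
    using implicit_chain_identity[OF ab] fin unfolding P_def K_def gdd_def Y_def by (simp add: sum.Sigma)
  also have "\<dots> = (\<Sum>(c, v)\<in>P - {(a, [a, b])}. K c v) + K a [a, b]"
    using finP trivial(1) by (simp add: sum.remove)
  also have "(\<Sum>(c, v)\<in>P - {(a, [a, b])}. K c v) = (\<Sum>(c, v)\<in>P. if long c v then K c v else 0)"
  proof (rule sum.mono_neutral_cong_left[OF finP])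
    show "\<forall>p\<in>P - (P - {(a, [a, b])}). (case p of (c, v) \<Rightarrow> if long c v then K c v else 0) = 0"
      using trivial(2) by auto
    fix p assume p: "p \<in> P - {(a, [a, b])}"
    obtain c v where cv: "p = (c, v)" by (cases p)
    then have "long c v" using p short[of c v] by blast
    then show "(case p of (c, v) \<Rightarrow> K c v) = (case p of (c, v) \<Rightarrow> if long c v then K c v else 0)"
      by (simp add: cv)
  qed blast
  also have "K a [a, b] = \<delta> * Y a b"
    by (simp add: K_def \<delta>_def)
  finally have Y: "Y a b = (\<Sum>(c, v)\<in>P. if long c v then - (K c v / \<delta>) else 0)"
  proof -
    assume "0 = (\<Sum>(c, v)\<in>P. if long c v then K c v else 0) + \<delta> * Y a b"
    then have "Y a b = - ((\<Sum>(c, v)\<in>P. if long c v then K c v else 0) / \<delta>)"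
      using \<delta> by (simp add: field_simps)
    also have "\<dots> = (\<Sum>(c, v)\<in>P. if long c v then - (K c v / \<delta>) else 0)"
      unfolding sum_divide_distrib sum_negf[symmetric] by (intro sum.cong) auto
    finally show ?thesis .
  qed
  have "(\<Sum>u | u \<in> chains_between a b \<and> 3 \<le> length u. curly g y x u * step_prod Y_long u)
      = (\<Sum>u\<in>chains_between a b. if 3 \<le> length u then curly g y x u * step_prod Y_long u else 0)"
    using fin by (simp add: sum.inter_filter)
  also have "\<dots> = (\<Sum>u\<in>chains_between a b. \<Sum>(s, t) | compatible u s t.
      (\<lambda>c v. if long c v then - (K c v / \<delta>) else 0) (\<chi> r. a $ r + s r) (drop (sum s UNIV) u))"
  proof (intro sum.cong refl)
    fix u assume u: "u \<in> chains_between a b"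
    have "long (\<chi> r. a $ r + s r) (drop (sum s UNIV) u) \<longleftrightarrow> 3 \<le> length u" if "compatible u s t" for s t
    proof -
      have "abs_index (\<chi> r. a $ r + s r) = abs_index a + sum s UNIV"
        by (simp add: abs_index_def sum.distrib)
      then show ?thesis
        using compatible_length[OF u that] by (simp add: long_def)
    qed
    then show "(if 3 \<le> length u then curly g y x u * step_prod Y_long u else 0)
        = (\<Sum>(s, t) | compatible u s t.
      (\<lambda>c v. if long c v then - (K c v / \<delta>) else 0) (\<chi> r. a $ r + s r) (drop (sum s UNIV) u))"
      unfolding curly_mult_step_prod[OF lt ab(2) u]
      by (cases "3 \<le> length u") (auto simp: K_def \<delta>_def intro!: sum.cong sum.neutral)
  qed
  also have "\<dots> = (\<Sum>c\<in>{a..b}. \<Sum>v\<in>chains_between c b. if long c v then - (K c v / \<delta>) else 0)"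
    by (rule sum_compatible)
  also have "\<dots> = Y a b"
    unfolding Y P_def using fin by (simp add: sum.Sigma)
  finally show ?thesis by simp
qed

text \<open>Both sides satisfy the same recursion and agree on unit steps.\<close>

theorem Y_long_eq_partition_sum:
  assumes "a < b" "b \<le> n"
  shows "Y_long a b = partition_sum (curly g y x) a b"
  using assms
proof (induction "abs_index b - abs_index a" arbitrary: a b rule: less_induct)
  case less
  have ab: "a \<le> b" using less.prems by simp
  have "abs_index a < abs_index b" using less.prems by (intro abs_index_strict_mono)
  then consider "abs_index b = Suc (abs_index a)" | "abs_index a + 2 \<le> abs_index b" by linarith
  then show ?case
  proof cases
    case 1
    then show ?thesis using ab by (simp add: Y_long_def partition_sum_unit_step)
  next
    case 2
    have "Y_long a b = Y a b" using 2 by (simp add: Y_long_def)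
    also have "\<dots> = (\<Sum>u | u \<in> chains_between a b \<and> 3 \<le> length u. curly g y x u * step_prod Y_long u)"
      by (rule Y_recursion[OF ab less.prems(2) 2])
    also have "\<dots> = (\<Sum>u | u \<in> chains_between a b \<and> 3 \<le> length u. curly g y x u * step_prod (partition_sum (curly g y x)) u)"
    proof (intro sum.cong refl arg_cong2[of _ _ _ _ "(*)"] step_prod_cong)
      fix u j assume u: "u \<in> {u. u \<in> chains_between a b \<and> 3 \<le> length u}" and j: "0 < j" "j < length u"
      then have uc: "u \<in> chains_between a b" and len: "3 \<le> length u" by auto
      have s: "sorted_wrt (<) u" and ends: "u ! 0 = a" "u ! (length u - 1) = b"
        using uc by (auto simp: chains_between_def hd_conv_nth last_conv_nth)
      have lt: "abs_index (u ! i) < abs_index (u ! k)" if "i < k" "k < length u" for i k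
        using that by (intro abs_index_strict_mono sorted_wrt_nth_less[OF s])
      have "abs_index (u ! j) - abs_index (u ! (j - 1)) < abs_index b - abs_index a"
      proof (cases "j = 1")
        case True
        have "1 < length u - 1" "length u - 1 < length u" using len by linarith+
        from lt[OF this] lt[of 0 1] show ?thesis using True len ends by simp
      next
        case False
        have "abs_index (u ! j) \<le> abs_index b"
          using chains_between_bounds[OF uc nth_mem[OF j(2)]] by (intro abs_index_mono)
        moreover have "abs_index (u ! 0) < abs_index (u ! (j - 1))" "abs_index (u ! (j - 1)) < abs_index (u ! j)"
          using False j by (intro lt; linarith)+
        ultimately show ?thesis using ends by simp
      qed
      moreover have "u ! (j - 1) < u ! j" using j by (intro sorted_wrt_nth_less[OF s]) auto
      moreover have "u ! j \<le> n"
        using chains_between_bounds[OF uc nth_mem[OF j(2)]] less.prems by (blast intro: order_trans)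
      ultimately show "Y_long (u ! (j - 1)) (u ! j) = partition_sum (curly g y x) (u ! (j - 1)) (u ! j)"
        by (rule less.hyps)
    qed
    also have "\<dots> = partition_sum (curly g y x) a b"
      by (rule partition_sum_rec[OF ab 2, symmetric])
    finally show ?thesis .
  qed
qed

end

theorem theorem3:
  fixes A :: "'q::{finite,linorder} \<Rightarrow> real set" and U :: "(real ^ 'q::{finite,linorder}) set" and V :: "real set"
    and g :: "(real ^ 'q::{finite,linorder}) \<times> real \<Rightarrow> real" and y :: "real ^ 'q::{finite,linorder} \<Rightarrow> real"
    and n :: "nat ^ 'q::{finite,linorder}" and x :: "'q::{finite,linorder} \<Rightarrow> nat \<Rightarrow> real"
  assumes box: "\<And>j. open (A j) \<and> is_interval (A j)" "U = {u. \<forall>j. u $ j \<in> A j}"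
    and V: "open V" "is_interval V"
    and smooth: "Ck_on (abs_index n) g (U \<times> V)" "Ck_on (abs_index n) y U"
    and y_V: "\<And>u. u \<in> U \<Longrightarrow> y u \<in> V"
    and implicit: "\<And>u. u \<in> U \<Longrightarrow> g (u, y u) = 0"
    and nondegenerate: "\<And>u. u \<in> U \<Longrightarrow> deriv (\<lambda>t. g (u, t)) (y u) \<noteq> 0"
    and grid: "\<And>j i. i \<le> n $ j \<Longrightarrow> x j i \<in> A j"
    and increasing: "\<And>j i k. i \<le> k \<Longrightarrow> k \<le> n $ j \<Longrightarrow> x j i \<le> x j k"
    and denominators: "\<And>i k. i < k \<Longrightarrow> k \<le> n \<Longrightarrow> divdiff_g g y x (\<lambda>r. [i $ r]) [i, k] \<noteq> 0"
    and size: "abs_index n \<ge> 2"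
  shows "divdiff_y y x 0 n =
           (\<Sum>p\<in>chains_to n. \<Sum>D\<in>polygon_partitions (abs_index n). \<Prod>v\<in>faces p D. curly g y x v)"
proof -
  interpret implicit_grid_solvable A U V g y n x
    by unfold_locales (use assms in auto)
  have "0 < n"
    using size zero_le_index[of n] by (auto simp: less_le abs_index_def)
  then have "Y_long 0 n = partition_sum (curly g y x) 0 n"
    by (intro Y_long_eq_partition_sum) auto
  moreover have "Y_long 0 n = divdiff_y y x 0 n"
    using size by (simp add: Y_long_def Y_def abs_index_def)
  ultimately show ?thesis
    using sum_partitions_eq_partition_sum[OF size] by simp
qed

end
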